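(* Assume (H1), (H2), (H3), and let $L\in\mathbb R$. Then the number of positive eigenvalues of $\mathcal L_L$ (counted with multiplicity) is equal to the number of conjugate points in $(-\infty,L)$ counted with multiplicity, i.e. $\sum_{x\in(-\infty,L)}\dim\big(\mathbb E^u_-(x,0)\cap\ell_*^{sand}\big)$.
   Context: Fix real $\nu,\mu$, $f(u)=\nu u^2-u^3-\mu u$. (H1): $\varphi$ is a smooth stationary solution of $u_t=-(1+\partial_x^2)^2u+f(u)$ with $\varphi\to0$ at $\pm\infty$. (H2): $f'(0)<0$. For $s\in\mathbb R$, $\mathcal L_s=-\partial_x^4-2\partial_x^2-1+f'(\varphi(x))$ on $(-\infty,s]$ with domain $\{u\in H^4((-\infty,s]):u(s)=u'(s)=0\}$. With $q=(u,u_{xx},u_{xxx}+2u_x,u_x)$, $\mathcal Lu=\lambda u$ becomes $q'=B(x,\lambda)q$, $B(x,\lambda)=\begin{pmatrix}0&0&0&1\\0&0&1&-2\\-\lambda-1+f'(\varphi(x))&0&0&0\\0&1&0&0\end{pmatrix}$. $\mathbb E^u_-(x,\lambda)$ is the set of values $q(x)$ of solutions with $q(y)\to0$ as $y\to-\infty$. $\ell_*^{sand}=\{q\in\mathbb R^4:q_1=q_4=0\}$. A conjugate point is an $x$ with $\mathbb E^u_-(x,0)\cap\ell_*^{sand}\neq\{0\}$, multiplicity being the dimension of the intersection. (H3): $\dim(\mathbb E^u_-(x,0)\cap\ell_*^{sand})\le1$ for all $x$. *)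

theory Defs
  imports "HOL-Analysis.Analysis" "HOL-Library.Function_Algebras" "HOL-Library.Extended_Nat"
begin

definition fnl :: "real \<Rightarrow> real \<Rightarrow> real \<Rightarrow> real" where
  "fnl \<nu> \<mu> u = \<nu> * u^2 - u^3 - \<mu> * u"

definition fnl' :: "real \<Rightarrow> real \<Rightarrow> real \<Rightarrow> real" where
  "fnl' \<nu> \<mu> u = 2 * \<nu> * u - 3 * u^2 - \<mu>"

definition smooth_with_derivs :: "(real \<Rightarrow> real) \<Rightarrow> (nat \<Rightarrow> real \<Rightarrow> real) \<Rightarrow> bool" where
  "smooth_with_derivs \<phi> D \<longleftrightarrow> D 0 = \<phi> \<and>
     (\<forall>k x. (D k has_real_derivative D (Suc k) x) (at x))"

text \<open>(H1): phi is a smooth stationary solution of u_t = -(1+d_x^2)^2 u + f(u),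
  i.e. -phi'''' - 2 phi'' - phi + f(phi) = 0, with phi -> 0 at +-infinity.\<close>
definition H1 :: "real \<Rightarrow> real \<Rightarrow> (real \<Rightarrow> real) \<Rightarrow> bool" where
  "H1 \<nu> \<mu> \<phi> \<longleftrightarrow>
     (\<exists>D. smooth_with_derivs \<phi> D \<and>
        (\<forall>x. - D 4 x - 2 * D 2 x - \<phi> x + fnl \<nu> \<mu> (\<phi> x) = 0)) \<and>
     (\<phi> \<longlongrightarrow> 0) at_top \<and> (\<phi> \<longlongrightarrow> 0) at_bot"

definition H2 :: "real \<Rightarrow> real \<Rightarrow> bool" where
  "H2 \<nu> \<mu> \<longleftrightarrow> fnl' \<nu> \<mu> 0 < 0"

definition sq_integrable_on :: "(real \<Rightarrow> real) \<Rightarrow> real set \<Rightarrow> bool" where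
  "sq_integrable_on g S \<longleftrightarrow> g \<in> borel_measurable (lebesgue_on S) \<and>
     (\<lambda>x. (g x)^2) integrable_on S"

text \<open>Sobolev space H^4((-infinity,s]) in one dimension: u has a representative
  d 0 = u with d 0, ..., d 3 absolutely continuous on (-infinity,s],
  (d k)' = d (k+1) a.e. (in integral form), and all d k (k <= 4) in L^2((-infinity,s]).
  d k is the k-th weak derivative of u.\<close>
definition H4_rep :: "real \<Rightarrow> (real \<Rightarrow> real) \<Rightarrow> (nat \<Rightarrow> real \<Rightarrow> real) \<Rightarrow> bool" where
  "H4_rep s u d \<longleftrightarrow> d 0 = u \<and>
     (\<forall>k\<le>4. sq_integrable_on (d k) {..s}) \<and>
     (\<forall>k<4. \<forall>x\<le>s. d (Suc k) integrable_on {x..s} \<and>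
                    d k x = d k s - integral {x..s} (d (Suc k)))"

text \<open>Eigenspace of L_s for eigenvalue lam: functions u in the domain
  {u in H^4((-infinity,s]) : u(s) = u'(s) = 0} with L_s u = lam u (a.e.).
  Elements are normalized to vanish outside (-infinity,s], so that the eigenspace
  is a linear subspace of real => real.\<close>
definition eigenspace_L :: "real \<Rightarrow> real \<Rightarrow> (real \<Rightarrow> real) \<Rightarrow> real \<Rightarrow> real \<Rightarrow> (real \<Rightarrow> real) set" where
  "eigenspace_L \<nu> \<mu> \<phi> s lam = {u. (\<forall>x>s. u x = 0) \<and>
     (\<exists>d. H4_rep s u d \<and> d 0 s = 0 \<and> d 1 s = 0 \<and>
        (AE x in lebesgue_on {..s}.
           - d 4 x - 2 * d 2 x - u x + fnl' \<nu> \<mu> (\<phi> x) * u x = lam * u x))}"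

definition fscale :: "real \<Rightarrow> (real \<Rightarrow> real) \<Rightarrow> (real \<Rightarrow> real)" where
  "fscale c u = (\<lambda>x. c * u x)"

definition is_eigenvalue_L :: "real \<Rightarrow> real \<Rightarrow> (real \<Rightarrow> real) \<Rightarrow> real \<Rightarrow> real \<Rightarrow> bool" where
  "is_eigenvalue_L \<nu> \<mu> \<phi> s lam \<longleftrightarrow> eigenspace_L \<nu> \<mu> \<phi> s lam \<noteq> {0}"

definition eig_mult_L :: "real \<Rightarrow> real \<Rightarrow> (real \<Rightarrow> real) \<Rightarrow> real \<Rightarrow> real \<Rightarrow> nat" where
  "eig_mult_L \<nu> \<mu> \<phi> s lam = vector_space.dim fscale (eigenspace_L \<nu> \<mu> \<phi> s lam)"

definition Bmat :: "real \<Rightarrow> real \<Rightarrow> (real \<Rightarrow> real) \<Rightarrow> real \<Rightarrow> real \<Rightarrow>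
    real \<times> real \<times> real \<times> real \<Rightarrow> real \<times> real \<times> real \<times> real" where
  "Bmat \<nu> \<mu> \<phi> x lam q = (case q of (q1, q2, q3, q4) \<Rightarrow>
     (q4, q3 - 2 * q4, (- lam - 1 + fnl' \<nu> \<mu> (\<phi> x)) * q1, q2))"

definition Eu_minus :: "real \<Rightarrow> real \<Rightarrow> (real \<Rightarrow> real) \<Rightarrow> real \<Rightarrow> real \<Rightarrow>
    (real \<times> real \<times> real \<times> real) set" where
  "Eu_minus \<nu> \<mu> \<phi> x lam = {q x | q.
     (\<forall>y. (q has_vector_derivative Bmat \<nu> \<mu> \<phi> y lam (q y)) (at y)) \<and>
     (q \<longlongrightarrow> 0) at_bot}"

definition ell_sand :: "(real \<times> real \<times> real \<times> real) set" where
  "ell_sand = {(q1, q2, q3, q4). q1 = 0 \<and> q4 = 0}"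

definition conj_mult :: "real \<Rightarrow> real \<Rightarrow> (real \<Rightarrow> real) \<Rightarrow> real \<Rightarrow> nat" where
  "conj_mult \<nu> \<mu> \<phi> x = dim (Eu_minus \<nu> \<mu> \<phi> x 0 \<inter> ell_sand)"

definition is_conj_point :: "real \<Rightarrow> real \<Rightarrow> (real \<Rightarrow> real) \<Rightarrow> real \<Rightarrow> bool" where
  "is_conj_point \<nu> \<mu> \<phi> x \<longleftrightarrow> Eu_minus \<nu> \<mu> \<phi> x 0 \<inter> ell_sand \<noteq> {0}"

definition H3 :: "real \<Rightarrow> real \<Rightarrow> (real \<Rightarrow> real) \<Rightarrow> bool" where
  "H3 \<nu> \<mu> \<phi> \<longleftrightarrow> (\<forall>x. conj_mult \<nu> \<mu> \<phi> x \<le> 1)"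

definition count_mult :: "'a set \<Rightarrow> ('a \<Rightarrow> nat) \<Rightarrow> enat" where
  "count_mult S m = (if finite S then enat (\<Sum>x\<in>S. m x) else \<infinity>)"

end

theory Submission
  imports Defs
begin

text \<open>
  Let \<open>W = - f'(\<phi>)\<close>. On functions clamped at \<open>s\<close>, the quadratic form of \<open>\<lambda> - \<L>\<^sub>s\<close> is
  \<open>Q(u) = \<integral> (u'' + u)\<^sup>2 + (W + \<lambda>) u\<^sup>2\<close>, and \<open>W\<close> is bounded below by a positive constant near \<open>-\<infinity>\<close>.
  Hence \<open>Q\<close> is coercive on the functions whose value and derivative vanish at the points of a fine
  finite grid; its orthogonal complement there is spanned by finitely many piecewise solutions of the
  eigenvalue equation. So \<open>Q\<close> has a finite Morse index, and its kernel is the eigenspace of \<open>\<L>\<^sub>s\<close>,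
  which corresponds to \<open>E\<^sup>u\<^sub>-(s, \<lambda>) \<inter> \<ell>\<^sub>*\<close>.

  Both counts equal the index at \<open>(L, 0)\<close>. The index is locally constant except that it jumps by the
  nullity when \<open>\<lambda>\<close> decreases, or \<open>s\<close> increases, through a point with nontrivial kernel. For \<open>\<lambda>\<close> this is
  perturbation by a multiple of the \<open>L\<^sup>2\<close> form. For \<open>s\<close>, translation identifies the domains for
  nearby endpoints and perturbs \<open>Q\<close> by a small multiple of the \<open>L\<^sup>2\<close> form, \<open>W\<close> being uniformly continuous;
  the index does jump by the whole nullity since a kernel element vanishing on an interval is zero.
  The index vanishes for \<open>\<lambda>\<close> large and for \<open>s\<close> near \<open>-\<infinity>\<close>.
\<close>

section \<open>Quadratic forms with finite index\<close>

text \<open>The term (u'' + u)^2 comes from the factor (1 + d^2/dx^2)^2, and the positive lower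
  bound on W near -infinity from (H2), since W tends to -f'(0). The form space is not complete, so
  no spectral theorem and no minimization is used: all index arguments are linear algebra on a
  finite-dimensional complement of a subspace where the form dominates a multiple of the L^2 form.
  Hence every perturbation must be controlled by the L^2 form alone. Translation achieves this
  because it only moves the potential, whereas rescaling the half-line would disturb second
  derivatives. The broken solutions need an outermost piece that decays and has prescribed value and
  slope. These pieces are found without asymptotic expansions, from the quantity w u' - w' u with w
  = u'' + u: its derivative w^2 + c u^2 is the density of the form, so it is monotone where c is
  positive, and its nonnegativity there characterizes decay. Replacing lambda by its negative makes
  both index functions nondecreasing and locally constant to the left, so one counting lemma serves
  both.\<close>

instantiation "fun" :: (type, real_vector) real_vector
begin
definition "scaleR r f = (\<lambda>x. r *\<^sub>R f x)"
instance
  by standard (simp_all add: scaleR_fun_def fun_eq_iff scaleR_add_right scaleR_add_left)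
end

lemma scaleR_fun_apply [simp]: "(r *\<^sub>R f) x = r *\<^sub>R f x"
  by (simp add: scaleR_fun_def)

lemma sum_fun_apply: "(\<Sum>i\<in>I. f i) x = (\<Sum>i\<in>I. f i x)"
  by (induction I rule: infinite_finite_induct) auto

text \<open>Bridges the multiplicity of eigenvalues, stated with \<open>fscale\<close>, to the
  \<open>real_vector\<close> structure just put on functions.\<close>

lemma dim_fscale: "vector_space.dim fscale V = dim V"
proof -
  have "fscale = scaleR" by (simp add: fun_eq_iff fscale_def)
  then show ?thesis by (simp only: dim_raw_def)
qed

text \<open>The family is indexed, so coinciding vectors count as dependent; replacing it by its
  image would collapse them and lose the cardinality bound.\<close>

lemma dependent_family:
  fixes v :: "'b \<Rightarrow> 'a::real_vector"
  assumes "finite A" "finite X" "card X < card A" "\<And>a. a \<in> A \<Longrightarrow> v a \<in> span X"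
  obtains x where "\<exists>a\<in>A. x a \<noteq> 0" "(\<Sum>a\<in>A. x a *\<^sub>R v a) = 0"
proof (cases "inj_on v A")
  case True
  have "\<not> independent (v ` A)"
  proof
    assume "independent (v ` A)"
    then have "card (v ` A) \<le> card X"
      using independent_span_bound[of X "v ` A"] assms by auto
    then show False using True assms by (simp add: card_image)
  qed
  then obtain f where f: "\<exists>w\<in>v ` A. f w \<noteq> 0" "(\<Sum>w\<in>v ` A. f w *\<^sub>R w) = 0"
    using dependent_finite[of "v ` A"] assms(1) by auto
  have "(\<Sum>a\<in>A. f (v a) *\<^sub>R v a) = 0"
    using f(2) sum.reindex[OF True, of "\<lambda>w. f w *\<^sub>R w"] by simp
  with f(1) show ?thesis by (intro that[of "\<lambda>a. f (v a)"]) auto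
next
  case False
  then obtain a b where ab: "a \<in> A" "b \<in> A" "a \<noteq> b" "v a = v b" unfolding inj_on_def by blast
  define x where "x = (\<lambda>c. if c = a then 1 else if c = b then -1 else (0::real))"
  have "(\<Sum>c\<in>A. x c *\<^sub>R v c) = (\<Sum>c\<in>{a,b}. x c *\<^sub>R v c)"
    by (rule sum.mono_neutral_right) (use ab assms(1) in \<open>auto simp: x_def\<close>)
  also have "\<dots> = 0" using ab by (simp add: x_def)
  finally show ?thesis using ab by (intro that[of x]) (auto simp: x_def)
qed

section \<open>Symmetric bilinear forms on a subspace\<close>

text \<open>The laws are imposed on \<open>H\<close> only: the forms in question are integrals,
  which behave linearly only where they converge.\<close>

locale form_space =
  fixes H :: "'a::real_vector set" and Q :: "'a \<Rightarrow> 'a \<Rightarrow> real"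
  assumes sub: "subspace H"
    and sym: "u \<in> H \<Longrightarrow> v \<in> H \<Longrightarrow> Q u v = Q v u"
    and add_l: "u \<in> H \<Longrightarrow> v \<in> H \<Longrightarrow> w \<in> H \<Longrightarrow> Q (u + v) w = Q u w + Q v w"
    and scale_l: "u \<in> H \<Longrightarrow> v \<in> H \<Longrightarrow> Q (c *\<^sub>R u) v = c * Q u v"
begin

lemma add_r: "u \<in> H \<Longrightarrow> v \<in> H \<Longrightarrow> w \<in> H \<Longrightarrow> Q w (u + v) = Q w u + Q w v"
  by (metis add_l sym sub subspace_add)

lemma scale_r: "u \<in> H \<Longrightarrow> v \<in> H \<Longrightarrow> Q v (c *\<^sub>R u) = c * Q v u"
  by (metis scale_l sym sub subspace_scale)

lemma zero_l: "v \<in> H \<Longrightarrow> Q 0 v = 0"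
  using scale_l[of v v 0] by simp

lemma zero_r: "v \<in> H \<Longrightarrow> Q v 0 = 0"
  using scale_r[of v v 0] by simp

lemma diff_l: "u \<in> H \<Longrightarrow> v \<in> H \<Longrightarrow> w \<in> H \<Longrightarrow> Q (u - v) w = Q u w - Q v w"
  using add_l[of u "(-1) *\<^sub>R v" w] scale_l[of v w "-1"] subspace_scale[OF sub, of v "-1"] by simp

lemma sum_l:
  assumes "\<And>i. i \<in> I \<Longrightarrow> f i \<in> H" "v \<in> H"
  shows "Q (\<Sum>i\<in>I. f i) v = (\<Sum>i\<in>I. Q (f i) v)"
  using assms
proof (induction I rule: infinite_finite_induct)
  case (insert i I)
  then have "(\<Sum>i\<in>I. f i) \<in> H" using sub by (auto intro!: subspace_sum)
  with insert show ?case by (simp add: add_l)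
qed (auto simp: zero_l)

lemma span_in: "B \<subseteq> H \<Longrightarrow> span B \<subseteq> H"
  by (rule span_minimal[OF _ sub])

lemma expand: 
  assumes "u \<in> H" "v \<in> H"
  shows "Q (u + v) (u + v) = Q u u + 2 * Q u v + Q v v"
proof -
  have "u + v \<in> H" using assms sub subspace_add by blast
  then show ?thesis using assms by (simp add: add_l add_r sym[of v u])
qed

lemma expand_diff: 
  assumes "u \<in> H" "v \<in> H"
  shows "Q (u - v) (u - v) = Q u u - 2 * Q u v + Q v v"
proof -
  have uv: "u - v \<in> H" using assms sub subspace_diff by blast
  have "Q (u - v) (u - v) = Q u (u - v) - Q v (u - v)" by (rule diff_l[OF assms uv])
  then show ?thesis using sym[OF assms(1) uv] sym[OF assms(2) uv] sym[OF assms] diff_l assms by simp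
qed

lemma orth_span:
  assumes "B \<subseteq> H" "u \<in> H" "\<And>e. e \<in> B \<Longrightarrow> Q u e = 0" "x \<in> span B"
  shows "Q u x = 0"
proof -
  have "subspace {x \<in> H. Q u x = 0}"
    using sub assms(2) unfolding subspace_def by (auto simp: zero_r add_r scale_r)
  then have "span B \<subseteq> {x \<in> H. Q u x = 0}"
    using assms by (intro span_minimal) auto
  with assms show ?thesis by auto
qed

definition orth_family :: "'a set \<Rightarrow> bool" where
  "orth_family E \<longleftrightarrow> (\<forall>e\<in>E. \<forall>e'\<in>E. e \<noteq> e' \<longrightarrow> Q e e' = 0)"

text \<open>Gram-Schmidt can break down on isotropic vectors of an indefinite form. So any
  \<open>e\<close> with \<open>Q e e \<noteq> 0\<close> is split off and the induction continues in
  its orthogonal complement inside the span; if there is no such \<open>e\<close>, polarization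
  makes the form vanish on the span and \<open>B\<close> itself is orthogonal.\<close>

lemma orth_basis:
  assumes "finite B" "independent B" "B \<subseteq> H"
  shows "\<exists>E. finite E \<and> independent E \<and> span E = span B \<and> orth_family E"
  using assms
proof (induction "card B" arbitrary: B rule: less_induct)
  case less
  have spB: "span B \<subseteq> H" using less by (simp add: span_in)
  show ?case
  proof (cases "\<forall>u\<in>span B. Q u u = 0")
    case True
    have "Q e e' = 0" if "e \<in> B" "e' \<in> B" for e e'
    proof -
      have "e + e' \<in> span B" "e \<in> span B" "e' \<in> span B" using that by (auto intro: span_base span_add)
      then show ?thesis using expand[of e e'] True spB by auto
    qed
    with less show ?thesis by (intro exI[of _ B]) (auto simp: orth_family_def)
  next
    case False
    then obtain e where e: "e \<in> span B" "Q e e \<noteq> 0" by auto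
    then have eH: "e \<in> H" using spB by auto
    define V where "V = {u \<in> span B. Q u e = 0}"
    have "subspace V"
      using subspace_span[of B] spB eH unfolding V_def subspace_def by (auto simp: zero_l add_l scale_l subset_iff)
    obtain C where C: "C \<subseteq> V" "independent C" "V \<subseteq> span C"
      using maximal_independent_subset[of V] by blast
    have spC: "span C = V"
      using C \<open>subspace V\<close> span_minimal by blast
    have "V \<subseteq> span B" by (auto simp: V_def)
    have finC: "finite C" using independent_span_bound[of B C] C \<open>V \<subseteq> span B\<close> less by auto
    have enV: "e \<notin> V" using e by (auto simp: V_def)
    have "independent (insert e C)" using enV spC C by (intro independent_insertI) auto
    then have "card (insert e C) \<le> card B"
      using independent_span_bound[of B "insert e C"] C \<open>V \<subseteq> span B\<close> less e by auto
    moreover have "e \<notin> C" using enV C by auto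
    ultimately have "card C < card B" using finC by simp
    then obtain E where E: "finite E" "independent E" "span E = span C" "orth_family E"
      using less(1)[of C] C finC \<open>V \<subseteq> span B\<close> spB by blast
    have EV: "E \<subseteq> V" using E(3) spC span_superset by blast
    have "independent (insert e E)" using enV E spC by (intro independent_insertI) auto
    moreover have "span (insert e E) = span B"
    proof
      show "span (insert e E) \<subseteq> span B" 
        using e EV \<open>V \<subseteq> span B\<close> by (intro span_minimal) auto
      show "span B \<subseteq> span (insert e E)"
      proof
        fix u assume u: "u \<in> span B"
        let ?k = "Q u e / Q e e"
        have uH: "u \<in> H" using u spB by auto
        have keH: "?k *\<^sub>R e \<in> H" using eH sub subspace_scale by blast
        have "Q (u - ?k *\<^sub>R e) e = 0" using diff_l[OF uH keH eH] scale_l[OF eH eH, of ?k] e(2) by simp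
        moreover have "u - ?k *\<^sub>R e \<in> span B" using u e by (intro span_diff span_scale)
        ultimately have "u - ?k *\<^sub>R e \<in> V" by (simp add: V_def)
        then have "u - ?k *\<^sub>R e \<in> span E" using E spC by auto
        then show "u \<in> span (insert e E)" unfolding span_insert by blast
      qed
    qed
    moreover have "orth_family (insert e E)"
      using E(4) EV spB sym eH unfolding orth_family_def V_def by (auto simp: subset_iff)
    ultimately show ?thesis using E(1) by (intro exI[of _ "insert e E"]) auto
  qed
qed

end

section \<open>Morse index of a form that is diagonal up to a coercive block\<close>

definition neg_family :: "'a::real_vector set \<Rightarrow> ('a \<Rightarrow> 'a \<Rightarrow> real) \<Rightarrow> 'a set \<Rightarrow> bool" where
  "neg_family H Q A \<longleftrightarrow> A \<subseteq> H \<and> finite A \<and> independent A \<and> (\<forall>u\<in>span A. u \<noteq> 0 \<longrightarrow> Q u u < 0)"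

text \<open>\<open>Max\<close> is meaningful only if the cardinalities are bounded; under
  \<open>diagonal_form\<close> this is part of \<open>morse_index_eq\<close>.\<close>

definition morse_index :: "'a::real_vector set \<Rightarrow> ('a \<Rightarrow> 'a \<Rightarrow> real) \<Rightarrow> nat" where
  "morse_index H Q = Max (card ` {A. neg_family H Q A})"

definition form_ker :: "'a::real_vector set \<Rightarrow> ('a \<Rightarrow> 'a \<Rightarrow> real) \<Rightarrow> 'a set" where
  "form_ker H Q = {u \<in> H. \<forall>v\<in>H. Q u v = 0}"

text \<open>\<open>Q\<close> is block diagonal for \<open>H = K + span E\<close>: coercive relative
  to \<open>G\<close> on the possibly infinite-dimensional \<open>K\<close>, and diagonal on the
  finite family \<open>E\<close>. \<open>G\<close> replaces a norm, and all spectral gaps below are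
  measured with it.\<close>

locale diagonal_form = form_space H Q + G: form_space H G
  for H :: "'a::real_vector set" and Q G +
  fixes E K :: "'a set" and c :: real
  assumes Gpos: "u \<in> H \<Longrightarrow> u \<noteq> 0 \<Longrightarrow> G u u > 0"
    and finE: "finite E" and EH: "E \<subseteq> H" and indE: "independent E" and orthE: "orth_family E"
    and subK: "subspace K" and KH: "K \<subseteq> H"
    and decomp: "u \<in> H \<Longrightarrow> \<exists>k\<in>K. u - k \<in> span E"
    and KE: "k \<in> K \<Longrightarrow> e \<in> E \<Longrightarrow> Q k e = 0"
    and cpos: "c > 0"
    and Kpos: "k \<in> K \<Longrightarrow> c * G k k \<le> Q k k"
begin

definition "Eneg = {e\<in>E. Q e e < 0}"
definition "Enul = {e\<in>E. Q e e = 0}"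
definition "Epos = {e\<in>E. Q e e > 0}"

lemma Gnonneg: "u \<in> H \<Longrightarrow> G u u \<ge> 0"
  using Gpos[of u] G.zero_l[of u] by (cases "u = 0") (auto intro: less_imp_le)

lemma Q_comb:
  assumes "X \<subseteq> E"
  shows "Q (\<Sum>e\<in>X. a e *\<^sub>R e) (\<Sum>e\<in>X. a e *\<^sub>R e) = (\<Sum>e\<in>X. (a e)\<^sup>2 * Q e e)"
proof -
  have fX: "finite X" using assms finE finite_subset by blast
  have H: "a e *\<^sub>R e \<in> H" if "e \<in> X" for e using that assms EH sub subspace_scale by blast
  have sH: "(\<Sum>e\<in>X. a e *\<^sub>R e) \<in> H" by (rule subspace_sum[OF sub]) (use H in auto)
  have "Q (a e *\<^sub>R e) (\<Sum>e\<in>X. a e *\<^sub>R e) = (a e)\<^sup>2 * Q e e" if e: "e \<in> X" for e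
  proof -
    have "Q (a e *\<^sub>R e) (\<Sum>e\<in>X. a e *\<^sub>R e) = (\<Sum>e'\<in>X. Q (a e' *\<^sub>R e') (a e *\<^sub>R e))"
      using sym[OF H[OF e] sH] sum_l[of X "\<lambda>e. a e *\<^sub>R e" "a e *\<^sub>R e"] H e by simp
    also have "\<dots> = (\<Sum>e'\<in>X. if e' = e then (a e)\<^sup>2 * Q e e else 0)"
    proof (rule sum.cong)
      fix e' assume e': "e' \<in> X"
      have in_H: "e' \<in> H" "e \<in> H" using e e' assms EH by auto
      then have "Q (a e' *\<^sub>R e') (a e *\<^sub>R e) = a e' * (a e * Q e' e)"
        using scale_l[of e' "a e *\<^sub>R e"] scale_r[of e e'] sub subspace_scale by metis
      moreover have "Q e' e = 0" if "e' \<noteq> e" using that orthE e e' assms unfolding orth_family_def by blast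
      ultimately show "Q (a e' *\<^sub>R e') (a e *\<^sub>R e) = (if e' = e then (a e)\<^sup>2 * Q e e else 0)"
        by (auto simp: power2_eq_square)
    qed simp
    finally show ?thesis using e fX by simp
  qed
  then show ?thesis using sum_l[of X "\<lambda>e. a e *\<^sub>R e"] H sH by simp
qed

text \<open>\<open>E\<close> is orthogonal for \<open>Q\<close> but not for \<open>G\<close>. The
  crude factor \<open>2 ^ card X\<close> comes from applying G(x + s) \<le> 2 G(x) + 2 G(s) once per
  vector.\<close>

lemma G_comb_le:
  assumes "X \<subseteq> E"
  shows "G (\<Sum>e\<in>X. a e *\<^sub>R e) (\<Sum>e\<in>X. a e *\<^sub>R e) \<le> 2 ^ card X * (\<Sum>e\<in>X. (a e)\<^sup>2 * G e e)"
proof -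
  have "finite X" using assms finE finite_subset by blast
  then show ?thesis using assms
  proof (induction X)
    case empty
    show ?case using G.zero_l subspace_0[OF sub] by simp
  next
    case (insert x X)
    let ?s = "\<Sum>e\<in>X. a e *\<^sub>R e" and ?x = "a x *\<^sub>R x"
    have H: "a e *\<^sub>R e \<in> H" if "e \<in> insert x X" for e using that insert.prems EH sub subspace_scale by blast
    have sH: "?s \<in> H" by (rule subspace_sum[OF sub]) (use H in auto)
    have xH: "?x \<in> H" using H by auto
    have "0 \<le> G (?x - ?s) (?x - ?s)" using xH sH sub subspace_diff by (intro Gnonneg) blast
    also have "\<dots> = G ?x ?x - 2 * G ?x ?s + G ?s ?s" by (rule G.expand_diff[OF xH sH])
    finally have "G (?x + ?s) (?x + ?s) \<le> 2 * G ?x ?x + 2 * G ?s ?s"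
      using G.expand[OF xH sH] by simp
    also have "G ?x ?x = (a x)\<^sup>2 * G x x"
    proof -
      have "x \<in> H" using insert.prems EH by auto
      then have "G ?x ?x = a x * (a x * G x x)" 
        using G.scale_l[of x ?x "a x"] G.scale_r[of x x] xH by metis
      then show ?thesis by (simp add: power2_eq_square)
    qed
    also have "2 * ((a x)\<^sup>2 * G x x) + 2 * G ?s ?s \<le> 2 ^ Suc (card X) * ((a x)\<^sup>2 * G x x) + 2 ^ Suc (card X) * (\<Sum>e\<in>X. (a e)\<^sup>2 * G e e)"
    proof (rule add_mono)
      have "x \<in> H" using insert.prems EH by auto
      then show "2 * ((a x)\<^sup>2 * G x x) \<le> 2 ^ Suc (card X) * ((a x)\<^sup>2 * G x x)"
        using Gnonneg[of x] by (intro mult_right_mono) auto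
      show "2 * G ?s ?s \<le> 2 ^ Suc (card X) * (\<Sum>e\<in>X. (a e)\<^sup>2 * G e e)"
        using insert.IH insert.prems by simp
    qed
    finally show ?case using insert.hyps by (simp add: distrib_left)
  qed
qed

lemma span_comb:
  assumes "X \<subseteq> E" "u \<in> span X"
  obtains a where "u = (\<Sum>e\<in>X. a e *\<^sub>R e)"
proof -
  have "finite X" using assms finE finite_subset by blast
  then show ?thesis using assms(2) that unfolding span_finite[OF \<open>finite X\<close>] by auto
qed

text \<open>On a finite-dimensional definite block the two forms are comparable. The sign
  \<open>s\<close> lets one proof serve both the positive and the negative block.\<close>

lemma comb_dominates:
  assumes X: "X \<subseteq> E" and pos: "\<And>e. e \<in> X \<Longrightarrow> s * Q e e > 0"
  obtains d where "d > 0" "\<And>u. u \<in> span X \<Longrightarrow> d * G u u \<le> s * Q u u"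
proof -
  have fX: "finite X" using X finE finite_subset by blast
  \<comment> \<open>The sum exceeds each single ratio; adding 1 keeps \<open>m\<close> positive when
    \<open>X\<close> is empty.\<close>
  define m where "m = (\<Sum>e\<in>X. G e e / (s * Q e e)) + 1"
  have XH: "X \<subseteq> H" using X EH by auto
  have term_nonneg: "G e e / (s * Q e e) \<ge> 0" if "e \<in> X" for e
    using pos[OF that] Gnonneg XH that by (intro divide_nonneg_pos) auto
  have mpos: "m > 0" unfolding m_def using sum_nonneg[of X "\<lambda>e. G e e / (s * Q e e)"] term_nonneg by (smt (verit))
  have m: "G e e \<le> m * (s * Q e e)" if "e \<in> X" for e
  proof -
    have "G e e / (s * Q e e) \<le> (\<Sum>e\<in>X. G e e / (s * Q e e))"
      by (rule member_le_sum) (use that fX term_nonneg in auto)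
    then have "G e e / (s * Q e e) \<le> m" unfolding m_def by simp
    then show ?thesis using pos[OF that] by (simp add: divide_le_eq)
  qed
  define d where "d = 1 / (2 ^ card X * m)"
  have "d > 0" using mpos by (simp add: d_def)
  moreover have "d * G u u \<le> s * Q u u" if u: "u \<in> span X" for u
  proof -
    obtain a where a: "u = (\<Sum>e\<in>X. a e *\<^sub>R e)" using span_comb[OF X u] .
    have "G u u \<le> 2 ^ card X * (\<Sum>e\<in>X. (a e)\<^sup>2 * G e e)" unfolding a by (rule G_comb_le[OF X])
    also have "(\<Sum>e\<in>X. (a e)\<^sup>2 * G e e) \<le> (\<Sum>e\<in>X. (a e)\<^sup>2 * (m * (s * Q e e)))"
      by (intro sum_mono mult_left_mono m) auto
    also have "\<dots> = m * (s * Q u u)" unfolding a Q_comb[OF X] by (simp add: sum_distrib_left mult_ac)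
    finally have "G u u \<le> (2 ^ card X * m) * (s * Q u u)" by simp
    then show ?thesis using mpos by (simp add: d_def field_simps)
  qed
  ultimately show ?thesis by (rule that)
qed

lemma K_orth_span: "k \<in> K \<Longrightarrow> x \<in> span E \<Longrightarrow> Q k x = 0"
  using orth_span[OF EH, of k x] KE KH by auto

lemma span_E_H: "X \<subseteq> E \<Longrightarrow> span X \<subseteq> H"
  using EH span_in by blast

lemma Q_sum_K:
  assumes "k \<in> K" "x \<in> span E"
  shows "Q (k + x) (k + x) = Q k k + Q x x"
  using expand[of k x] K_orth_span[OF assms] assms KH span_E_H[of E] by auto

lemma pos_gap:
  obtains d where "d > 0" "\<And>k p. k \<in> K \<Longrightarrow> p \<in> span Epos \<Longrightarrow> d * G (k + p) (k + p) \<le> Q (k + p) (k + p)"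
proof -
  have PE: "Epos \<subseteq> E" by (auto simp: Epos_def)
  obtain d where d: "d > 0" "\<And>u. u \<in> span Epos \<Longrightarrow> d * G u u \<le> 1 * Q u u"
    by (rule comb_dominates[OF PE, of 1]) (auto simp: Epos_def)
  \<comment> \<open>The halving pays for the factor 2 in G(k + p) \<le> 2 G(k) + 2 G(p), as
    \<open>K\<close> and \<open>Epos\<close> are orthogonal for \<open>Q\<close> only.\<close>
  define d' where "d' = min d c / 2"
  have d': "d' > 0" "2 * d' \<le> d" "2 * d' \<le> c" using d(1) cpos by (auto simp: d'_def)
  show ?thesis
  proof (rule that[OF d'(1)])
    fix k p assume kp: "k \<in> K" "p \<in> span Epos"
    have kH: "k \<in> H" and pH: "p \<in> H" using kp KH span_E_H[OF PE] by auto
    have "0 \<le> G (k - p) (k - p)" using kH pH sub subspace_diff by (intro Gnonneg) blast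
    also have "\<dots> = G k k - 2 * G k p + G p p" by (rule G.expand_diff[OF kH pH])
    finally have "G (k + p) (k + p) \<le> 2 * G k k + 2 * G p p" using G.expand[OF kH pH] by simp
    then have "d' * G (k + p) (k + p) \<le> d' * (2 * G k k + 2 * G p p)"
      using d' by (intro mult_left_mono) auto
    also have "\<dots> = (2 * d') * G k k + (2 * d') * G p p" by (simp add: algebra_simps)
    also have "\<dots> \<le> c * G k k + d * G p p"
      using d' Gnonneg kH pH by (intro add_mono mult_right_mono) auto
    also have "\<dots> \<le> Q k k + Q p p" using Kpos kp d(2) by (intro add_mono) auto
    also have "\<dots> = Q (k + p) (k + p)" using Q_sum_K kp span_mono[OF PE] by auto
    finally show "d' * G (k + p) (k + p) \<le> Q (k + p) (k + p)" .
  qed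
qed

lemma neg_gap:
  obtains d where "d > 0" "\<And>u. u \<in> span Eneg \<Longrightarrow> Q u u \<le> - d * G u u"
proof -
  have PE: "Eneg \<subseteq> E" by (auto simp: Eneg_def)
  obtain d where d: "d > 0" "\<And>u. u \<in> span Eneg \<Longrightarrow> d * G u u \<le> (-1) * Q u u"
    by (rule comb_dominates[OF PE, of "-1"]) (auto simp: Eneg_def)
  show ?thesis by (rule that[OF d(1)]) (use d(2) in force)
qed

text \<open>Dimension count: the \<open>X\<close>-coordinates of the vectors of \<open>A\<close>
  live in a space of dimension at most \<open>card X\<close>, so some nontrivial combination of
  \<open>A\<close> has none. Every comparison of indices below is an instance with a suitable
  \<open>X\<close>.\<close>

lemma avoid:
  assumes A: "A \<subseteq> H" "finite A" "independent A" and X: "X \<subseteq> E" and card: "card X < card A"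
  obtains u k x where "u \<in> span A" "u \<noteq> 0" "k \<in> K" "x \<in> span (E - X)" "u = k + x"
proof -
  have "\<exists>k b. k \<in> K \<and> a = k + (\<Sum>e\<in>E. b e *\<^sub>R e)" if aA: "a \<in> A" for a
  proof -
    obtain k where k: "k \<in> K" "a - k \<in> span E" using decomp[of a] A(1) aA by blast
    obtain b where "a - k = (\<Sum>e\<in>E. b e *\<^sub>R e)" using span_comb[OF order_refl k(2)] .
    then have "a = k + (\<Sum>e\<in>E. b e *\<^sub>R e)" by (simp add: algebra_simps)
    then show ?thesis using k by blast
  qed
  then obtain k b where kb: "\<And>a. a \<in> A \<Longrightarrow> k a \<in> K" "\<And>a. a \<in> A \<Longrightarrow> a = k a + (\<Sum>e\<in>E. b a e *\<^sub>R e)"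
    by metis
  have fX: "finite X" using X finE finite_subset by blast
  have vs: "(\<Sum>e\<in>X. b a e *\<^sub>R e) \<in> span X" for a by (intro span_sum span_scale span_base)
  obtain t where t: "\<exists>a\<in>A. t a \<noteq> 0" "(\<Sum>a\<in>A. t a *\<^sub>R (\<Sum>e\<in>X. b a e *\<^sub>R e)) = 0"
    using dependent_family[OF A(2) fX card, of "\<lambda>a. \<Sum>e\<in>X. b a e *\<^sub>R e"] vs by blast
  define u where "u = (\<Sum>a\<in>A. t a *\<^sub>R a)"
  define k' where "k' = (\<Sum>a\<in>A. t a *\<^sub>R k a)"
  define x where "x = (\<Sum>a\<in>A. t a *\<^sub>R (\<Sum>e\<in>E - X. b a e *\<^sub>R e))"
  show ?thesis
  proof (rule that)
    show "u \<in> span A" unfolding u_def by (intro span_sum span_scale span_base)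
    show "u \<noteq> 0"
      using t(1) A unfolding u_def by (metis dependent_finite)
    show "k' \<in> K" unfolding k'_def using subK kb by (intro subspace_sum subspace_scale) auto
    show "x \<in> span (E - X)" unfolding x_def by (intro span_sum span_scale span_base)
    have "u = (\<Sum>a\<in>A. t a *\<^sub>R k a + (t a *\<^sub>R (\<Sum>e\<in>E - X. b a e *\<^sub>R e) + t a *\<^sub>R (\<Sum>e\<in>X. b a e *\<^sub>R e)))"
      unfolding u_def
    proof (rule sum.cong)
      fix a assume a: "a \<in> A"
      have "(\<Sum>e\<in>E. b a e *\<^sub>R e) = (\<Sum>e\<in>E - X. b a e *\<^sub>R e) + (\<Sum>e\<in>X. b a e *\<^sub>R e)"
        by (rule sum.subset_diff[OF X finE])
      then show "t a *\<^sub>R a = t a *\<^sub>R k a + (t a *\<^sub>R (\<Sum>e\<in>E - X. b a e *\<^sub>R e) + t a *\<^sub>R (\<Sum>e\<in>X. b a e *\<^sub>R e))"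
        by (subst kb(2)[OF a]) (simp add: scaleR_add_right)
    qed simp
    also have "\<dots> = k' + x" unfolding sum.distrib t(2) k'_def x_def by simp
    finally show "u = k' + x" .
  qed
qed

lemma span_Un_split:
  assumes "x \<in> span (X \<union> Y)"
  obtains y z where "y \<in> span X" "z \<in> span Y" "x = y + z"
  using assms unfolding span_Un by auto

lemma Q_span_nonneg:
  assumes "X \<subseteq> E" "\<And>e. e \<in> X \<Longrightarrow> Q e e \<ge> 0" "x \<in> span X"
  shows "Q x x \<ge> 0"
proof -
  obtain a where a: "x = (\<Sum>e\<in>X. a e *\<^sub>R e)" using span_comb[OF assms(1,3)] .
  show ?thesis unfolding a Q_comb[OF assms(1)] using assms(2) by (intro sum_nonneg) auto
qed

lemma Q_span_nonpos:
  assumes "X \<subseteq> E" "\<And>e. e \<in> X \<Longrightarrow> Q e e \<le> 0" "x \<in> span X"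
  shows "Q x x \<le> 0"
proof -
  obtain a where a: "x = (\<Sum>e\<in>X. a e *\<^sub>R e)" using span_comb[OF assms(1,3)] .
  show ?thesis unfolding a Q_comb[OF assms(1)] using assms(2) by (intro sum_nonpos) (auto intro: mult_nonneg_nonpos)
qed

lemma neg_family_Eneg: "neg_family H Q Eneg"
proof -
  obtain d where d: "d > 0" "\<And>u. u \<in> span Eneg \<Longrightarrow> Q u u \<le> - d * G u u" using neg_gap by blast
  have E: "Eneg \<subseteq> E" by (auto simp: Eneg_def)
  have "Q u u < 0" if "u \<in> span Eneg" "u \<noteq> 0" for u
  proof -
    have "d * G u u > 0" using d(1) Gpos[OF _ that(2)] span_E_H[OF E] that(1) by auto
    then show ?thesis using d(2)[OF that(1)] by simp
  qed
  moreover have "Eneg \<subseteq> H" "finite Eneg" "independent Eneg"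
    using E EH finite_subset[OF E finE] independent_mono[OF indE E] by auto
  ultimately show ?thesis unfolding neg_family_def by simp
qed

text \<open>A larger family would span a nonzero vector without \<open>Eneg\<close>-component, and
  on such vectors \<open>Q\<close> is a sum of nonnegative terms.\<close>

lemma neg_family_le:
  assumes "neg_family H Q A" shows "card A \<le> card Eneg"
proof (rule ccontr)
  assume "\<not> ?thesis"
  then have c: "card Eneg < card A" by simp
  have E: "Eneg \<subseteq> E" by (auto simp: Eneg_def)
  obtain u k x where u: "u \<in> span A" "u \<noteq> 0" "k \<in> K" "x \<in> span (E - Eneg)" "u = k + x"
    using avoid[OF _ _ _ E c] assms unfolding neg_family_def by metis
  have "Q x x \<ge> 0" by (rule Q_span_nonneg[OF _ _ u(4)]) (auto simp: Eneg_def)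
  moreover have "Q k k \<ge> 0" using Kpos[OF u(3)] cpos Gnonneg[of k] u(3) KH by (smt (verit) mult_nonneg_nonneg subsetD)
  moreover have "x \<in> span E" using u(4) span_mono[of "E - Eneg" E] by auto
  ultimately have "Q u u \<ge> 0" using Q_sum_K u by simp
  then show False using assms u unfolding neg_family_def by force
qed

lemma morse_index_eq: "morse_index H Q = card Eneg"
  unfolding morse_index_def
proof (rule Max_eqI)
  have "card ` {A. neg_family H Q A} \<subseteq> {..card Eneg}" using neg_family_le by auto
  then show "finite (card ` {A. neg_family H Q A})" using finite_subset by blast
qed (use neg_family_le neg_family_Eneg in auto)

lemma morse_index_ge: "neg_family H Q A \<Longrightarrow> card A \<le> morse_index H Q"
  using neg_family_le morse_index_eq by simp

lemma Enul_ker: "span Enul \<subseteq> form_ker H Q"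
proof -
  have sk: "subspace (form_ker H Q)"
    using sub unfolding form_ker_def subspace_def by (auto simp: zero_l add_l scale_l)
  have "e \<in> form_ker H Q" if "e \<in> Enul" for e
  proof -
    have eE: "e \<in> E" "Q e e = 0" using that by (auto simp: Enul_def)
    have eH: "e \<in> H" using eE EH by auto
    have ez: "Q e x = 0" if "x \<in> span E" for x
    proof (rule orth_span[OF EH eH _ that])
      show "Q e e' = 0" if "e' \<in> E" for e'
        using that eE orthE unfolding orth_family_def by (cases "e' = e") auto
    qed
    have "Q e v = 0" if vH: "v \<in> H" for v
    proof -
      obtain k where k: "k \<in> K" "v - k \<in> span E" using decomp[of v] vH by blast
      have "Q e (k + (v - k)) = Q e k + Q e (v - k)" 
        using k eH KH vH span_E_H[of E] by (intro add_r) auto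
      then show ?thesis using ez[OF k(2)] KE[OF k(1) eE(1)] sym[of e k] k(1) KH eH by auto
    qed
    then show ?thesis using eH by (simp add: form_ker_def)
  qed
  then show ?thesis using span_minimal[OF _ sk] by blast
qed

text \<open>Testing a kernel element against its own \<open>K\<close>-part kills that part by
  coercivity; testing against each \<open>e\<close> then kills the coefficients with
  \<open>Q e e \<noteq> 0\<close>.\<close>

lemma ker_eq: "form_ker H Q = span Enul"
proof
  show "form_ker H Q \<subseteq> span Enul"
  proof
    fix u assume u: "u \<in> form_ker H Q"
    then have uH: "u \<in> H" and uz: "\<And>v. v \<in> H \<Longrightarrow> Q u v = 0" by (auto simp: form_ker_def)
    obtain k where k: "k \<in> K" "u - k \<in> span E" using decomp[of u] uH by blast
    define x where "x = u - k"
    have ukx: "u = k + x" by (simp add: x_def)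
    have xE: "x \<in> span E" and xH: "x \<in> H" and kH: "k \<in> H" using k span_E_H[of E] KH by (auto simp: x_def)
    have "Q u k = Q k k + Q x k" unfolding ukx using kH xH by (intro add_l)
    then have "Q k k = 0" using uz[OF kH] K_orth_span[OF k(1) xE] sym[OF xH kH] by simp
    then have "c * G k k \<le> 0" using Kpos[OF k(1)] by simp
    then have "k = 0" using Gpos[OF kH] cpos by (smt (verit) mult_pos_pos)
    then have ux: "u = x" using ukx by simp
    obtain a where a: "u = (\<Sum>e\<in>E. a e *\<^sub>R e)" using span_comb[OF order_refl] xE ux by metis
    have az: "a e = 0" if e: "e \<in> E" "e \<notin> Enul" for e
    proof -
      have eH: "e \<in> H" using e EH by auto
      have "Q u e = (\<Sum>e'\<in>E. Q (a e' *\<^sub>R e') e)" unfolding a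
        by (rule sum_l) (use EH sub subspace_scale eH in blast)+
      also have "\<dots> = (\<Sum>e'\<in>E. if e' = e then a e * Q e e else 0)"
      proof (rule sum.cong)
        fix e' assume e': "e' \<in> E"
        have "Q (a e' *\<^sub>R e') e = a e' * Q e' e" using e' EH eH by (intro scale_l) auto
        moreover have "Q e' e = 0" if "e' \<noteq> e" using that e e' orthE unfolding orth_family_def by blast
        ultimately show "Q (a e' *\<^sub>R e') e = (if e' = e then a e * Q e e else 0)" by auto
      qed simp
      finally have "a e * Q e e = 0" using uz[OF eH] e(1) finE by simp
      moreover have "Q e e \<noteq> 0" using e by (auto simp: Enul_def)
      ultimately show ?thesis by simp
    qed
    have "u = (\<Sum>e\<in>Enul. a e *\<^sub>R e)" unfolding a
      by (rule sum.mono_neutral_right[OF finE]) (use az in \<open>auto simp: Enul_def\<close>)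
    then show "u \<in> span Enul" by (metis (no_types, lifting) span_sum span_scale span_base)
  qed
qed (rule Enul_ker)

lemma dim_ker: "dim (form_ker H Q) = card Enul"
  unfolding ker_eq
  using indE independent_mono[of E Enul] by (intro dim_span_eq_card_independent) (auto simp: Enul_def)

text \<open>\<open>dim\<close> is also 0 for spaces with infinite bases, so dimension 0 need not
  mean a trivial space; the finite spanning set \<open>Enul\<close> excludes this case.\<close>

lemma ker_trivial_iff: "form_ker H Q = {0} \<longleftrightarrow> dim (form_ker H Q) = 0"
proof
  assume d: "dim (form_ker H Q) = 0"
  have "finite Enul" using finE by (auto simp: Enul_def)
  then have "Enul = {}" using d dim_ker by auto
  then show "form_ker H Q = {0}" using ker_eq by simp
next
  assume "form_ker H Q = {0}"
  then have "span Enul = span {}" using ker_eq by simp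
  moreover have "independent Enul" using indE independent_mono[of E Enul] by (auto simp: Enul_def)
  ultimately have "Enul = {}" using independent_span_bound[of "{}" Enul] span_superset[of Enul] by auto
  then show "dim (form_ker H Q) = 0" using dim_ker by simp
qed

section \<open>Behaviour of the index under perturbation\<close>

text \<open>Upper semicontinuity, with epsilon the gap of \<open>Q\<close> on
  \<open>K + span Epos\<close>: a form at most epsilon below \<open>Q\<close> stays nonnegative
  there, so a negative family is bounded by the number of remaining directions. The injection
  \<open>T\<close> allows the perturbed form to live on another space, as needed for a moving
  endpoint.\<close>

lemma card_le_index_plus_nullity:
  "\<exists>\<epsilon>>0. \<forall>H' Q' (T :: 'a \<Rightarrow> 'a) A. linear T \<longrightarrow> inj T \<longrightarrow> T ` H' \<subseteq> H \<longrightarrow> form_space H' Q' \<longrightarrow>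
     (\<forall>u\<in>H'. Q (T u) (T u) - \<epsilon> * G (T u) (T u) \<le> Q' u u) \<longrightarrow> neg_family H' Q' A \<longrightarrow>
     card A \<le> morse_index H Q + dim (form_ker H Q)"
proof -
  obtain d where d: "d > 0" "\<And>k p. k \<in> K \<Longrightarrow> p \<in> span Epos \<Longrightarrow> d * G (k + p) (k + p) \<le> Q (k + p) (k + p)"
    using pos_gap by blast
  have main: "card A \<le> morse_index H Q + dim (form_ker H Q)"
    if T: "linear T" "inj T" "T ` H' \<subseteq> H" and H': "form_space H' Q'"
      and Q': "\<forall>u\<in>H'. Q (T u) (T u) - d * G (T u) (T u) \<le> Q' u u" and A: "neg_family H' Q' A" for H' Q' and T :: "'a \<Rightarrow> 'a" and A
  proof (rule ccontr)
    interpret T: linear T by (rule T(1))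
    assume neg: "\<not> ?thesis"
    have dis: "Eneg \<inter> Enul = {}" by (auto simp: Eneg_def Enul_def)
    have fin: "finite Eneg" "finite Enul" using finE by (auto simp: Eneg_def Enul_def)
    have X: "Eneg \<union> Enul \<subseteq> E" by (auto simp: Eneg_def Enul_def)
    have injA: "inj_on T (span A)" using T(2) inj_on_subset by blast
    have cA: "card (T ` A) = card A" using T(2) by (meson card_image inj_on_subset subset_UNIV)
    have c: "card (Eneg \<union> Enul) < card (T ` A)"
      using neg cA card_Un_disjoint[OF fin dis] morse_index_eq dim_ker by simp
    have Ai: "A \<subseteq> H'" "finite A" "independent A" using A by (auto simp: neg_family_def)
    have "independent (T ` A)" using linear_independent_injective_image[OF T(1) Ai(3) injA] .
    then obtain u k x where u: "u \<in> span (T ` A)" "u \<noteq> 0" "k \<in> K" "x \<in> span (E - (Eneg \<union> Enul))" "u = k + x"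
      using avoid[of "T ` A", OF _ _ _ X c] T(3) Ai by blast
    have "E - (Eneg \<union> Enul) = Epos" by (auto simp: Eneg_def Enul_def Epos_def)
    then have x: "x \<in> span Epos" using u by simp
    obtain a where a: "a \<in> span A" "u = T a" using u(1) linear_span_image[OF T(1)] by auto
    have aH: "a \<in> H'" using a Ai form_space.span_in[OF H'] by auto
    have "a \<noteq> 0" using a u T.zero by auto
    then have "Q' a a < 0" using A a by (auto simp: neg_family_def)
    moreover have "0 \<le> Q' a a" using d(2)[OF u(3) x] Q' aH a u(5) by force
    ultimately show False by simp
  qed
  show ?thesis
    by (rule exI[of _ d], intro conjI allI impI, rule d(1), rule main)
qed

text \<open>Lower semicontinuity: raising \<open>Q\<close> by at most half of the negative gap
  leaves it strictly negative on the image of \<open>span Eneg\<close>.\<close>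

lemma neg_family_perturbed:
  "\<exists>\<epsilon>>0. \<forall>H' Q' (T :: 'a \<Rightarrow> 'a). linear T \<longrightarrow> inj T \<longrightarrow> T ` H \<subseteq> H' \<longrightarrow>
     (\<forall>u\<in>H. Q' (T u) (T u) \<le> Q u u + \<epsilon> * G u u) \<longrightarrow>
     (\<exists>A. neg_family H' Q' A \<and> card A = morse_index H Q)"
proof -
  obtain d where d: "d > 0" "\<And>u. u \<in> span Eneg \<Longrightarrow> Q u u \<le> - d * G u u" using neg_gap by blast
  have main: "neg_family H' Q' (T ` Eneg) \<and> card (T ` Eneg) = morse_index H Q"
    if T: "linear T" "inj T" "T ` H \<subseteq> H'" and Q': "\<forall>u\<in>H. Q' (T u) (T u) \<le> Q u u + d / 2 * G u u" for H' Q' and T :: "'a \<Rightarrow> 'a"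
  proof
    interpret T: linear T by (rule T(1))
    have E: "Eneg \<subseteq> E" by (auto simp: Eneg_def)
    have injA: "inj_on T (span Eneg)" using T(2) inj_on_subset by blast
    show "card (T ` Eneg) = morse_index H Q"
      using morse_index_eq T(2) by (metis card_image inj_on_subset subset_UNIV)
    have ng: "Eneg \<subseteq> H" "finite Eneg" "independent Eneg" using neg_family_Eneg by (auto simp: neg_family_def)
    have "Q' y y < 0" if y: "y \<in> span (T ` Eneg)" "y \<noteq> 0" for y
    proof -
      obtain u where u: "u \<in> span Eneg" "y = T u" using y linear_span_image[OF T(1)] by auto
      have un: "u \<noteq> 0" using u y T.zero by auto
      have uH: "u \<in> H" using u span_E_H[OF E] by auto
      have "d * G u u > 0" using d(1) Gpos[OF uH un] by simp
      then show ?thesis using d(2)[OF u(1)] Q' uH u(2) by force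
    qed
    then show "neg_family H' Q' (T ` Eneg)" unfolding neg_family_def
      using ng T(3) linear_independent_injective_image[OF T(1) ng(3) injA] by auto
  qed
  show ?thesis
    by (rule exI[of _ "d / 2"], intro conjI allI impI, use d(1) in simp, rule exI, rule main)
qed

text \<open>If the nonpositive directions \<open>Eneg\<close> and \<open>Enul\<close> of
  \<open>Q\<close> outnumbered the negative ones of \<open>Q'\<close>, some nonzero \<open>u\<close>
  in their span would avoid the latter. Then 0 \<le> Q'(u) \<le> Q(u) \<le> 0, so the positive part
  of \<open>u\<close> vanishes and \<open>u\<close> lies in the kernel of \<open>Q'\<close>, which
  \<open>ker\<close> forbids.\<close>

lemma index_increases:
  assumes "diagonal_form H' Q' G' E' K' c'"
    and HH: "H \<subseteq> H'" and le: "\<And>u. u \<in> H \<Longrightarrow> Q' u u \<le> Q u u"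
    and ker: "\<And>u. u \<in> H \<Longrightarrow> Q u u \<le> 0 \<Longrightarrow> u \<in> form_ker H' Q' \<Longrightarrow> u = 0"
  shows "morse_index H Q + dim (form_ker H Q) \<le> morse_index H' Q'"
proof (rule ccontr)
  interpret D: diagonal_form H' Q' G' E' K' c' by fact
  assume neg: "\<not> ?thesis"
  define X where "X = Eneg \<union> Enul"
  have dis: "Eneg \<inter> Enul = {}" by (auto simp: Eneg_def Enul_def)
  have fin: "finite Eneg" "finite Enul" using finE by (auto simp: Eneg_def Enul_def)
  have X: "X \<subseteq> E" by (auto simp: Eneg_def Enul_def X_def)
  have c: "card D.Eneg < card X"
    using neg card_Un_disjoint[OF fin dis] morse_index_eq dim_ker D.morse_index_eq by (simp add: X_def)
  have XH: "X \<subseteq> H" "finite X" "independent X"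
    using X EH finite_subset[OF X finE] independent_mono[OF indE X] by auto
  have E': "D.Eneg \<subseteq> E'" by (auto simp: D.Eneg_def)
  obtain u k x where u: "u \<in> span X" "u \<noteq> 0" "k \<in> K'" "x \<in> span (E' - D.Eneg)" "u = k + x"
    using D.avoid[OF _ XH(2,3) E' c] XH HH by blast
  have uH: "u \<in> H" using u(1) span_E_H[OF X] by auto
  have Qu: "Q u u \<le> 0" by (rule Q_span_nonpos[OF X _ u(1)]) (auto simp: X_def Eneg_def Enul_def)
  have "E' - D.Eneg = D.Enul \<union> D.Epos" by (auto simp: D.Eneg_def D.Enul_def D.Epos_def)
  then obtain y z where yz: "y \<in> span D.Enul" "z \<in> span D.Epos" "x = y + z"
    using u(4) D.span_Un_split by metis
  have yker: "y \<in> form_ker H' Q'" using yz(1) D.Enul_ker by auto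
  have PE: "D.Epos \<subseteq> E'" by (auto simp: D.Epos_def)
  have kH: "k \<in> H'" and zH: "z \<in> H'" and yH: "y \<in> H'"
    using u(3) D.KH yz(2) D.span_E_H[OF PE] yker by (auto simp: form_ker_def)
  have kzH: "k + z \<in> H'" using kH zH D.sub subspace_add by blast
  have ueq: "u = y + (k + z)" using u(5) yz(3) by (simp add: algebra_simps)
  have "Q' u u = Q' y y + 2 * Q' y (k + z) + Q' (k + z) (k + z)"
    unfolding ueq by (rule D.expand[OF yH kzH])
  then have Q'u: "Q' u u = Q' (k + z) (k + z)" using yker yH kzH by (simp add: form_ker_def)
  obtain d where d: "d > 0" "\<And>k p. k \<in> K' \<Longrightarrow> p \<in> span D.Epos \<Longrightarrow> d * G' (k + p) (k + p) \<le> Q' (k + p) (k + p)"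
    using D.pos_gap by blast
  have "d * G' (k + z) (k + z) \<le> 0" using d(2)[OF u(3) yz(2)] Q'u le[OF uH] Qu by simp
  then have "k + z = 0" using D.Gpos[OF kzH] d(1) by (smt (verit) mult_pos_pos)
  then have "u = y" using ueq by simp
  then have "u = 0" using ker[OF uH Qu] yker by simp
  then show False using u(2) by simp
qed

lemma neg_family_mono:
  assumes "neg_family H Q A" "H \<subseteq> H'" "\<And>u. u \<in> H \<Longrightarrow> Q' u u \<le> Q u u"
  shows "neg_family H' Q' A"
  using assms span_in[of A] unfolding neg_family_def by (force simp: subset_iff)

end

text \<open>The complement of \<open>K\<close> may be given by any finite spanning set; passing to a
  basis and diagonalizing \<open>Q\<close> on its span preserves orthogonality to
  \<open>K\<close>.\<close>

lemma diagonal_form_exists: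
  assumes "form_space H Q" "form_space H G" and Gpos: "\<And>u. u \<in> H \<Longrightarrow> u \<noteq> 0 \<Longrightarrow> G u u > 0"
    and S: "finite S" "S \<subseteq> H" and K: "subspace K" "K \<subseteq> H"
    and decomp: "\<And>u. u \<in> H \<Longrightarrow> \<exists>k\<in>K. u - k \<in> span S"
    and KS: "\<And>k e. k \<in> K \<Longrightarrow> e \<in> S \<Longrightarrow> Q k e = 0"
    and c: "c > 0" "\<And>k. k \<in> K \<Longrightarrow> c * G k k \<le> Q k k"
  obtains E where "diagonal_form H Q G E K c"
proof -
  interpret form_space H Q by fact
  interpret G: form_space H G by fact
  obtain B where B: "B \<subseteq> S" "independent B" "S \<subseteq> span B" using maximal_independent_subset[of S] by blast
  then obtain E where E: "finite E" "independent E" "span E = span B" "orth_family E"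
    using orth_basis[of B] S finite_subset by blast
  have spB: "span B = span S" using B by (meson span_mono span_minimal subspace_span subset_antisym)
  have EH: "E \<subseteq> H" using E(3) B S span_in[of B] span_superset[of E] by blast
  have "diagonal_form H Q G E K c"
  proof
    show "Q k e = 0" if "k \<in> K" "e \<in> E" for k e
    proof (rule orth_span[OF S(2)])
      show "e \<in> span S" using that E(3) spB span_superset by blast
    qed (use that K KS in auto)
  qed (use assms E EH spB in auto)
  then show ?thesis by (rule that)
qed

section \<open>Recovering a step function from its jumps\<close>

text \<open>Continuous induction on \<open>S\<close>, the set of endpoints up to which the count is
  finite and correct: \<open>left\<close> puts the supremum into \<open>S\<close>, and
  \<open>right\<close> moves beyond it unless it is \<open>b\<close>. Finiteness of the jump set is
  thus part of the conclusion.\<close>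

lemma count_by_jumps:
  fixes f \<nu> :: "real \<Rightarrow> nat"
  assumes low: "l \<le> b" "\<And>p. p \<le> l \<Longrightarrow> f p = 0"
    and left: "\<And>p. p \<le> b \<Longrightarrow> \<exists>\<epsilon>>0. \<forall>t. p - \<epsilon> < t \<and> t \<le> p \<longrightarrow> f t = f p"
    and right: "\<And>p. p < b \<Longrightarrow> \<exists>\<epsilon>>0. \<forall>t. p < t \<and> t < p + \<epsilon> \<and> t \<le> b \<longrightarrow> f t = f p + \<nu> p"
  shows "finite {p. p < b \<and> \<nu> p \<noteq> 0} \<and> (\<Sum>p\<in>{p. p < b \<and> \<nu> p \<noteq> 0}. \<nu> p) = f b"
proof -
  define Z where "Z t = {p. p < t \<and> \<nu> p \<noteq> 0}" for t
  define S where "S = {t. l \<le> t \<and> t \<le> b \<and> finite (Z t) \<and> (\<Sum>p\<in>Z t. \<nu> p) = f t}"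
  have const: "\<nu> p = 0" if pb: "p < b" "p < q" "\<And>t. p < t \<Longrightarrow> t < q \<Longrightarrow> f t = f p" for p q
  proof -
    obtain e where e: "e > 0" "\<And>t. p < t \<Longrightarrow> t < p + e \<Longrightarrow> t \<le> b \<Longrightarrow> f t = f p + \<nu> p"
      using right[of p] pb(1) by meson
    define r where "r = min (min e (q - p)) (b - p)"
    define t where "t = p + r / 2"
    have m: "r > 0" "r \<le> e" "r \<le> q - p" "r \<le> b - p" using e pb by (auto simp: r_def)
    have "p < t" "t < p + e" "t < q" "t \<le> b" unfolding t_def using m by linarith+
    then show ?thesis using e(2)[of t] that(3)[of t] by simp
  qed
  have lS: "l \<in> S"
  proof -
    have "Z l = {}"
    proof -
      have "\<nu> p = 0" if "p < l" for p
        by (rule const[of p l]) (use that low in auto)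
      then show ?thesis by (auto simp: Z_def)
    qed
    then show ?thesis using low by (simp add: S_def)
  qed
  define s where "s = Sup S"
  have bdd: "bdd_above S" by (auto simp: S_def intro!: bdd_aboveI[of _ b])
  have ls: "l \<le> s" using lS bdd by (simp add: s_def cSup_upper)
  have sb: "s \<le> b" unfolding s_def using lS by (intro cSup_least) (auto simp: S_def)
  have sS: "s \<in> S"
  proof -
    obtain e where e: "e > 0" "\<And>t. s - e < t \<Longrightarrow> t \<le> s \<Longrightarrow> f t = f s" using left[of s] sb by meson
    have "\<exists>t\<in>S. s - e < t" using lS e(1) less_cSup_iff[OF _ bdd, of "s - e"] by (auto simp: s_def)
    then obtain t where t: "t \<in> S" "s - e < t" by blast
    have ts: "t \<le> s" using t bdd by (simp add: s_def cSup_upper)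
    \<comment> \<open>By \<open>left\<close> the function is constant on \<open>(t, s]\<close> and
      at \<open>t\<close>, so no jump lies between \<open>t\<close> and the supremum.\<close>
    have "Z s = Z t"
    proof -
      have nz: "\<nu> p = 0" if "t \<le> p" "p < s" for p
      proof (rule const[of p s])
        fix r assume "p < r" "r < s"
        then show "f r = f p" using e(2)[of r] e(2)[of p] t(2) that by simp
      qed (use that sb in auto)
      then have "p < t" if "p < s" "\<nu> p \<noteq> 0" for p using nz[of p] that by (cases "t \<le> p") auto
      then show ?thesis using ts unfolding Z_def by auto
    qed
    then show ?thesis using t ts ls sb e(2)[of t] by (simp add: S_def)
  qed
  have "s = b"
  proof (rule ccontr)
    assume "s \<noteq> b"
    then have sb': "s < b" using sb by simp
    obtain e where e: "e > 0" "\<And>t. s < t \<Longrightarrow> t < s + e \<Longrightarrow> t \<le> b \<Longrightarrow> f t = f s + \<nu> s"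
      using right[of s] sb' by meson
    define r where "r = min e (b - s)"
    \<comment> \<open>A point beyond \<open>s\<close> but inside the range of \<open>right\<close>;
      the only possible new jump before it is \<open>s\<close> itself.\<close>
    define t where "t = s + r / 2"
    have m: "r > 0" "r \<le> e" "r \<le> b - s" using e sb' by (auto simp: r_def)
    have t: "s < t" "t < s + e" "t \<le> b" unfolding t_def using m by linarith+
    have nz: "\<nu> p = 0" if "s < p" "p < t" for p
    proof (rule const[of p t])
      fix r assume "p < r" "r < t"
      then show "f r = f p" using e(2)[of r] e(2)[of p] t that by simp
    qed (use that t in auto)
    have lt: "p = s \<or> p < s" if "p < t" "\<nu> p \<noteq> 0" for p using nz[of p] that by linarith
    then have Zt: "Z t = (if \<nu> s = 0 then Z s else insert s (Z s))"
    proof (cases "\<nu> s = 0")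
      case True
      have "p < s" if "p < t" "\<nu> p \<noteq> 0" for p using lt[of p] that True by auto
      then show ?thesis using t True unfolding Z_def by auto
    next
      case False
      have "p < s" if "p < t" "\<nu> p \<noteq> 0" "p \<noteq> s" for p using lt[of p] that by auto
      then show ?thesis using t False unfolding Z_def by auto
    qed
    have "s \<notin> Z s" by (simp add: Z_def)
    then have "t \<in> S" using sS t ls e(2)[OF t] Zt by (auto simp: S_def)
    then have "t \<le> s" using bdd by (simp add: s_def cSup_upper)
    then show False using t by simp
  qed
  then show ?thesis using sS by (simp add: S_def Z_def)
qed

section \<open>The eigenvalue equation as a linear system\<close>

lemma antiderivative_exists:
  fixes g :: "real \<Rightarrow> real"
  assumes "continuous_on UNIV g"
  obtains F where "F x0 = y0" "\<And>x. (F has_real_derivative g x) (at x)"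
proof -
  have "isCont g x" for x using assms by (simp add: continuous_on_eq_continuous_at)
  then obtain F where F: "\<And>x. (F has_vector_derivative g x) (at x)"
    using einterval_antiderivative[of "-\<infinity>" "\<infinity>" g] by auto
  show ?thesis
    by (rule that[of "\<lambda>x. F x - F x0 + y0"])
       (auto intro!: derivative_eq_intros F[unfolded has_real_derivative_iff_has_vector_derivative[symmetric]])
qed

lemma deriv_le_imp_diff_le:
  fixes f g :: "real \<Rightarrow> real"
  assumes "a \<le> b"
    and "\<And>x. a \<le> x \<Longrightarrow> x \<le> b \<Longrightarrow> (f has_real_derivative f' x) (at x)"
    and "\<And>x. a \<le> x \<Longrightarrow> x \<le> b \<Longrightarrow> (g has_real_derivative g' x) (at x)"
    and "\<And>x. a \<le> x \<Longrightarrow> x \<le> b \<Longrightarrow> f' x \<le> g' x"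
  shows "f b - f a \<le> g b - g a"
proof -
  have "g a - f a \<le> g b - f b"
    by (rule DERIV_nonneg_imp_nondecreasing[OF assms(1)])
       (use assms in \<open>fastforce intro!: derivative_eq_intros exI\<close>)
  then show ?thesis by simp
qed

lemma abs_deriv_le_imp:
  fixes f g :: "real \<Rightarrow> real"
  assumes "a \<le> b"
    and f: "\<And>x. a \<le> x \<Longrightarrow> x \<le> b \<Longrightarrow> (f has_real_derivative f' x) (at x)"
    and g: "\<And>x. a \<le> x \<Longrightarrow> x \<le> b \<Longrightarrow> (g has_real_derivative g' x) (at x)"
    and le: "\<And>x. a \<le> x \<Longrightarrow> x \<le> b \<Longrightarrow> \<bar>f' x\<bar> \<le> g' x"
  shows "\<bar>f b - f a\<bar> \<le> g b - g a"
proof -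
  have "f b - f a \<le> g b - g a"
    by (rule deriv_le_imp_diff_le[OF assms(1) f g]) (use le in force)+
  moreover have "(\<lambda>x. - f x) b - (\<lambda>x. - f x) a \<le> g b - g a"
    by (rule deriv_le_imp_diff_le[OF assms(1) _ g]) (use le f in \<open>force intro!: derivative_intros\<close>)+
  ultimately show ?thesis by simp
qed

definition vfield :: "(real \<Rightarrow> real) \<Rightarrow> real \<Rightarrow> (nat \<Rightarrow> real) \<Rightarrow> nat \<Rightarrow> real" where
  "vfield c x v k = (if k = 0 then v 1 else if k = 1 then v 2 - v 0 else if k = 2 then v 3
     else if k = 3 then - v 2 - c x * v 0 else 0)"

text \<open>The equation \<open>(\<partial>\<^sup>2 + 1)\<^sup>2 u + c u = 0\<close> as a first-order system for
  \<open>y = (u, u', w, w')\<close> with \<open>w = u'' + u\<close>.\<close>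

definition sol :: "(real \<Rightarrow> real) \<Rightarrow> (nat \<Rightarrow> real \<Rightarrow> real) \<Rightarrow> bool" where
  "sol c y \<longleftrightarrow> (\<forall>x. \<forall>k<4. (y k has_real_derivative vfield c x (\<lambda>j. y j x) k) (at x))"

lemma all_less_4: "(\<forall>k<4. P k) \<longleftrightarrow> P 0 \<and> P 1 \<and> P 2 \<and> P (3::nat)"
  by (auto simp: numeral_eq_Suc All_less_Suc)

lemma solD:
  assumes "sol c y"
  shows "(y 0 has_real_derivative y 1 x) (at x)" "(y 1 has_real_derivative y 2 x - y 0 x) (at x)"
    "(y 2 has_real_derivative y 3 x) (at x)" "(y 3 has_real_derivative - y 2 x - c x * y 0 x) (at x)"
  using assms unfolding sol_def all_less_4 by (auto simp: vfield_def)

lemma solI: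
  assumes "\<And>x. (y 0 has_real_derivative y 1 x) (at x)" "\<And>x. (y 1 has_real_derivative y 2 x - y 0 x) (at x)"
    "\<And>x. (y 2 has_real_derivative y 3 x) (at x)" "\<And>x. (y 3 has_real_derivative - y 2 x - c x * y 0 x) (at x)"
  shows "sol c y"
  using assms unfolding sol_def all_less_4 by (auto simp: vfield_def)

lemma sol_deriv_comb:
  assumes "sol c y" "sol c z"
  shows "sol c (\<lambda>k x. a * y k x + b * z k x)"
  by (rule solI) (auto intro!: derivative_eq_intros solD[OF assms(1)] solD[OF assms(2)] simp: algebra_simps simp del: One_nat_def)

lemma sol_scale: "sol c y \<Longrightarrow> sol c (\<lambda>k x. a * y k x)"
  using sol_deriv_comb[of c y y a 0] by simp

lemma sol_add: "sol c y \<Longrightarrow> sol c z \<Longrightarrow> sol c (\<lambda>k x. y k x + z k x)"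
  using sol_deriv_comb[of c y z 1 1] by simp

lemma sol_diff: "sol c y \<Longrightarrow> sol c z \<Longrightarrow> sol c (\<lambda>k x. y k x - z k x)"
  using sol_deriv_comb[of c y z 1 "-1"] by simp

lemma sol_zero: "sol c (\<lambda>k x. 0)"
  by (rule solI) auto

lemma sol_isCont: "sol c y \<Longrightarrow> k < 4 \<Longrightarrow> isCont (y k) x"
  unfolding sol_def using DERIV_isCont by blast

lemma sol_continuous_on: "sol c y \<Longrightarrow> k < 4 \<Longrightarrow> continuous_on S (y k)"
  by (intro continuous_at_imp_continuous_on ballI sol_isCont)

text \<open>The boundary term left over when the quadratic form of a solution is integrated by
  parts, w u' - w' u for w = u'' + u. Despite the name it involves a single solution.\<close>

definition wronsk :: "(nat \<Rightarrow> real \<Rightarrow> real) \<Rightarrow> real \<Rightarrow> real" where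
  "wronsk y x = y 2 x * y 1 x - y 3 x * y 0 x"

lemma wronsk_deriv:
  assumes "sol c y"
  shows "(wronsk y has_real_derivative (y 2 x)\<^sup>2 + c x * (y 0 x)\<^sup>2) (at x)"
  unfolding wronsk_def[abs_def]
  by (auto intro!: derivative_eq_intros solD[OF assms] simp: algebra_simps power2_eq_square simp del: One_nat_def)

section \<open>Existence and uniqueness for the linear system\<close>

locale bounded_potential =
  fixes c :: "real \<Rightarrow> real" and M :: real
  assumes cont: "continuous_on UNIV c" and bd: "\<bar>c x\<bar> \<le> M"
begin

lemma M_nonneg: "0 \<le> M" using bd[of 0] by linarith

lemma continuous_vfield:
  assumes "\<And>k. k < 4 \<Longrightarrow> continuous_on UNIV (y k)" "k < 4"
  shows "continuous_on UNIV (\<lambda>x. vfield c x (\<lambda>j. y j x) k)"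
proof -
  have "\<forall>k<4. continuous_on UNIV (\<lambda>x. vfield c x (\<lambda>j. y j x) k)"
    unfolding all_less_4 vfield_def using assms(1) cont by (auto intro!: continuous_intros)
  then show ?thesis using assms(2) by blast
qed

lemma vfield_bound:
  assumes "\<And>k. k < 4 \<Longrightarrow> \<bar>v k\<bar> \<le> m" "k < 4"
  shows "\<bar>vfield c x v k\<bar> \<le> (2 + M) * m"
proof -
  have m: "0 \<le> m" using assms(1)[of 0] by simp
  have "\<bar>c x * v 0\<bar> \<le> M * m" unfolding abs_mult by (rule mult_mono) (use bd M_nonneg assms(1)[of 0] in auto)
  moreover have "0 \<le> M * m" using m M_nonneg by simp
  ultimately have "\<forall>k<4. \<bar>vfield c x v k\<bar> \<le> (2 + M) * m"
    unfolding all_less_4 vfield_def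
    using assms(1)[of 0] assms(1)[of 1] assms(1)[of 2] assms(1)[of 3] m by (auto simp: algebra_simps)
  then show ?thesis using assms(2) by blast
qed

text \<open>These are the increments of Picard iteration rather than the iterates: each is the
  primitive, vanishing at \<open>x0\<close>, of the field along the previous one. The solution will
  be their sum.\<close>

lemma picard_sequence:
  obtains Y :: "nat \<Rightarrow> nat \<Rightarrow> real \<Rightarrow> real" where
    "\<And>k x. Y 0 k x = \<xi> k" "\<And>n k. k < 4 \<Longrightarrow> Y (Suc n) k x0 = 0"
    "\<And>n k x. k < 4 \<Longrightarrow> (Y (Suc n) k has_real_derivative vfield c x (\<lambda>j. Y n j x) k) (at x)"
proof -
  \<comment> \<open>Continuity is carried along so that the next primitive exists, and the clause
    for \<open>n = 0\<close> pins the start of the dependent choice.\<close>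
  define P where "P n Z \<longleftrightarrow> (\<forall>k<4. continuous_on UNIV (Z k)) \<and> (n = 0 \<longrightarrow> Z = (\<lambda>k x. \<xi> k))"
    for n :: nat and Z :: "nat \<Rightarrow> real \<Rightarrow> real"
  define R where "R n Z Z' \<longleftrightarrow> (\<forall>k<4. Z' k x0 = 0 \<and>
     (\<forall>x. (Z' k has_real_derivative vfield c x (\<lambda>j. Z j x) k) (at x)))" for n :: nat and Z Z' :: "nat \<Rightarrow> real \<Rightarrow> real"
  have step: "\<exists>Z'. P (Suc n) Z' \<and> R n Z Z'" if Z: "P n Z" for n Z
  proof -
    have "\<exists>F. F x0 = 0 \<and> (\<forall>x. (F has_real_derivative vfield c x (\<lambda>j. Z j x) k) (at x))" if "k < 4" for k
    proof -
      have "continuous_on UNIV (\<lambda>x. vfield c x (\<lambda>j. Z j x) k)"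
        by (rule continuous_vfield) (use Z that in \<open>auto simp: P_def\<close>)
      then show ?thesis by (rule antiderivative_exists[where ?x0.0 = x0 and ?y0.0 = 0]) blast
    qed
    then obtain Z' where Z': "\<And>k. k < 4 \<Longrightarrow> Z' k x0 = 0 \<and> (\<forall>x. (Z' k has_real_derivative vfield c x (\<lambda>j. Z j x) k) (at x))"
      by metis
    have "continuous_on UNIV (Z' k)" if "k < 4" for k
      using Z'[OF that] DERIV_isCont by (blast intro: continuous_at_imp_continuous_on)
    then show ?thesis using Z' by (intro exI[of _ Z']) (auto simp: P_def R_def)
  qed
  have "\<exists>Y. \<forall>n. P n (Y n) \<and> R n (Y n) (Y (Suc n))"
    by (rule dependent_nat_choice) (use step in \<open>auto simp: P_def\<close>)
  then obtain Y where Y: "\<And>n. P n (Y n)" "\<And>n. R n (Y n) (Y (Suc n))" by blast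
  show ?thesis
    by (rule that[of Y]) (use Y(1)[of 0] Y(2) in \<open>auto simp: P_def R_def\<close>)
qed

lemma picard_bound:
  assumes Y0: "\<And>k x. Y 0 k x = \<xi> k" and Y1: "\<And>n k. k < 4 \<Longrightarrow> Y (Suc n) k x0 = 0"
    and Y2: "\<And>n k x. k < 4 \<Longrightarrow> (Y (Suc n) k has_real_derivative vfield c x (\<lambda>j. Y n j x) k) (at x)"
    and C: "\<And>k. k < 4 \<Longrightarrow> \<bar>\<xi> k\<bar> \<le> C"
    and k: "k < 4"
  shows "\<bar>Y n k x\<bar> \<le> C * ((2 + M) * \<bar>x - x0\<bar>) ^ n / fact n"
  using k
proof (induction n arbitrary: k x)
  case 0
  then show ?case using Y0 C by simp
next
  case (Suc n)
  let ?K = "2 + M"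
  let ?g = "\<lambda>t. C * ?K ^ Suc n * t ^ n / fact n"
  have b: "\<bar>vfield c t (\<lambda>j. Y n j t) k\<bar> \<le> C * ?K ^ Suc n * \<bar>t - x0\<bar> ^ n / fact n" for t
  proof -
    have "\<bar>vfield c t (\<lambda>j. Y n j t) k\<bar> \<le> ?K * (C * (?K * \<bar>t - x0\<bar>) ^ n / fact n)"
      by (rule vfield_bound) (use Suc in auto)
    then show ?thesis by (simp add: power_mult_distrib mult_ac)
  qed
  show ?case
  proof (cases "x0 \<le> x")
    case True
    have "\<bar>Y (Suc n) k x - Y (Suc n) k x0\<bar> \<le> C * ?K ^ Suc n * (x - x0) ^ Suc n / fact (Suc n) - C * ?K ^ Suc n * (x0 - x0) ^ Suc n / fact (Suc n)"
    proof (rule abs_deriv_le_imp[OF True Y2[OF Suc.prems]])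
      fix t assume t: "x0 \<le> t" "t \<le> x"
      show "((\<lambda>t. C * ?K ^ Suc n * (t - x0) ^ Suc n / fact (Suc n)) has_real_derivative C * ?K ^ Suc n * (t - x0) ^ n / fact n) (at t)"
        by (rule derivative_eq_intros refl | simp add: field_simps del: of_nat_Suc power_Suc)+
      show "\<bar>vfield c t (\<lambda>j. Y n j t) k\<bar> \<le> C * ?K ^ Suc n * (t - x0) ^ n / fact n" using b[of t] t by simp
    qed
    then show ?thesis using True Y1[OF Suc.prems] by (simp add: power_mult_distrib mult_ac)
  next
    case False
    then have le: "x \<le> x0" by simp
    \<comment> \<open>To the left of \<open>x0\<close> the majorant must still increase with its
      argument, hence the minus sign in front of the power of \<open>x0 - t\<close>.\<close>
    have "\<bar>Y (Suc n) k x0 - Y (Suc n) k x\<bar> \<le> (- C * ?K ^ Suc n * (x0 - x0) ^ Suc n / fact (Suc n)) - (- C * ?K ^ Suc n * (x0 - x) ^ Suc n / fact (Suc n))"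
    proof (rule abs_deriv_le_imp[OF le Y2[OF Suc.prems]])
      fix t assume t: "x \<le> t" "t \<le> x0"
      show "((\<lambda>t. - C * ?K ^ Suc n * (x0 - t) ^ Suc n / fact (Suc n)) has_real_derivative C * ?K ^ Suc n * (x0 - t) ^ n / fact n) (at t)"
        by (rule derivative_eq_intros refl | simp add: field_simps del: of_nat_Suc power_Suc)+
      show "\<bar>vfield c t (\<lambda>j. Y n j t) k\<bar> \<le> C * ?K ^ Suc n * (x0 - t) ^ n / fact n" using b[of t] t by simp
    qed
    then show ?thesis using False Y1[OF Suc.prems] by (simp add: power_mult_distrib mult_ac)
  qed
qed

lemma sol_exists: obtains y where "sol c y" "\<And>k. k < 4 \<Longrightarrow> y k x0 = \<xi> k"
proof -
  obtain Y :: "nat \<Rightarrow> nat \<Rightarrow> real \<Rightarrow> real" where Y: "\<And>k x. Y 0 k x = \<xi> k" "\<And>n k. k < 4 \<Longrightarrow> Y (Suc n) k x0 = 0"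
    "\<And>n k x. k < 4 \<Longrightarrow> (Y (Suc n) k has_real_derivative vfield c x (\<lambda>j. Y n j x) k) (at x)"
    using picard_sequence by blast
  define C where "C = (\<Sum>k<4. \<bar>\<xi> k\<bar>)"
  have C: "\<bar>\<xi> k\<bar> \<le> C" if "k < 4" for k
    unfolding C_def by (rule member_le_sum) (use that in auto)
  note bnd = picard_bound[OF Y C]
  define K where "K = 2 + M"
  have K: "K \<ge> 0" using M_nonneg by (simp add: K_def)
  have C0: "C \<ge> 0" by (simp add: C_def sum_nonneg)
  define y where "y k x = (\<Sum>n. Y n k x)" for k x
  \<comment> \<open>Termwise derivatives, with the index shifted by one: the constant term
    contributes 0 and term \<open>m + 1\<close> contributes the field along term
    \<open>m\<close>.\<close>
  define Y' where "Y' k n x = (case n of 0 \<Rightarrow> 0 | Suc m \<Rightarrow> vfield c x (\<lambda>j. Y m j x) k)" for k n x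
  have exps: "summable (\<lambda>n. C * (K * R) ^ n / fact n)" for R
    using summable_mult[OF summable_exp_generic[of "K * R"], of C] by (simp add: scaleR_conv_of_real field_simps)
  have summ: "summable (\<lambda>n. Y n k x)" if "k < 4" for k x
    by (rule summable_comparison_test'[OF exps[of "\<bar>x - x0\<bar>"], of 0]) (use bnd that in \<open>simp add: K_def\<close>)
  have der: "(y k has_real_derivative (\<Sum>n. Y' k n x)) (at x)" if k: "k < 4" for k x
  proof -
    \<comment> \<open>The added 1 puts \<open>x\<close> in the interior of the interval on which the
      differentiated series converges uniformly.\<close>
    define R where "R = \<bar>x - x0\<bar> + 1"
    have xR: "x \<in> interior {x0 - R..x0 + R}" by (auto simp: R_def interior_atLeastAtMost_real abs_if)
    have "uniformly_convergent_on {x0 - R..x0 + R} (\<lambda>n x. \<Sum>i<n. Y' k i x)"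
    proof (rule Weierstrass_m_test')
      show "norm (Y' k n t) \<le> (case n of 0 \<Rightarrow> 0 | Suc m \<Rightarrow> K * (C * (K * R) ^ m / fact m))" if t: "t \<in> {x0 - R..x0 + R}" for n t
      proof (cases n)
        case (Suc m)
        have "\<bar>Y m j t\<bar> \<le> C * (K * R) ^ m / fact m" if "j < 4" for j
        proof -
          have "\<bar>Y m j t\<bar> \<le> C * (K * \<bar>t - x0\<bar>) ^ m / fact m" using bnd that by (simp add: K_def)
          also have "\<dots> \<le> C * (K * R) ^ m / fact m"
            using t K C0 by (intro divide_right_mono mult_left_mono power_mono) auto
          finally show ?thesis .
        qed
        then have "\<bar>vfield c t (\<lambda>j. Y m j t) k\<bar> \<le> (2 + M) * (C * (K * R) ^ m / fact m)"
          using k by (rule vfield_bound)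
        then show ?thesis using Suc by (simp add: Y'_def K_def)
      qed (simp add: Y'_def)
      have "summable (\<lambda>m. K * (C * (K * R) ^ m / fact m))" by (rule summable_mult[OF exps])
      then show "summable (\<lambda>n. case n of 0 \<Rightarrow> 0 | Suc m \<Rightarrow> K * (C * (K * R) ^ m / fact m))"
        by (subst summable_Suc_iff[symmetric]) simp
    qed
    moreover have "(Y n k has_real_derivative Y' k n t) (at t within {x0 - R..x0 + R})" for n t
    proof (cases n)
      case 0
      then have "Y n k = (\<lambda>x. \<xi> k)" using Y(1) by auto
      then show ?thesis using 0 by (simp add: Y'_def)
    next
      case (Suc m)
      then show ?thesis using has_field_derivative_at_within[OF Y(3)[OF k]] by (simp add: Y'_def)
    qed
    moreover have "x0 \<in> {x0 - R..x0 + R}" by (simp add: R_def)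
    ultimately have "((\<lambda>x. \<Sum>n. Y n k x) has_real_derivative (\<Sum>n. Y' k n x)) (at x)"
      using has_field_derivative_series'(2)[of "{x0 - R..x0 + R}" "\<lambda>n. Y n k" "Y' k" x0 x] summ[OF k] xR by simp
    then show ?thesis by (simp add: y_def[abs_def])
  qed
  have "(\<Sum>n. Y' k n x) = vfield c x (\<lambda>j. y j x) k" if k: "k < 4" for k x
  proof -
    have s: "(\<lambda>n. Y n j x) sums y j x" if "j < 4" for j unfolding y_def using summ[OF that] by (simp add: summable_sums)
    have "\<forall>k<4. (\<lambda>m. vfield c x (\<lambda>j. Y m j x) k) sums vfield c x (\<lambda>j. y j x) k"
      unfolding all_less_4 vfield_def using s[of 0] s[of 1] s[of 2] s[of 3]
      by (auto intro!: sums_diff sums_minus sums_mult)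
    then have "(\<lambda>m. Y' k (Suc m) x) sums vfield c x (\<lambda>j. y j x) k" using k by (simp add: Y'_def)
    then have "(\<lambda>m. Y' k m x) sums vfield c x (\<lambda>j. y j x) k" by (subst (asm) sums_Suc_iff) (simp add: Y'_def)
    then show ?thesis by (rule sums_unique[symmetric])
  qed
  then have "sol c y" using der unfolding sol_def by simp
  moreover have "y k x0 = \<xi> k" if "k < 4" for k
  proof -
    have "y k x0 = (\<Sum>n. if n = 0 then \<xi> k else 0)"
      unfolding y_def by (rule arg_cong[where f = suminf]) (auto simp: fun_eq_iff Y(1) Y(2)[OF that] gr0_conv_Suc)
    also have "\<dots> = \<xi> k" using sums_unique[OF sums_single[of 0 "\<lambda>_. \<xi> k"]] by simp
    finally show ?thesis .
  qed
  ultimately show ?thesis using that by blast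
qed

text \<open>The left side is the derivative of the sum of squares along a solution. The products
  \<open>y0 * y1\<close> and \<open>y2 * y3\<close> cancel, which leaves two cross terms and the
  rate \<open>1 + M\<close>.\<close>

lemma energy_rate:
  fixes y0 y1 y2 y3 :: real
  shows "\<bar>2 * y0 * y1 + 2 * y1 * (y2 - y0) + 2 * y2 * y3 + 2 * y3 * (- y2 - c x * y0)\<bar>
     \<le> (1 + M) * (y0\<^sup>2 + y1\<^sup>2 + y2\<^sup>2 + y3\<^sup>2)"
proof -
  have e: "2 * y0 * y1 + 2 * y1 * (y2 - y0) + 2 * y2 * y3 + 2 * y3 * (- y2 - c x * y0) = 2 * (y1 * y2) - c x * (2 * (y3 * y0))"
    by (simp add: algebra_simps)
  have "2 * \<bar>y1 * y2\<bar> \<le> y1\<^sup>2 + y2\<^sup>2" using sum_squares_bound[of "\<bar>y1\<bar>" "\<bar>y2\<bar>"] by (simp add: abs_mult)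
  moreover have "2 * \<bar>y3 * y0\<bar> \<le> y3\<^sup>2 + y0\<^sup>2" using sum_squares_bound[of "\<bar>y3\<bar>" "\<bar>y0\<bar>"] by (simp add: abs_mult)
  then have "\<bar>c x\<bar> * (2 * \<bar>y3 * y0\<bar>) \<le> M * (y3\<^sup>2 + y0\<^sup>2)" using bd M_nonneg by (intro mult_mono) auto
  then have "\<bar>c x * (2 * (y3 * y0))\<bar> \<le> M * (y3\<^sup>2 + y0\<^sup>2)" by (simp add: abs_mult)
  ultimately have "\<bar>2 * (y1 * y2) - c x * (2 * (y3 * y0))\<bar> \<le> (y1\<^sup>2 + y2\<^sup>2) + M * (y3\<^sup>2 + y0\<^sup>2)"
    by linarith
  also have "\<dots> \<le> (1 + M) * (y0\<^sup>2 + y1\<^sup>2 + y2\<^sup>2 + y3\<^sup>2)" using M_nonneg by (simp add: algebra_simps)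
  finally show ?thesis using e by simp
qed

text \<open>Gronwall backwards: the sum of squares times \<open>exp ((1 + M) * x)\<close> is
  nondecreasing and vanishes at \<open>s\<close>. Only continuity on the closed interval and
  derivatives inside are assumed, since this is also applied to representatives of Sobolev
  functions, which are known only up to the endpoint \<open>s\<close>.\<close>

lemma zero_left:
  fixes y :: "nat \<Rightarrow> real \<Rightarrow> real"
  assumes "a \<le> s" and cy: "\<And>k. k < 4 \<Longrightarrow> continuous_on {a..s} (y k)"
    and d: "\<And>k x. k < 4 \<Longrightarrow> a < x \<Longrightarrow> x < s \<Longrightarrow> (y k has_real_derivative vfield c x (\<lambda>j. y j x) k) (at x)"
    and z: "\<And>k. k < 4 \<Longrightarrow> y k s = 0"
  shows "k < 4 \<Longrightarrow> y k a = 0"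
proof -
  define N where "N x = (y 0 x)\<^sup>2 + (y 1 x)\<^sup>2 + (y 2 x)\<^sup>2 + (y 3 x)\<^sup>2" for x
  have "N a * exp ((1 + M) * a) \<le> N s * exp ((1 + M) * s)"
  proof (rule DERIV_nonneg_imp_increasing_open[OF assms(1)])
    show "continuous_on {a..s} (\<lambda>x. N x * exp ((1 + M) * x))"
      unfolding N_def by (intro continuous_intros cy) auto
    fix x assume x: "a < x" "x < s"
    let ?d = "2 * y 0 x * y 1 x + 2 * y 1 x * (y 2 x - y 0 x) + 2 * y 2 x * y 3 x + 2 * y 3 x * (- y 2 x - c x * y 0 x)"
    have dd: "(y 0 has_real_derivative y 1 x) (at x)" "(y 1 has_real_derivative y 2 x - y 0 x) (at x)"
      "(y 2 has_real_derivative y 3 x) (at x)" "(y 3 has_real_derivative - y 2 x - c x * y 0 x) (at x)"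
      using d[of 0 x] d[of 1 x] d[of 2 x] d[of 3 x] x by (auto simp: vfield_def)
    have "((\<lambda>x. N x * exp ((1 + M) * x)) has_real_derivative (?d + (1 + M) * N x) * exp ((1 + M) * x)) (at x)"
      unfolding N_def by (auto intro!: derivative_eq_intros dd simp: algebra_simps simp del: One_nat_def)
    moreover have "?d + (1 + M) * N x \<ge> 0" using energy_rate[of "y 0 x" "y 1 x" "y 2 x" "y 3 x" x] unfolding N_def by linarith
    ultimately show "\<exists>d. ((\<lambda>x. N x * exp ((1 + M) * x)) has_real_derivative d) (at x) \<and> 0 \<le> d" by fastforce
  qed
  moreover have "N s = 0" using z by (simp add: N_def)
  ultimately have "N a \<le> 0" by (simp add: mult_le_0_iff)
  moreover have "(y 0 a)\<^sup>2 \<ge> 0" "(y 1 a)\<^sup>2 \<ge> 0" "(y 2 a)\<^sup>2 \<ge> 0" "(y 3 a)\<^sup>2 \<ge> 0" by simp_all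
  ultimately have "(y 0 a)\<^sup>2 = 0" "(y 1 a)\<^sup>2 = 0" "(y 2 a)\<^sup>2 = 0" "(y 3 a)\<^sup>2 = 0" unfolding N_def by linarith+
  then have "\<forall>k<4. y k a = 0" unfolding all_less_4 by simp
  then show "k < 4 \<Longrightarrow> y k a = 0" by blast
qed

lemma sol_unique_zero:
  assumes s: "sol c y" and z: "\<And>k. k < 4 \<Longrightarrow> y k x0 = 0" and k: "k < 4"
  shows "y k x = 0"
proof (cases "x \<le> x0")
  case True
  show ?thesis
    using True
  proof (rule zero_left[where s = x0 and y = y and k = k])
    show "continuous_on {x..x0} (y j)" if "j < 4" for j by (rule sol_continuous_on[OF s that])
    show "(y j has_real_derivative vfield c t (\<lambda>j. y j t) j) (at t)" if "j < 4" for j t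
      using s that by (simp add: sol_def)
  qed (use z k in auto)
next
  case False
  then have le: "x0 \<le> x" by simp
  define N where "N x = (y 0 x)\<^sup>2 + (y 1 x)\<^sup>2 + (y 2 x)\<^sup>2 + (y 3 x)\<^sup>2" for x
  have "N x * exp (- ((1 + M) * x)) \<le> N x0 * exp (- ((1 + M) * x0))"
  proof (rule DERIV_nonpos_imp_nonincreasing[OF le])
    fix x
    let ?d = "2 * y 0 x * y 1 x + 2 * y 1 x * (y 2 x - y 0 x) + 2 * y 2 x * y 3 x + 2 * y 3 x * (- y 2 x - c x * y 0 x)"
    have "((\<lambda>x. N x * exp (- ((1 + M) * x))) has_real_derivative (?d - (1 + M) * N x) * exp (- ((1 + M) * x))) (at x)"
      unfolding N_def by (auto intro!: derivative_eq_intros solD[OF s] simp: algebra_simps simp del: One_nat_def)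
    moreover have "?d - (1 + M) * N x \<le> 0" using energy_rate[of "y 0 x" "y 1 x" "y 2 x" "y 3 x" x] unfolding N_def by linarith
    then have "(?d - (1 + M) * N x) * exp (- ((1 + M) * x)) \<le> 0"
      by (rule mult_nonpos_nonneg) simp
    ultimately show "\<exists>d. ((\<lambda>x. N x * exp (- ((1 + M) * x))) has_real_derivative d) (at x) \<and> d \<le> 0" by blast
  qed
  moreover have "N x0 = 0" using z by (simp add: N_def)
  ultimately have "N x \<le> 0" by (simp add: mult_le_0_iff)
  moreover have "(y 0 x)\<^sup>2 \<ge> 0" "(y 1 x)\<^sup>2 \<ge> 0" "(y 2 x)\<^sup>2 \<ge> 0" "(y 3 x)\<^sup>2 \<ge> 0" by simp_all
  ultimately have "(y 0 x)\<^sup>2 = 0" "(y 1 x)\<^sup>2 = 0" "(y 2 x)\<^sup>2 = 0" "(y 3 x)\<^sup>2 = 0" unfolding N_def by linarith+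
  then have "\<forall>k<4. y k x = 0" unfolding all_less_4 by simp
  then show ?thesis using k by blast
qed

lemma sol_unique:
  assumes "sol c y" "sol c z" "\<And>k. k < 4 \<Longrightarrow> y k x0 = z k x0" "k < 4"
  shows "y k x = z k x"
  using sol_unique_zero[OF sol_diff[OF assms(1,2)], of x0 k x] assms(3,4) by simp

text \<open>Unique continuation: differentiating \<open>y 0\<close> successively shows that all
  components vanish inside the interval, hence everywhere.\<close>

lemma sol_zero_on_interval:
  assumes s: "sol c y" and z: "\<And>x. l < x \<Longrightarrow> x < r \<Longrightarrow> y 0 x = 0" and "l < r" "k < 4"
  shows "y k x = 0"
proof -
  have dz: "d = 0" if "\<And>x. l < x \<Longrightarrow> x < r \<Longrightarrow> f x = 0" "l < t" "t < r" "(f has_real_derivative d) (at t)"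
    for f :: "real \<Rightarrow> real" and d t
  proof -
    have "eventually (\<lambda>x. x \<in> {l<..<r}) (nhds t)" using that by (intro eventually_nhds_in_open) auto
    then have "eventually (\<lambda>x. f x = 0) (nhds t)" by (rule eventually_mono) (use that in auto)
    then have "((\<lambda>_. 0) has_real_derivative d) (at t)"
      using DERIV_cong_ev[of t t f "\<lambda>_. 0" d] that by auto
    then show ?thesis using DERIV_unique[OF _ DERIV_const] by blast
  qed
  have z1: "y 1 t = 0" if "l < t" "t < r" for t using dz[OF z that solD(1)[OF s]] .
  have z2: "y 2 t = 0" if "l < t" "t < r" for t using dz[OF z1 that solD(2)[OF s]] z[OF that] by simp
  have z3: "y 3 t = 0" if "l < t" "t < r" for t using dz[OF z2 that solD(3)[OF s]] .
  define m where "m = (l + r) / 2"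
  have m: "l < m" "m < r" using assms(3) by (auto simp: m_def)
  have "\<forall>k<4. y k m = 0" unfolding all_less_4 using z[OF m] z1[OF m] z2[OF m] z3[OF m] by simp
  then show ?thesis using sol_unique_zero[OF s, of m k x] assms(4) by blast
qed

text \<open>\<open>Y \<xi>\<close> is the solution with Cauchy data \<open>\<xi>\<close> at
  \<open>t\<close>, depending linearly and continuously on \<open>\<xi>\<close>. Data are tuples, so
  that compactness and dimension arguments take place in a Euclidean space.\<close>

lemma sol_parametrization:
  obtains Y :: "real \<times> real \<times> real \<times> real \<Rightarrow> nat \<Rightarrow> real \<Rightarrow> real" where
    "\<And>\<xi>. sol c (Y \<xi>)"
    "\<And>p q r s. Y (p, q, r, s) 0 t = p" "\<And>p q r s. Y (p, q, r, s) 1 t = q"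
    "\<And>p q r s. Y (p, q, r, s) 2 t = r" "\<And>p q r s. Y (p, q, r, s) 3 t = s"
    "\<And>\<alpha> \<xi> \<beta> \<eta> k x. Y (\<alpha> *\<^sub>R \<xi> + \<beta> *\<^sub>R \<eta>) k x = \<alpha> * Y \<xi> k x + \<beta> * Y \<eta> k x"
    "\<And>y k x. sol c y \<Longrightarrow> k < 4 \<Longrightarrow> y k x = Y (y 0 t, y 1 t, y 2 t, y 3 t) k x"
    "\<And>g \<xi> k x. g \<longlonglongrightarrow> \<xi> \<Longrightarrow> (\<lambda>n. Y (g n) k x) \<longlonglongrightarrow> Y \<xi> k x"
proof -
  have "\<exists>y. sol c y \<and> (\<forall>k<4. y k t = (if k = j then 1 else 0))" for j
    by (rule sol_exists[of t "\<lambda>k. if k = j then 1 else 0"]) blast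
  then obtain U where U: "\<And>j. sol c (U j)" "\<And>j k. k < 4 \<Longrightarrow> U j k t = (if k = j then 1 else 0)" by metis
  define Y where "Y \<xi> k x = (case \<xi> of (p, q, r, s) \<Rightarrow> p * U 0 k x + q * U 1 k x + r * U 2 k x + s * U 3 k x)"
    for \<xi> :: "real \<times> real \<times> real \<times> real" and k x
  have Ysol: "sol c (Y \<xi>)" for \<xi>
  proof -
    obtain p q r s where \<xi>: "\<xi> = (p, q, r, s)" by (cases \<xi>) auto
    have "sol c (\<lambda>k x. (p * U 0 k x + q * U 1 k x) + (r * U 2 k x + s * U 3 k x))"
      by (intro sol_add sol_scale U)
    then show ?thesis unfolding Y_def[abs_def] \<xi> by (simp add: add.assoc)
  qed
  have Yt: "Y (p, q, r, s) 0 t = p" "Y (p, q, r, s) 1 t = q" "Y (p, q, r, s) 2 t = r" "Y (p, q, r, s) 3 t = s" for p q r s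
    unfolding Y_def using U(2) by simp_all
  show ?thesis
  proof (rule that[OF Ysol Yt])
    show "Y (\<alpha> *\<^sub>R \<xi> + \<beta> *\<^sub>R \<eta>) k x = \<alpha> * Y \<xi> k x + \<beta> * Y \<eta> k x" for \<alpha> \<beta> \<xi> \<eta> k x
      by (cases \<xi>; cases \<eta>) (simp add: Y_def algebra_simps)
    show "y k x = Y (y 0 t, y 1 t, y 2 t, y 3 t) k x" if "sol c y" "k < 4" for y k x
    proof (rule sol_unique[OF that(1) Ysol _ that(2)])
      fix j :: nat assume "j < 4"
      moreover have "\<forall>j<4. y j t = Y (y 0 t, y 1 t, y 2 t, y 3 t) j t" unfolding all_less_4 Yt by simp
      ultimately show "y j t = Y (y 0 t, y 1 t, y 2 t, y 3 t) j t" by blast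
    qed
    show "(\<lambda>n. Y (g n) k x) \<longlonglongrightarrow> Y \<xi> k x" if "g \<longlonglongrightarrow> \<xi>" for g \<xi> k x
      unfolding Y_def case_prod_beta by (intro tendsto_intros that)
  qed
qed

end

section \<open>Solutions decaying at minus infinity\<close>

lemma set_integrable_lessThan_iff:
  fixes h :: "real \<Rightarrow> real"
  assumes "h \<in> borel_measurable borel"
  shows "set_integrable lborel {..<a} h \<longleftrightarrow> set_integrable lborel {..a} h"
  unfolding set_integrable_def
proof (rule integrable_cong_AE)
  show "AE x in lborel. indicat_real {..<a} x *\<^sub>R h x = indicat_real {..a} x *\<^sub>R h x"
    using AE_lborel_singleton[of a] by eventually_elim (auto simp: indicator_def)
qed (use assms in measurable)

lemma mono_bounded_below_tendsto_at_bot: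
  fixes F :: "real \<Rightarrow> real"
  assumes mono: "\<And>x y. x \<le> y \<Longrightarrow> y \<le> a \<Longrightarrow> F x \<le> F y" and low: "\<And>x. x \<le> a \<Longrightarrow> m \<le> F x"
  obtains A where "(F \<longlongrightarrow> A) at_bot"
proof -
  define A where "A = Inf (F ` {..a})"
  have bdd: "bdd_below (F ` {..a})" by (rule bdd_belowI[of _ m]) (use low in auto)
  have "(F \<longlongrightarrow> A) at_bot"
  proof (rule decreasing_tendsto)
    show "eventually (\<lambda>x. A \<le> F x) at_bot"
      using eventually_le_at_bot[of a] by eventually_elim (auto simp: A_def intro!: cInf_lower bdd)
    fix x assume "A < x"
    then obtain t where t: "t \<le> a" "F t < x" using cInf_less_iff[OF _ bdd] by (auto simp: A_def)
    show "eventually (\<lambda>n. F n < x) at_bot"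
      using eventually_le_at_bot[of t] by eventually_elim (use mono t in \<open>meson le_less_trans\<close>)
  qed
  then show ?thesis by (rule that)
qed

text \<open>A nonnegative density is integrable near -infinity once its primitive is bounded below.
  Applied to \<open>wronsk\<close>, this turns a sign into square integrability.\<close>

lemma set_integrable_from_antiderivative:
  fixes F h :: "real \<Rightarrow> real"
  assumes F: "\<And>x. (F has_real_derivative h x) (at x)" and h: "continuous_on UNIV h"
    and nonneg: "\<And>x. x \<le> a \<Longrightarrow> 0 \<le> h x" and low: "\<And>x. x \<le> a \<Longrightarrow> m \<le> F x"
  shows "set_integrable lborel {..a} h"
proof -
  have "F x \<le> F y" if "x \<le> y" "y \<le> a" for x y
    by (rule DERIV_nonneg_imp_nondecreasing[OF that(1)]) (use that F nonneg in force)
  then obtain A where A: "(F \<longlongrightarrow> A) at_bot" using mono_bounded_below_tendsto_at_bot low by blast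
  have "set_integrable lborel (einterval (-\<infinity>) (ereal a)) h"
  proof (rule interval_integral_FTC_nonneg(1))
    show "((F \<circ> real_of_ereal) \<longlongrightarrow> A) (at_right (-\<infinity>))"
      by (simp add: at_right_MInf filterlim_filtermap comp_def A)
    have "isCont F a" using F DERIV_isCont by blast
    then have "(F \<longlongrightarrow> F a) (at_left a)" by (simp add: isCont_def filterlim_at_split)
    then show "((F \<circ> real_of_ereal) \<longlongrightarrow> F a) (at_left (ereal a))"
      by (simp add: at_left_ereal filterlim_filtermap comp_def)
  qed (use F h nonneg in \<open>auto simp: continuous_on_eq_continuous_at\<close>)
  moreover have "einterval (-\<infinity>) (ereal a) = {..<a}" by (auto simp: einterval_def)
  ultimately show ?thesis using set_integrable_lessThan_iff borel_measurable_continuous_onI[OF h] by simp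
qed

lemma antiderivative_bounded_below:
  fixes F h :: "real \<Rightarrow> real"
  assumes F: "\<And>x. (F has_real_derivative h x) (at x)" and h: "continuous_on UNIV h"
    and nonneg: "\<And>x. x \<le> a \<Longrightarrow> 0 \<le> h x" and int: "set_integrable lborel {..a} h"
  shows "\<exists>m. \<forall>x\<le>a. m \<le> F x"
proof (intro exI allI impI)
  fix x assume x: "x \<le> a"
  have i: "set_integrable lborel {x..a} h" by (rule set_integrable_subset[OF int]) auto
  have "(h has_integral F a - F x) {x..a}"
    using x by (intro fundamental_theorem_of_calculus) (auto intro: has_field_derivative_at_within F simp: has_real_derivative_iff_has_vector_derivative[symmetric])
  then have "F a - F x = (LINT t:{x..a}|lborel. h t)"
    using set_borel_integral_eq_integral(2)[OF i] by (simp add: integral_unique)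
  also have "\<dots> \<le> (LINT t:{..a}|lborel. h t)"
    unfolding set_lebesgue_integral_def
    by (rule integral_mono) (use i int nonneg in \<open>auto simp: set_integrable_def indicator_def\<close>)
  finally show "F a - (LINT t:{..a}|lborel. h t) \<le> F x" by simp
qed

lemma set_integrable_dominated:
  fixes f h :: "real \<Rightarrow> real"
  assumes "set_integrable lborel A h" "f \<in> borel_measurable borel" "A \<in> sets borel"
    and "\<And>x. x \<in> A \<Longrightarrow> \<bar>f x\<bar> \<le> h x"
  shows "set_integrable lborel A f"
  by (rule set_integrable_bound[OF assms(1)])
     (use assms in \<open>auto simp: set_borel_measurable_def intro!: AE_I2 order_trans[OF _ abs_ge_self]\<close>)

lemma set_integrable_atMost_continuous:
  fixes h :: "real \<Rightarrow> real"
  assumes h: "continuous_on UNIV h" and int: "set_integrable lborel {..a} h"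
  shows "set_integrable lborel {..b} h"
proof -
  have "set_integrable lborel {a..b} h"
    by (rule borel_integrable_atLeastAtMost') (rule continuous_on_subset[OF h], simp)
  then have "set_integrable lborel ({..a} \<union> {a..b}) h"
    using int by (intro set_integrable_Un) auto
  then show ?thesis by (rule set_integrable_subset) auto
qed

text \<open>With a cubic weight \<open>P\<close>, \<open>(P f' - P' f)' = P f'' - P'' f\<close>; hence both \<open>f x\<close> and \<open>f' x\<close> are
  controlled by the local size of \<open>f\<close> and \<open>f''\<close>.\<close>

lemma local_bound:
  fixes f f1 f2 P P1 P2 G :: "real \<Rightarrow> real"
  assumes f: "\<And>x. (f has_real_derivative f1 x) (at x)" "\<And>x. (f1 has_real_derivative f2 x) (at x)"
    and P: "\<And>x. (P has_real_derivative P1 x) (at x)" "\<And>x. (P1 has_real_derivative P2 x) (at x)" "P 0 = 0" "P1 0 = 0"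
    and Pb: "\<And>x. 0 \<le> x \<Longrightarrow> x \<le> 1 \<Longrightarrow> \<bar>P x\<bar> \<le> 6 \<and> \<bar>P2 x\<bar> \<le> 6"
    and G: "\<And>x. (G has_real_derivative (f x)\<^sup>2 + (f2 x)\<^sup>2) (at x)" and e: "e > 0"
  shows "\<bar>P 1 * f1 x - P1 1 * f x\<bar> \<le> 6 * e + (3 / e) * (G x - G (x - 1))"
proof -
  \<comment> \<open>Young's inequality with a free weight \<open>e\<close>: the constant part can be
    made small first, and the quadratic part is then small far to the left.\<close>
  have amgm: "6 * \<bar>v\<bar> \<le> 3 * e + (3 / e) * v\<^sup>2" for v :: real
  proof -
    have "0 \<le> (\<bar>v\<bar> - e)\<^sup>2" by simp
    then have "2 * e * \<bar>v\<bar> \<le> e\<^sup>2 + v\<^sup>2" by (simp add: power2_diff mult.commute add.commute mult.left_commute)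
    then show ?thesis using e by (simp add: field_simps power2_eq_square)
  qed
  let ?h = "\<lambda>t. P (t - (x - 1)) * f1 t - P1 (t - (x - 1)) * f t"
  let ?g = "\<lambda>t. 6 * e * t + (3 / e) * G t"
  have shift: "((\<lambda>t. P (t - (x - 1))) has_real_derivative P1 (t - (x - 1))) (at t)"
    "((\<lambda>t. P1 (t - (x - 1))) has_real_derivative P2 (t - (x - 1))) (at t)" for t
    using DERIV_shift[of P "P1 (t - (x - 1))" t "- (x - 1)"] DERIV_shift[of P1 "P2 (t - (x - 1))" t "- (x - 1)"] P(1,2)
    by (simp_all add: algebra_simps)
  have "\<bar>?h x - ?h (x - 1)\<bar> \<le> ?g x - ?g (x - 1)"
  proof (rule abs_deriv_le_imp)
    fix t assume t: "x - 1 \<le> t" "t \<le> x"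
    show "(?h has_real_derivative P (t - (x - 1)) * f2 t - P2 (t - (x - 1)) * f t) (at t)"
      by (rule derivative_eq_intros shift f refl)+ (simp add: algebra_simps)
    show "(?g has_real_derivative 6 * e + (3 / e) * ((f t)\<^sup>2 + (f2 t)\<^sup>2)) (at t)"
      by (rule derivative_eq_intros G refl)+ simp
    have "\<bar>P (t - (x - 1)) * f2 t\<bar> \<le> 6 * \<bar>f2 t\<bar>" "\<bar>P2 (t - (x - 1)) * f t\<bar> \<le> 6 * \<bar>f t\<bar>"
      unfolding abs_mult using Pb[of "t - (x - 1)"] t by (auto intro!: mult_right_mono)
    then have "\<bar>P (t - (x - 1)) * f2 t - P2 (t - (x - 1)) * f t\<bar> \<le> 6 * \<bar>f2 t\<bar> + 6 * \<bar>f t\<bar>" by linarith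
    also have "\<dots> \<le> 6 * e + (3 / e) * ((f t)\<^sup>2 + (f2 t)\<^sup>2)"
      using amgm[of "f2 t"] amgm[of "f t"] by (simp add: distrib_left)
    finally show "\<bar>P (t - (x - 1)) * f2 t - P2 (t - (x - 1)) * f t\<bar> \<le> 6 * e + (3 / e) * ((f t)\<^sup>2 + (f2 t)\<^sup>2)" .
  qed simp
  then show ?thesis using P(3,4) by (simp add: algebra_simps)
qed

lemma filterlim_shift_at_bot: "filterlim (\<lambda>x::real. x + \<tau>) at_bot at_bot"
  unfolding filterlim_at_bot
proof
  fix Z :: real
  show "eventually (\<lambda>x. x + \<tau> \<le> Z) at_bot" using eventually_le_at_bot[of "Z - \<tau>"] by eventually_elim simp
qed

text \<open>A primitive \<open>G\<close> of \<open>f\<^sup>2 + f2\<^sup>2\<close> converges at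
  -infinity, so its increments over unit intervals tend to 0, and by \<open>local_bound\<close> they
  control \<open>f\<close> and \<open>f1\<close>. Integrability of \<open>f1\<^sup>2\<close> follows
  by partial integration, with \<open>f * f1\<close> as the boundary term.\<close>

lemma decay_from_square_integrable:
  fixes f f1 f2 :: "real \<Rightarrow> real"
  assumes f: "\<And>x. (f has_real_derivative f1 x) (at x)" "\<And>x. (f1 has_real_derivative f2 x) (at x)"
    and f2: "continuous_on UNIV f2"
    and int: "set_integrable lborel {..a} (\<lambda>x. (f x)\<^sup>2)" "set_integrable lborel {..a} (\<lambda>x. (f2 x)\<^sup>2)"
  shows "(f \<longlongrightarrow> 0) at_bot" "(f1 \<longlongrightarrow> 0) at_bot" "set_integrable lborel {..a} (\<lambda>x. (f1 x)\<^sup>2)"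
proof -
  have cf: "continuous_on UNIV f" "continuous_on UNIV f1"
    using DERIV_isCont[OF f(1)] DERIV_isCont[OF f(2)] by (auto intro!: continuous_at_imp_continuous_on)
  let ?g = "\<lambda>x. (f x)\<^sup>2 + (f2 x)\<^sup>2"
  have cg: "continuous_on UNIV ?g" by (intro continuous_intros cf f2)
  obtain G where G: "\<And>x. (G has_real_derivative ?g x) (at x)"
    using antiderivative_exists[OF cg] by metis
  have ig: "set_integrable lborel {..a} ?g" using int by (rule set_integral_add)
  obtain m where m: "\<And>x. x \<le> a \<Longrightarrow> m \<le> G x"
    using antiderivative_bounded_below[OF G cg _ ig] by auto
  have Gmono: "G x \<le> G y" if "x \<le> y" for x y
    by (rule DERIV_nonneg_imp_nondecreasing[OF that]) (use G in force)
  obtain A where A: "(G \<longlongrightarrow> A) at_bot"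
    using mono_bounded_below_tendsto_at_bot[of a G m] Gmono m by blast
  have "filterlim (\<lambda>x::real. x + - 1) at_bot at_bot" by (rule filterlim_shift_at_bot)
  then have "filterlim (\<lambda>x::real. x - 1) at_bot at_bot" by simp
  then have A1: "((\<lambda>x. G (x - 1)) \<longlongrightarrow> A) at_bot" using A filterlim_compose by blast
  have D: "((\<lambda>x. G x - G (x - 1)) \<longlongrightarrow> 0) at_bot" using tendsto_diff[OF A A1] by simp
  have lim: "(g \<longlongrightarrow> 0) at_bot" if g: "\<And>x e. e > 0 \<Longrightarrow> \<bar>g x\<bar> \<le> 6 * e + (3 / e) * (G x - G (x - 1))" for g :: "real \<Rightarrow> real"
  proof (rule tendstoI)
    fix r :: real assume r: "r > 0"
    \<comment> \<open>An increment of \<open>G\<close> below \<open>e * e\<close> yields the total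
      \<open>6 * e + 3 * e\<close>, which is \<open>r / 2\<close>.\<close>
    define e where "e = r / 18"
    have e: "e > 0" using r by (simp add: e_def)
    have "e * e > 0" using e by simp
    from tendstoD[OF D this] show "eventually (\<lambda>x. dist (g x) 0 < r) at_bot"
    proof eventually_elim
      case (elim x)
      then have "G x - G (x - 1) < e * e" by (simp add: dist_real_def)
      then have "(3 / e) * (G x - G (x - 1)) < (3 / e) * (e * e)" using e by (intro mult_strict_left_mono) auto
      also have "\<dots> = 3 * e" using e by simp
      finally have "\<bar>g x\<bar> < 9 * e" using g[OF e, of x] by linarith
      then show ?case using r by (simp add: e_def dist_real_def)
    qed
  qed
  show f0: "(f \<longlongrightarrow> 0) at_bot"
  proof (rule lim)
    fix x e :: real assume e: "e > 0"
    \<comment> \<open>This cubic has value 0 and slope 1 at 1, so only \<open>f x\<close> survives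
      on the left; at 0 it vanishes to second order.\<close>
    have "\<bar>(\<lambda>s. s^3 - s^2) 1 * f1 x - (\<lambda>s. 3 * s^2 - 2 * s) 1 * f x\<bar> \<le> 6 * e + (3 / e) * (G x - G (x - 1))"
    proof (rule local_bound[OF f _ _ _ _ _ G e])
      show "((\<lambda>s. s^3 - s^2) has_real_derivative 3 * t^2 - 2 * t) (at t)" for t :: real
        by (auto intro!: derivative_eq_intros simp: power2_eq_square)
      show "((\<lambda>s. 3 * s^2 - 2 * s) has_real_derivative 6 * t - 2) (at t)" for t :: real
        by (auto intro!: derivative_eq_intros)
      show "\<bar>t ^ 3 - t\<^sup>2\<bar> \<le> 6 \<and> \<bar>6 * t - 2\<bar> \<le> 6" if t: "0 \<le> t" "t \<le> 1" for t :: real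
        using t power_le_one[of t 3] power_le_one[of t 2] zero_le_power[of t 3] zero_le_power[of t 2] by linarith
    qed auto
    then show "\<bar>f x\<bar> \<le> 6 * e + (3 / e) * (G x - G (x - 1))" by simp
  qed
  show f10: "(f1 \<longlongrightarrow> 0) at_bot"
  proof (rule lim)
    fix x e :: real assume e: "e > 0"
    \<comment> \<open>Here the value at 1 is 1 and the slope is 0, which isolates
      \<open>f1 x\<close>.\<close>
    have "\<bar>(\<lambda>s. 3 * s^2 - 2 * s^3) 1 * f1 x - (\<lambda>s. 6 * s - 6 * s^2) 1 * f x\<bar> \<le> 6 * e + (3 / e) * (G x - G (x - 1))"
    proof (rule local_bound[OF f _ _ _ _ _ G e])
      show "((\<lambda>s. 3 * s^2 - 2 * s^3) has_real_derivative 6 * t - 6 * t^2) (at t)" for t :: real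
        by (auto intro!: derivative_eq_intros simp: power2_eq_square)
      show "((\<lambda>s. 6 * s - 6 * s^2) has_real_derivative 6 - 12 * t) (at t)" for t :: real
        by (auto intro!: derivative_eq_intros)
      show "\<bar>3 * t\<^sup>2 - 2 * t ^ 3\<bar> \<le> 6 \<and> \<bar>6 - 12 * t\<bar> \<le> 6" if t: "0 \<le> t" "t \<le> 1" for t :: real
        using t power_le_one[of t 3] power_le_one[of t 2] zero_le_power[of t 3] zero_le_power[of t 2] by linarith
    qed auto
    then show "\<bar>f1 x\<bar> \<le> 6 * e + (3 / e) * (G x - G (x - 1))" by simp
  qed
  have c1: "continuous_on UNIV (\<lambda>x. (f1 x)\<^sup>2)" by (intro continuous_intros cf)
  obtain F where F: "\<And>x. (F has_real_derivative (f1 x)\<^sup>2) (at x)"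
    using antiderivative_exists[OF c1] by metis
  have "((\<lambda>x. f x * f1 x) \<longlongrightarrow> 0) at_bot" using tendsto_mult[OF f0 f10] by simp
  then have "eventually (\<lambda>x. f x * f1 x > -1) at_bot" by (rule order_tendstoD) simp
  then obtain b where b: "\<And>x. x \<le> b \<Longrightarrow> f x * f1 x > -1" by (auto simp: eventually_at_bot_linorder)
  define d where "d = min a b"
  \<comment> \<open>The lower bound for \<open>F\<close> obtained by integrating
    \<open>(F - f * f1)' = - f * f2\<close>, with \<open>f * f1 > -1\<close> and
    \<open>m \<le> G\<close> inserted at the left end.\<close>
  define L where "L = F d - f d * f1 d - G d / 2 - 1 + m / 2"
  have "set_integrable lborel {..d} (\<lambda>x. (f1 x)\<^sup>2)"
  proof (rule set_integrable_from_antiderivative[OF F c1])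
    fix x assume x: "x \<le> d"
    have "(\<lambda>x. F x - f x * f1 x) d - (\<lambda>x. F x - f x * f1 x) x \<le> (\<lambda>x. G x / 2) d - (\<lambda>x. G x / 2) x"
    proof (rule deriv_le_imp_diff_le[OF x])
      fix t
      show "((\<lambda>x. F x - f x * f1 x) has_real_derivative - (f t * f2 t)) (at t)"
        by (rule derivative_eq_intros F f refl)+ (simp add: power2_eq_square)
      show "((\<lambda>x. G x / 2) has_real_derivative ?g t / 2) (at t)"
        by (rule DERIV_cdivide[OF G])
      show "- (f t * f2 t) \<le> ?g t / 2"
        using sum_squares_bound[of "f t" "- f2 t"] by simp
    qed
    moreover have "m \<le> G x" "f x * f1 x > -1" using m b x by (auto simp: d_def)
    ultimately show "L \<le> F x" unfolding L_def by linarith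
  qed simp
  then show "set_integrable lborel {..a} (\<lambda>x. (f1 x)\<^sup>2)" by (rule set_integrable_atMost_continuous[OF c1])
qed

section \<open>Characterization and existence of decaying solutions\<close>

definition decays :: "(nat \<Rightarrow> real \<Rightarrow> real) \<Rightarrow> bool" where
  "decays y \<longleftrightarrow> (\<forall>k<4. (y k \<longlongrightarrow> 0) at_bot)"

lemma decays_lincomb: "decays y \<Longrightarrow> decays z \<Longrightarrow> decays (\<lambda>k x. a * y k x + b * z k x)"
  unfolding decays_def by (auto intro!: tendsto_eq_intros)

locale left_positive_potential = bounded_potential +
  fixes a \<delta> :: real
  assumes \<delta>: "\<delta> > 0" and pos: "x \<le> a \<Longrightarrow> \<delta> \<le> c x"
begin

text \<open>Square integrability of u and u'' suffices: it passes to w = u'' + u and, through the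
  equation w'' = -w - c u with bounded c, to w''. The decay lemma then applies to u and to
  w.\<close>

lemma sol_decays_if_square_integrable:
  assumes s: "sol c y" and int: "set_integrable lborel {..b} (\<lambda>x. (y 0 x)\<^sup>2)" "set_integrable lborel {..b} (\<lambda>x. (y 2 x - y 0 x)\<^sup>2)"
  shows "decays y" "k < 4 \<Longrightarrow> set_integrable lborel {..r} (\<lambda>x. (y k x)\<^sup>2)"
proof -
  have cy: "continuous_on UNIV (y k)" if "k < 4" for k by (rule sol_continuous_on[OF s that])
  have i2: "set_integrable lborel {..b} (\<lambda>x. (y 2 x)\<^sup>2)"
  proof (rule set_integrable_dominated)
    show "set_integrable lborel {..b} (\<lambda>x. 2 * (y 2 x - y 0 x)\<^sup>2 + 2 * (y 0 x)\<^sup>2)"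
      using int by (intro set_integral_add set_integrable_mult_right) auto
    show "(\<lambda>x. (y 2 x)\<^sup>2) \<in> borel_measurable borel" by (intro borel_measurable_continuous_onI continuous_intros cy) auto
    show "\<bar>(y 2 x)\<^sup>2\<bar> \<le> 2 * (y 2 x - y 0 x)\<^sup>2 + 2 * (y 0 x)\<^sup>2" for x
      using zero_le_power2[of "y 2 x - 2 * y 0 x"] by (simp add: power2_eq_square algebra_simps)
  qed auto
  have i4: "set_integrable lborel {..b} (\<lambda>x. (- y 2 x - c x * y 0 x)\<^sup>2)"
  proof (rule set_integrable_dominated)
    show "set_integrable lborel {..b} (\<lambda>x. 2 * (y 2 x)\<^sup>2 + 2 * M\<^sup>2 * (y 0 x)\<^sup>2)"
      using int i2 by (intro set_integral_add set_integrable_mult_right) auto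
    show "(\<lambda>x. (- y 2 x - c x * y 0 x)\<^sup>2) \<in> borel_measurable borel"
      by (intro borel_measurable_continuous_onI continuous_intros cy cont) auto
    fix x
    have "(- y 2 x - c x * y 0 x)\<^sup>2 \<le> 2 * (y 2 x)\<^sup>2 + 2 * (c x)\<^sup>2 * (y 0 x)\<^sup>2"
      using zero_le_power2[of "y 2 x - c x * y 0 x"] by (simp add: power2_eq_square algebra_simps)
    also have "(c x)\<^sup>2 \<le> M\<^sup>2" using bd[of x] by (rule power2_le_iff_abs_le[THEN iffD2, OF M_nonneg])
    then have "2 * (c x)\<^sup>2 * (y 0 x)\<^sup>2 \<le> 2 * M\<^sup>2 * (y 0 x)\<^sup>2" by (intro mult_right_mono) auto
    finally show "\<bar>(- y 2 x - c x * y 0 x)\<^sup>2\<bar> \<le> 2 * (y 2 x)\<^sup>2 + 2 * M\<^sup>2 * (y 0 x)\<^sup>2" by simp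
  qed auto
  have c2: "continuous_on UNIV (\<lambda>x. y 2 x - y 0 x)" "continuous_on UNIV (\<lambda>x. - y 2 x - c x * y 0 x)"
    by (intro continuous_intros cy cont; simp)+
  note D0 = decay_from_square_integrable[OF solD(1,2)[OF s] c2(1) int]
  note D2 = decay_from_square_integrable[OF solD(3,4)[OF s] c2(2) i2 i4]
  show "decays y" unfolding decays_def all_less_4 using D0 D2 by simp
  have "\<forall>k<4. set_integrable lborel {..b} (\<lambda>x. (y k x)\<^sup>2)"
    unfolding all_less_4 using D0 D2 int i2 by simp
  then show "set_integrable lborel {..r} (\<lambda>x. (y k x)\<^sup>2)" if "k < 4"
    using that set_integrable_atMost_continuous[OF continuous_on_power[OF cy[OF that]]] by blast
qed

lemma wronsk_mono:
  assumes "sol c y" "x \<le> t" "t \<le> a"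
  shows "wronsk y x \<le> wronsk y t"
proof (rule DERIV_nonneg_imp_nondecreasing[OF assms(2)])
  fix r assume r: "x \<le> r" "r \<le> t"
  have "0 \<le> c r" using pos[of r] \<delta> r assms(3) by simp
  then show "\<exists>d. (wronsk y has_real_derivative d) (at r) \<and> 0 \<le> d" using wronsk_deriv[OF assms(1), of r] by (intro exI[of _ "(y 2 r)\<^sup>2 + c r * (y 0 r)\<^sup>2"]) auto
qed

text \<open>A lower bound on \<open>wronsk\<close> makes its derivative w^2 + c u^2 integrable near
  -infinity, and c is at least \<open>\<delta>\<close> there.\<close>

lemma decays_if_wronsk_nonneg:
  assumes s: "sol c y" and w: "\<And>x. x \<le> a \<Longrightarrow> 0 \<le> wronsk y x"
  shows "decays y" "k < 4 \<Longrightarrow> set_integrable lborel {..r} (\<lambda>x. (y k x)\<^sup>2)"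
proof -
  have cy: "continuous_on UNIV (y k)" if "k < 4" for k by (rule sol_continuous_on[OF s that])
  let ?h = "\<lambda>x. (y 2 x)\<^sup>2 + c x * (y 0 x)\<^sup>2"
  have h: "set_integrable lborel {..a} ?h"
  proof (rule set_integrable_from_antiderivative[OF wronsk_deriv[OF s] _ _ w])
    show "continuous_on UNIV ?h" by (intro continuous_intros cy cont) auto
    show "0 \<le> ?h x" if "x \<le> a" for x using pos[OF that] \<delta> by simp
  qed
  have i0: "set_integrable lborel {..a} (\<lambda>x. (y 0 x)\<^sup>2)"
  proof (rule set_integrable_dominated)
    show "set_integrable lborel {..a} (\<lambda>x. (1 / \<delta>) * ?h x)" using h by (intro set_integrable_mult_right)
    show "(\<lambda>x. (y 0 x)\<^sup>2) \<in> borel_measurable borel" by (intro borel_measurable_continuous_onI continuous_intros cy) auto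
    fix x assume "x \<in> {..a}"
    then have "\<delta> * (y 0 x)\<^sup>2 \<le> c x * (y 0 x)\<^sup>2" using pos by (intro mult_right_mono) auto
    then have "\<delta> * (y 0 x)\<^sup>2 \<le> ?h x" using zero_le_power2[of "y 2 x"] by linarith
    then show "\<bar>(y 0 x)\<^sup>2\<bar> \<le> (1 / \<delta>) * ?h x" using \<delta> by (simp add: field_simps)
  qed auto
  have i2: "set_integrable lborel {..a} (\<lambda>x. (y 2 x - y 0 x)\<^sup>2)"
  proof (rule set_integrable_dominated)
    show "set_integrable lborel {..a} (\<lambda>x. 2 * ?h x + 2 * (y 0 x)\<^sup>2)"
      by (rule set_integral_add(1); rule set_integrable_mult_right; rule h i0)
    show "(\<lambda>x. (y 2 x - y 0 x)\<^sup>2) \<in> borel_measurable borel" by (intro borel_measurable_continuous_onI continuous_intros cy) auto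
    fix x assume "x \<in> {..a}"
    then have "0 \<le> c x" using pos[of x] \<delta> by simp
    then have "0 \<le> c x * (y 0 x)\<^sup>2" by simp
    moreover have "(y 2 x - y 0 x)\<^sup>2 \<le> 2 * (y 2 x)\<^sup>2 + 2 * (y 0 x)\<^sup>2"
      using zero_le_power2[of "y 2 x + y 0 x"] by (simp add: power2_eq_square algebra_simps)
    ultimately show "\<bar>(y 2 x - y 0 x)\<^sup>2\<bar> \<le> 2 * ?h x + 2 * (y 0 x)\<^sup>2"
      unfolding abs_of_nonneg[OF zero_le_power2] by (simp add: distrib_left)
  qed auto
  show "decays y" "k < 4 \<Longrightarrow> set_integrable lborel {..r} (\<lambda>x. (y k x)\<^sup>2)"
    using sol_decays_if_square_integrable[OF s i0 i2] by auto
qed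

text \<open>Converse of the preceding criterion: \<open>wronsk\<close> increases from its limit 0 at
  -infinity.\<close>

lemma wronsk_nonneg_if_decays:
  assumes s: "sol c y" and d: "decays y" and x: "x \<le> a"
  shows "0 \<le> wronsk y x"
proof -
  have "(wronsk y \<longlongrightarrow> 0 * 0 - 0 * 0) at_bot"
    unfolding wronsk_def[abs_def] using d unfolding decays_def all_less_4 by (intro tendsto_intros) auto
  moreover have "eventually (\<lambda>t. wronsk y t \<le> wronsk y x) at_bot"
    using eventually_le_at_bot[of x] by eventually_elim (rule wronsk_mono[OF s _ x])
  ultimately show ?thesis using tendsto_le[of at_bot "\<lambda>_. wronsk y x" "wronsk y x" "wronsk y" 0] by simp
qed

text \<open>Clamping at \<open>t\<close> gives \<open>wronsk y t = 0\<close>; being nonnegative and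
  monotone, \<open>wronsk\<close> vanishes to the left of \<open>t\<close>, and so does its
  derivative, which controls u. Hence value and slope at \<open>t\<close> determine a decaying
  solution.\<close>

lemma decaying_zero:
  assumes s: "sol c y" and w: "\<And>x. x \<le> a \<Longrightarrow> 0 \<le> wronsk y x" and z: "y 0 t = 0" "y 1 t = 0" "t \<le> a" and k: "k < 4"
  shows "y k x = 0"
proof -
  have w0: "wronsk y r = 0" if "r \<le> t" for r
    using wronsk_mono[OF s that z(3)] w[of r] that z by (simp add: wronsk_def)
  have energy: "(y 2 r)\<^sup>2 + c r * (y 0 r)\<^sup>2 = 0" if r: "r < t" for r
  proof -
    have "eventually (\<lambda>x. x \<in> {..<t}) (nhds r)" using r by (intro eventually_nhds_in_open) auto
    then have "eventually (\<lambda>x. wronsk y x = 0) (nhds r)" by eventually_elim (use w0 in auto)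
    then have "((\<lambda>_. 0) has_real_derivative (y 2 r)\<^sup>2 + c r * (y 0 r)\<^sup>2) (at r)"
      using DERIV_cong_ev[of r r "wronsk y" "\<lambda>_. 0"] wronsk_deriv[OF s, of r] by auto
    then show ?thesis using DERIV_unique[OF _ DERIV_const] by blast
  qed
  have sm: "y 0 r = 0" if r: "r < t" for r
  proof -
    have e: "(y 2 r)\<^sup>2 + c r * (y 0 r)\<^sup>2 = 0" by (rule energy[OF r])
    have cr: "c r > 0" using pos[of r] \<delta> r z(3) by simp
    then have "0 \<le> c r * (y 0 r)\<^sup>2" by simp
    then have "c r * (y 0 r)\<^sup>2 = 0" using e zero_le_power2[of "y 2 r"] by linarith+
    then show ?thesis using cr by simp
  qed
  show ?thesis by (rule sol_zero_on_interval[OF s, of "t - 1" t]) (use sm k in auto)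
qed

text \<open>The solutions clamped at \<open>-n\<close> form a plane on which \<open>wronsk \<ge> 0\<close> on \<open>[-n, t]\<close>;
  a limit of these planes, in the space of data at \<open>t\<close>, consists of decaying solutions.\<close>

lemma decaying_sol_exists:
  assumes t: "t \<le> a"
  obtains y where "sol c y" "y 0 t = A" "y 1 t = B" "decays y"
proof -
  obtain Y where Ysol: "\<And>\<xi>. sol c (Y \<xi>)"
    and Yt: "\<And>p q r s. Y (p, q, r, s) 0 t = p" "\<And>p q r s. Y (p, q, r, s) 1 t = q"
    "\<And>p q r s. Y (p, q, r, s) 2 t = r" "\<And>p q r s. Y (p, q, r, s) 3 t = s"
    and Ylin: "\<And>\<alpha> \<xi> \<beta> \<eta> k x. Y (\<alpha> *\<^sub>R \<xi> + \<beta> *\<^sub>R \<eta>) k x = \<alpha> * Y \<xi> k x + \<beta> * Y \<eta> k x"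
    and Yrep: "\<And>y k x. sol c y \<Longrightarrow> k < 4 \<Longrightarrow> y k x = Y (y 0 t, y 1 t, y 2 t, y 3 t) k x"
    and cY: "\<And>g \<xi> k x. g \<longlonglongrightarrow> \<xi> \<Longrightarrow> (\<lambda>n. Y (g n) k x) \<longlonglongrightarrow> Y \<xi> k x"
    by (rule sol_parametrization[of t]) blast
  have Y0: "Y 0 k x = 0" for k x using Ylin[of 0 0 0 0 k x] by simp
  \<comment> \<open>The two solutions with value and slope 0 at \<open>x\<close> are encoded by
    their data at \<open>t\<close> and orthonormalized there. Orthonormality survives limits, so the
    limiting plane remains two-dimensional.\<close>
  have clamped: "\<exists>e f. norm e = 1 \<and> norm f = 1 \<and> e \<bullet> f = 0 \<and> Y e 0 x = 0 \<and> Y e 1 x = 0 \<and> Y f 0 x = 0 \<and> Y f 1 x = 0" for x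
  proof -
    obtain y where y: "sol c y" "\<And>k. k < 4 \<Longrightarrow> y k x = (if k = 2 then 1 else 0)"
      using sol_exists[of x "\<lambda>k. if k = 2 then 1 else 0"] by blast
    obtain z where z: "sol c z" "\<And>k. k < 4 \<Longrightarrow> z k x = (if k = 3 then 1 else 0)"
      using sol_exists[of x "\<lambda>k. if k = 3 then 1 else 0"] by blast
    define p where "p = (y 0 t, y 1 t, y 2 t, y 3 t)"
    define q where "q = (z 0 t, z 1 t, z 2 t, z 3 t)"
    have py: "Y p k x = y k x" and qz: "Y q k x = z k x" if "k < 4" for k
      using Yrep[OF y(1) that] Yrep[OF z(1) that] by (auto simp: p_def q_def)
    have p0: "p \<noteq> 0" using py[of 2] y(2)[of 2] Y0 by auto
    define e where "e = p /\<^sub>R norm p"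
    define q' where "q' = q - (q \<bullet> e) *\<^sub>R e"
    have ne: "norm e = 1" using p0 by (simp add: e_def)
    have Ye: "Y e k x = y k x / norm p" if "k < 4" for k
      using Ylin[of "1 / norm p" p 0 0 k x] py[OF that] by (simp add: e_def divide_inverse)
    have Yq': "Y q' k x = z k x - (q \<bullet> e) * (y k x / norm p)" if "k < 4" for k
      using Ylin[of 1 q "- (q \<bullet> e)" e k x] qz[OF that] Ye[OF that] by (simp add: q'_def)
    have "q' \<noteq> 0" using Yq'[of 3] z(2)[of 3] y(2)[of 3] Y0[of 3 x] by auto
    define f where "f = q' /\<^sub>R norm q'"
    have nf: "norm f = 1" using \<open>q' \<noteq> 0\<close> by (simp add: f_def)
    have "e \<bullet> q' = 0" using ne by (simp add: q'_def inner_diff_right inner_commute dot_square_norm)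
    then have "e \<bullet> f = 0" by (simp add: f_def)
    moreover have "Y f k x = Y q' k x / norm q'" for k
      using Ylin[of "1 / norm q'" q' 0 0 k x] by (simp add: f_def divide_inverse)
    ultimately show ?thesis using ne nf Ye Yq' y(2) z(2) by (intro exI[of _ e] exI[of _ f]) simp
  qed
  then obtain e f where ef: "\<And>n. norm (e n) = 1" "\<And>n. norm (f n) = 1" "\<And>n. e n \<bullet> f n = 0"
    "\<And>n. Y (e n) 0 (- real n) = 0 \<and> Y (e n) 1 (- real n) = 0 \<and> Y (f n) 0 (- real n) = 0 \<and> Y (f n) 1 (- real n) = 0"
    using clamped[of "- real n" for n] by metis
  let ?S = "sphere (0 :: real \<times> real \<times> real \<times> real) 1 \<times> sphere (0 :: real \<times> real \<times> real \<times> real) 1"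
  have "compact ?S" by (intro compact_Times compact_sphere)
  moreover have "\<forall>n. (e n, f n) \<in> ?S" using ef by (simp add: dist_norm)
  ultimately obtain l \<rho> where l: "strict_mono \<rho>" "((\<lambda>n. (e n, f n)) \<circ> \<rho>) \<longlonglongrightarrow> l"
    unfolding compact_def by (metis (mono_tags, lifting))
  define E where "E = fst l"
  define F where "F = snd l"
  have lim: "(\<lambda>n. e (\<rho> n)) \<longlonglongrightarrow> E" "(\<lambda>n. f (\<rho> n)) \<longlonglongrightarrow> F"
    using tendsto_fst[OF l(2)] tendsto_snd[OF l(2)] by (simp_all add: E_def F_def comp_def)
  have nE: "norm E = 1" using tendsto_norm[OF lim(1)] ef(1) LIMSEQ_unique[OF _ tendsto_const] by simp
  have nF: "norm F = 1" using tendsto_norm[OF lim(2)] ef(2) LIMSEQ_unique[OF _ tendsto_const] by simp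
  have EF: "E \<bullet> F = 0" using tendsto_inner[OF lim] ef(3) LIMSEQ_unique[OF _ tendsto_const] by simp
  \<comment> \<open>For large \<open>n\<close> the clamping point lies left of \<open>x\<close>,
    where \<open>wronsk\<close> starts from 0 and increases; the inequality passes to the
    limit.\<close>
  have w: "0 \<le> wronsk (Y (\<alpha> *\<^sub>R E + \<beta> *\<^sub>R F)) x" if x: "x \<le> a" for x \<alpha> \<beta>
  proof -
    define g where "g n = \<alpha> *\<^sub>R e (\<rho> n) + \<beta> *\<^sub>R f (\<rho> n)" for n
    have g: "g \<longlonglongrightarrow> \<alpha> *\<^sub>R E + \<beta> *\<^sub>R F" unfolding g_def by (intro tendsto_intros lim)
    have "(\<lambda>n. wronsk (Y (g n)) x) \<longlonglongrightarrow> wronsk (Y (\<alpha> *\<^sub>R E + \<beta> *\<^sub>R F)) x"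
      unfolding wronsk_def by (intro tendsto_intros cY g)
    moreover have "eventually (\<lambda>n. 0 \<le> wronsk (Y (g n)) x) sequentially"
    proof -
      obtain N where N: "- x \<le> real N" using real_arch_simple by blast
      show ?thesis
      proof (rule eventually_sequentiallyI[of N])
        fix n assume "N \<le> n"
        then have "real N \<le> real (\<rho> n)" using seq_suble[OF l(1), of n] by simp
        then have "- real (\<rho> n) \<le> x" using N by linarith
        from wronsk_mono[OF Ysol this x, of "g n"]
        have "wronsk (Y (g n)) (- real (\<rho> n)) \<le> wronsk (Y (g n)) x" .
        moreover have "wronsk (Y (g n)) (- real (\<rho> n)) = 0"
          unfolding wronsk_def g_def Ylin using ef(4)[of "\<rho> n"] by simp
        ultimately show "0 \<le> wronsk (Y (g n)) x" by simp
      qed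
    qed
    ultimately show ?thesis by (rule tendsto_lowerbound) simp
  qed
  have inj: "\<alpha> = 0 \<and> \<beta> = 0" if z: "Y (\<alpha> *\<^sub>R E + \<beta> *\<^sub>R F) 0 t = 0" "Y (\<alpha> *\<^sub>R E + \<beta> *\<^sub>R F) 1 t = 0" for \<alpha> \<beta>
  proof -
    let ?v = "\<alpha> *\<^sub>R E + \<beta> *\<^sub>R F"
    have "\<forall>k<4. Y ?v k t = 0" using decaying_zero[OF Ysol w z t] by blast
    moreover obtain p q r s where v: "?v = (p, q, r, s)" by (cases ?v) auto
    ultimately have "p = 0" "q = 0" "r = 0" "s = 0" unfolding all_less_4 v Yt by auto
    then have "?v = 0" using v by (simp add: zero_prod_def)
    then have "?v \<bullet> E = 0" "?v \<bullet> F = 0" by simp_all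
    moreover have "E \<bullet> E = 1" "F \<bullet> F = 1" "F \<bullet> E = 0"
      using nE nF EF by (simp_all add: dot_square_norm inner_commute)
    then have "?v \<bullet> E = \<alpha>" "?v \<bullet> F = \<beta>" using EF by (simp_all add: inner_add_left)
    ultimately show ?thesis by linarith
  qed
  define e0 e1 f0 f1 where "e0 = Y E 0 t" and "e1 = Y E 1 t" and "f0 = Y F 0 t" and "f1 = Y F 1 t"
  have jets: "Y (\<alpha> *\<^sub>R E + \<beta> *\<^sub>R F) 0 t = \<alpha> * e0 + \<beta> * f0" "Y (\<alpha> *\<^sub>R E + \<beta> *\<^sub>R F) 1 t = \<alpha> * e1 + \<beta> * f1" for \<alpha> \<beta>
    by (simp_all add: Ylin e0_def e1_def f0_def f1_def)
  define D where "D = e0 * f1 - e1 * f0"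
  \<comment> \<open>\<open>D\<close> is the determinant of the map from coefficients to value and
    slope at \<open>t\<close>. If it were 0, \<open>inj\<close> applied to the vectors
    \<open>(f1, - e1)\<close> and \<open>(f0, - e0)\<close> would make all four entries vanish,
    contradicting \<open>inj\<close> at \<open>(1, 0)\<close>.\<close>
  have D: "D \<noteq> 0"
  proof
    assume "D = 0"
    then have "f1 = 0 \<and> - e1 = 0" "f0 = 0 \<and> - e0 = 0"
      using inj[of f1 "- e1"] inj[of f0 "- e0"] unfolding jets by (simp_all add: D_def algebra_simps)
    then show False using inj[of 1 0] unfolding jets by simp
  qed
  \<comment> \<open>Cramer's rule for prescribed value \<open>A\<close> and slope
    \<open>B\<close>.\<close>
  define \<alpha> \<beta> where "\<alpha> = (A * f1 - B * f0) / D" and "\<beta> = (e0 * B - e1 * A) / D"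
  show ?thesis
  proof (rule that)
    show "sol c (Y (\<alpha> *\<^sub>R E + \<beta> *\<^sub>R F))" by (rule Ysol)
    show "decays (Y (\<alpha> *\<^sub>R E + \<beta> *\<^sub>R F))" by (rule decays_if_wronsk_nonneg(1)[OF Ysol w])
    show "Y (\<alpha> *\<^sub>R E + \<beta> *\<^sub>R F) 0 t = A"
    proof -
      have "(\<alpha> * e0 + \<beta> * f0) * D = A * D" using D by (simp add: \<alpha>_def \<beta>_def field_simps) (simp add: D_def algebra_simps)
      then show ?thesis using D jets by simp
    qed
    show "Y (\<alpha> *\<^sub>R E + \<beta> *\<^sub>R F) 1 t = B"
    proof -
      have "(\<alpha> * e1 + \<beta> * f1) * D = B * D" using D by (simp add: \<alpha>_def \<beta>_def field_simps) (simp add: D_def algebra_simps)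
      then show ?thesis using D jets by simp
    qed
  qed
qed

end

section \<open>The form domain\<close>

definition deriv2 :: "(real \<Rightarrow> real) \<Rightarrow> real \<Rightarrow> real" where
  "deriv2 u = deriv (deriv u)"

text \<open>Functions of class \<open>C\<^sup>1\<close>, twice differentiable off a finite set, with \<open>u''\<close> locally square integrable;
  at the exceptional points \<open>deriv2 u\<close> has an irrelevant junk value.\<close>

definition pc2 :: "(real \<Rightarrow> real) \<Rightarrow> bool" where
  "pc2 u \<longleftrightarrow> (\<forall>x. (u has_real_derivative deriv u x) (at x)) \<and> continuous_on UNIV (deriv u) \<and>
     deriv2 u \<in> borel_measurable borel \<and> (\<forall>n. set_integrable lborel {-n..n} (\<lambda>x. (deriv2 u x)\<^sup>2)) \<and>
     (\<exists>F. finite F \<and> (\<forall>x. x \<notin> F \<longrightarrow> (deriv u has_real_derivative deriv2 u x) (at x)))"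

lemma pc2D:
  assumes "pc2 u"
  shows "(u has_real_derivative deriv u x) (at x)" "continuous_on S (deriv u)" "continuous_on S u"
    "deriv2 u \<in> borel_measurable borel" "set_integrable lborel {-n..n} (\<lambda>x. (deriv2 u x)\<^sup>2)"
    "u \<in> borel_measurable borel"
proof -
  show d: "(u has_real_derivative deriv u x) (at x)" for x using assms by (auto simp: pc2_def)
  show "continuous_on S (deriv u)" using assms by (auto simp: pc2_def intro: continuous_on_subset)
  show c: "continuous_on S u" for S using DERIV_isCont[OF d] by (auto intro!: continuous_at_imp_continuous_on)
  show "deriv2 u \<in> borel_measurable borel" "set_integrable lborel {-n..n} (\<lambda>x. (deriv2 u x)\<^sup>2)"
    using assms by (auto simp: pc2_def)
  show "u \<in> borel_measurable borel" using c by (rule borel_measurable_continuous_onI)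
qed

lemma pc2_exceptional:
  assumes "pc2 u"
  obtains F where "finite F" "\<And>x. x \<notin> F \<Longrightarrow> (deriv u has_real_derivative deriv2 u x) (at x)"
  using assms unfolding pc2_def by blast

lemma AE_not_in_finite: "finite (F :: real set) \<Longrightarrow> AE x in lborel. x \<notin> F"
  by (rule AE_not_in) (simp add: finite_imp_null_set_lborel)

lemma pc2I:
  assumes v: "\<And>x. (u has_real_derivative v x) (at x)" "continuous_on UNIV v"
    and g: "finite F" "\<And>x. x \<notin> F \<Longrightarrow> (v has_real_derivative g x) (at x)" "g \<in> borel_measurable borel"
    "\<And>n. set_integrable lborel {-n..n} (\<lambda>x. (g x)\<^sup>2)"
  shows "pc2 u" "deriv u = v" "x \<notin> F \<Longrightarrow> deriv2 u x = g x" "AE x in lborel. deriv2 u x = g x"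
proof -
  show dv: "deriv u = v" using v(1) DERIV_imp_deriv by blast
  have d2: "deriv2 u x = g x" if "x \<notin> F" for x
    unfolding deriv2_def dv using g(2)[OF that] by (rule DERIV_imp_deriv)
  then show "x \<notin> F \<Longrightarrow> deriv2 u x = g x" by blast
  show ae: "AE x in lborel. deriv2 u x = g x"
    using AE_not_in_finite[OF g(1)] by eventually_elim (rule d2)
  have m: "deriv2 u \<in> borel_measurable borel"
    by (rule measurable_discrete_difference[OF g(3), of F]) (use g(1) d2 countable_finite in auto)
  moreover have "set_integrable lborel {-n..n} (\<lambda>x. (deriv2 u x)\<^sup>2)" for n
  proof -
    have "integrable lborel (\<lambda>x. indicat_real {-n..n} x *\<^sub>R (deriv2 u x)\<^sup>2) \<longleftrightarrow> integrable lborel (\<lambda>x. indicat_real {-n..n} x *\<^sub>R (g x)\<^sup>2)"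
    proof (rule integrable_cong_AE)
      show "AE x in lborel. indicat_real {-n..n} x *\<^sub>R (deriv2 u x)\<^sup>2 = indicat_real {-n..n} x *\<^sub>R (g x)\<^sup>2"
        using ae by eventually_elim simp
    qed (use m g(3) in measurable)
    then show ?thesis using g(4) by (simp add: set_integrable_def)
  qed
  ultimately show "pc2 u" unfolding pc2_def dv using v g(1,2) d2 by (auto intro!: exI[of _ F])
qed

lemma pc2_comb:
  assumes u: "pc2 u" and w: "pc2 w"
  shows "pc2 (a *\<^sub>R u + b *\<^sub>R w)" "deriv (a *\<^sub>R u + b *\<^sub>R w) x = a * deriv u x + b * deriv w x"
    "AE x in lborel. deriv2 (a *\<^sub>R u + b *\<^sub>R w) x = a * deriv2 u x + b * deriv2 w x"
proof -
  have eq: "a *\<^sub>R u + b *\<^sub>R w = (\<lambda>x. a * u x + b * w x)" by (simp add: fun_eq_iff)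
  obtain F where F: "finite F" "\<And>x. x \<notin> F \<Longrightarrow> (deriv u has_real_derivative deriv2 u x) (at x)"
    using pc2_exceptional[OF u] by blast
  obtain F' where F': "finite F'" "\<And>x. x \<notin> F' \<Longrightarrow> (deriv w has_real_derivative deriv2 w x) (at x)"
    using pc2_exceptional[OF w] by blast
  have 1: "((\<lambda>x. a * u x + b * w x) has_real_derivative a * deriv u x + b * deriv w x) (at x)" for x
    by (intro derivative_intros DERIV_cmult pc2D(1) u w)
  have 2: "continuous_on UNIV (\<lambda>x. a * deriv u x + b * deriv w x)"
    by (intro continuous_intros pc2D(2) u w)
  have 3: "finite (F \<union> F')" using F F' by simp
  have 4: "((\<lambda>x. a * deriv u x + b * deriv w x) has_real_derivative a * deriv2 u x + b * deriv2 w x) (at x)"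
    if "x \<notin> F \<union> F'" for x using that by (intro derivative_intros DERIV_cmult F F') auto
  have 5: "(\<lambda>x. a * deriv2 u x + b * deriv2 w x) \<in> borel_measurable borel"
    using pc2D(4)[OF u] pc2D(4)[OF w] by measurable
  have 6: "set_integrable lborel {-n..n} (\<lambda>x. (a * deriv2 u x + b * deriv2 w x)\<^sup>2)" for n
  proof (rule set_integrable_dominated)
    show "set_integrable lborel {-n..n} (\<lambda>x. (2 * a\<^sup>2) * (deriv2 u x)\<^sup>2 + (2 * b\<^sup>2) * (deriv2 w x)\<^sup>2)"
      using pc2D(5)[OF u, of n] pc2D(5)[OF w, of n] by (intro set_integral_add(1) set_integrable_mult_right)
    show "\<bar>(a * deriv2 u x + b * deriv2 w x)\<^sup>2\<bar> \<le> (2 * a\<^sup>2) * (deriv2 u x)\<^sup>2 + (2 * b\<^sup>2) * (deriv2 w x)\<^sup>2" for x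
      unfolding abs_of_nonneg[OF zero_le_power2]
      using zero_le_power2[of "a * deriv2 u x - b * deriv2 w x"] by (simp add: power2_eq_square algebra_simps)
  qed (use 5 in measurable)
  note P = pc2I[OF 1 2 3 4 5 6]
  show "pc2 (a *\<^sub>R u + b *\<^sub>R w)" "deriv (a *\<^sub>R u + b *\<^sub>R w) x = a * deriv u x + b * deriv w x"
    "AE x in lborel. deriv2 (a *\<^sub>R u + b *\<^sub>R w) x = a * deriv2 u x + b * deriv2 w x"
    unfolding eq using P(1) P(2) P(4) by simp_all
qed

lemma deriv_cong_open:
  assumes "open S" "x \<in> S" "\<And>t. t \<in> S \<Longrightarrow> u t = w t"
  shows "deriv u x = deriv w x" "deriv2 u x = deriv2 w x"
proof -
  have 1: "deriv u t = deriv w t" if "t \<in> S" for t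
    by (rule deriv_cong_ev) (use assms that eventually_nhds_in_open[of S t] in \<open>auto elim!: eventually_mono\<close>)
  then show "deriv u x = deriv w x" using assms by blast
  show "deriv2 u x = deriv2 w x" unfolding deriv2_def
    by (rule deriv_cong_ev) (use assms 1 eventually_nhds_in_open[of S x] in \<open>auto elim!: eventually_mono\<close>)
qed

definition glue :: "real \<Rightarrow> (real \<Rightarrow> real) \<Rightarrow> (real \<Rightarrow> real) \<Rightarrow> real \<Rightarrow> real" where
  "glue m f g x = (if x \<le> m then f x else g x)"

lemma glue_has_derivative:
  assumes f: "\<And>x. (f has_real_derivative f' x) (at x)" and g: "\<And>x. (g has_real_derivative g' x) (at x)"
    and eq: "f m = g m" "f' m = g' m"
  shows "(glue m f g has_real_derivative glue m f' g' x) (at x)"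
proof -
  have "((\<lambda>x. if x \<in> {..m} then f x else g x) has_derivative (if x \<in> {..m} then (*) (f' x) else (*) (g' x))) (at x within {..m} \<union> {m..})"
    by (rule has_derivative_If_within_closures)
       (use eq f g in \<open>auto intro: has_derivative_at_withinI simp: has_field_derivative_def\<close>)
  moreover have "{..m} \<union> {m..} = UNIV" by auto
  moreover have "(\<lambda>x. if x \<in> {..m} then f x else g x) = glue m f g" by (auto simp: glue_def)
  moreover have "(if x \<in> {..m} then (*) (f' x) else (*) (g' x)) = (*) (glue m f' g' x)" by (auto simp: glue_def)
  ultimately show ?thesis by (simp add: has_field_derivative_def)
qed

lemma glue_continuous:
  fixes f g :: "real \<Rightarrow> real"
  assumes f: "continuous_on UNIV f" and g: "continuous_on UNIV g" and eq: "f m = g m"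
  shows "continuous_on UNIV (glue m f g)"
proof -
  have "continuous_on ({..m} \<union> {m..}) (\<lambda>x. if x \<le> m then f x else g x)"
    by (rule continuous_on_cases) (use f g eq in \<open>auto intro: continuous_on_subset\<close>)
  moreover have "{..m} \<union> {m..} = UNIV" by auto
  ultimately show ?thesis by (simp add: glue_def[abs_def])
qed

text \<open>Matching value and slope keeps the function C^1; the second derivative may jump at
  \<open>m\<close>, which therefore joins the exceptional set.\<close>

lemma pc2_glue:
  assumes u: "pc2 u" and w: "pc2 w" and eq: "u m = w m" "deriv u m = deriv w m"
  shows "pc2 (glue m u w)" "deriv (glue m u w) = glue m (deriv u) (deriv w)"
proof -
  obtain F where F: "finite F" "\<And>x. x \<notin> F \<Longrightarrow> (deriv u has_real_derivative deriv2 u x) (at x)"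
    using pc2_exceptional[OF u] by blast
  obtain F' where F': "finite F'" "\<And>x. x \<notin> F' \<Longrightarrow> (deriv w has_real_derivative deriv2 w x) (at x)"
    using pc2_exceptional[OF w] by blast
  have 1: "(glue m u w has_real_derivative glue m (deriv u) (deriv w) x) (at x)" for x
    by (rule glue_has_derivative[OF pc2D(1)[OF u] pc2D(1)[OF w] eq])
  have 2: "continuous_on UNIV (glue m (deriv u) (deriv w))"
    by (rule glue_continuous[OF pc2D(2)[OF u] pc2D(2)[OF w] eq(2)])
  have 3: "finite (insert m (F \<union> F'))" using F F' by simp
  have 4: "(glue m (deriv u) (deriv w) has_real_derivative glue m (deriv2 u) (deriv2 w) x) (at x)"
    if x: "x \<notin> insert m (F \<union> F')" for x
  proof (cases "x < m")
    case True
    have "((deriv u) has_real_derivative deriv2 u x) (at x)" using F x by auto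
    then have "(glue m (deriv u) (deriv w) has_real_derivative deriv2 u x) (at x)"
      by (rule DERIV_cong_ev[THEN iffD1, rotated -1])
         (use True eventually_nhds_in_open[of "{..<m}" x] in \<open>auto simp: glue_def elim!: eventually_mono\<close>)
    then show ?thesis using True by (simp add: glue_def)
  next
    case False
    then have xm: "m < x" using x by auto
    have "((deriv w) has_real_derivative deriv2 w x) (at x)" using F' x by auto
    then have "(glue m (deriv u) (deriv w) has_real_derivative deriv2 w x) (at x)"
      by (rule DERIV_cong_ev[THEN iffD1, rotated -1])
         (use xm eventually_nhds_in_open[of "{m<..}" x] in \<open>auto simp: glue_def elim!: eventually_mono\<close>)
    then show ?thesis using xm by (simp add: glue_def)
  qed
  have 5: "glue m (deriv2 u) (deriv2 w) \<in> borel_measurable borel"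
    unfolding glue_def[abs_def] using pc2D(4)[OF u] pc2D(4)[OF w] by measurable
  have 6: "set_integrable lborel {-n..n} (\<lambda>x. (glue m (deriv2 u) (deriv2 w) x)\<^sup>2)" for n
  proof (rule set_integrable_dominated)
    show "set_integrable lborel {-n..n} (\<lambda>x. (deriv2 u x)\<^sup>2 + (deriv2 w x)\<^sup>2)"
      using pc2D(5)[OF u, of n] pc2D(5)[OF w, of n] by (intro set_integral_add(1))
    show "\<bar>(glue m (deriv2 u) (deriv2 w) x)\<^sup>2\<bar> \<le> (deriv2 u x)\<^sup>2 + (deriv2 w x)\<^sup>2" for x
      by (simp add: glue_def)
  qed (use 5 in measurable)
  note P = pc2I[OF 1 2 3 4 5 6]
  show "pc2 (glue m u w)" "deriv (glue m u w) = glue m (deriv u) (deriv w)"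
    using P(1) P(2) by simp_all
qed

lemma pc2_sol:
  assumes s: "sol c y" and c: "continuous_on UNIV c"
  shows "pc2 (y 0)" "deriv (y 0) = y 1" "deriv2 (y 0) = (\<lambda>x. y 2 x - y 0 x)"
proof -
  have cy: "continuous_on S (y k)" if "k < 4" for k S by (rule sol_continuous_on[OF s that])
  have 5: "(\<lambda>x. y 2 x - y 0 x) \<in> borel_measurable borel"
    by (intro borel_measurable_continuous_onI continuous_intros cy) auto
  have 6: "set_integrable lborel {-n..n} (\<lambda>x. (y 2 x - y 0 x)\<^sup>2)" for n
    by (intro borel_integrable_atLeastAtMost' continuous_intros cy) auto
  note P = pc2I[OF solD(1)[OF s] cy finite.emptyI solD(2)[OF s] 5 6]
  show "pc2 (y 0)" "deriv (y 0) = y 1" "deriv2 (y 0) = (\<lambda>x. y 2 x - y 0 x)"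
    using P(1) P(2) P(3) by (simp_all add: fun_eq_iff)
qed

lemma pc2_zero: "pc2 (\<lambda>x. 0)" "deriv (\<lambda>x::real. 0::real) = (\<lambda>x. 0)" "deriv2 (\<lambda>x. 0) = (\<lambda>x. 0)"
proof -
  show d: "deriv (\<lambda>x::real. 0::real) = (\<lambda>x. 0)" by simp
  show d2: "deriv2 (\<lambda>x. 0) = (\<lambda>x. 0)" by (simp add: deriv2_def)
  show "pc2 (\<lambda>x. 0)" unfolding pc2_def by (auto simp: d d2 set_integrable_def)
qed

text \<open>A form core standing in for the \<open>H\<^sup>2\<close> functions on \<open>(-\<infinity>, s]\<close> clamped at \<open>s\<close>; elements are extended by zero.\<close>

definition form_dom :: "real \<Rightarrow> (real \<Rightarrow> real) set" where
  "form_dom s = {u. pc2 u \<and> integrable lborel (\<lambda>x. (u x)\<^sup>2) \<and> integrable lborel (\<lambda>x. (deriv2 u x)\<^sup>2) \<and>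
     (u \<longlongrightarrow> 0) at_bot \<and> (deriv u \<longlongrightarrow> 0) at_bot \<and> (\<forall>x\<ge>s. u x = 0)}"

definition qform :: "(real \<Rightarrow> real) \<Rightarrow> (real \<Rightarrow> real) \<Rightarrow> (real \<Rightarrow> real) \<Rightarrow> real" where
  "qform c u v = (\<integral>x. (deriv2 u x + u x) * (deriv2 v x + v x) + c x * u x * v x \<partial>lborel)"

definition l2form :: "(real \<Rightarrow> real) \<Rightarrow> (real \<Rightarrow> real) \<Rightarrow> real" where
  "l2form u v = (\<integral>x. u x * v x \<partial>lborel)"

lemma integrable_mult_of_squares:
  fixes f g :: "real \<Rightarrow> real"
  assumes "integrable M (\<lambda>x. (f x)\<^sup>2)" "integrable M (\<lambda>x. (g x)\<^sup>2)" "f \<in> borel_measurable M" "g \<in> borel_measurable M"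
  shows "integrable M (\<lambda>x. f x * g x)"
proof (rule Bochner_Integration.integrable_bound)
  show "integrable M (\<lambda>x. (f x)\<^sup>2 + (g x)\<^sup>2)" using assms by simp
  show "AE x in M. norm (f x * g x) \<le> norm ((f x)\<^sup>2 + (g x)\<^sup>2)"
  proof (rule AE_I2)
    fix x
    have "2 * \<bar>f x\<bar> * \<bar>g x\<bar> \<le> \<bar>f x\<bar>\<^sup>2 + \<bar>g x\<bar>\<^sup>2" by (rule sum_squares_bound)
    moreover have "0 \<le> \<bar>f x\<bar> * \<bar>g x\<bar>" by simp
    ultimately have "\<bar>f x\<bar> * \<bar>g x\<bar> \<le> (f x)\<^sup>2 + (g x)\<^sup>2" unfolding power2_abs by linarith
    then show "norm (f x * g x) \<le> norm ((f x)\<^sup>2 + (g x)\<^sup>2)" by (simp add: abs_mult)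
  qed
qed (use assms in measurable)

lemma integrable_square_comb:
  fixes f g :: "real \<Rightarrow> real"
  assumes "integrable M (\<lambda>x. (f x)\<^sup>2)" "integrable M (\<lambda>x. (g x)\<^sup>2)" "f \<in> borel_measurable M" "g \<in> borel_measurable M"
  shows "integrable M (\<lambda>x. (a * f x + b * g x)\<^sup>2)"
proof -
  have "integrable M (\<lambda>x. a\<^sup>2 * (f x)\<^sup>2 + 2 * a * b * (f x * g x) + b\<^sup>2 * (g x)\<^sup>2)"
    using assms integrable_mult_of_squares[OF assms] by simp
  moreover have "(\<lambda>x. a\<^sup>2 * (f x)\<^sup>2 + 2 * a * b * (f x * g x) + b\<^sup>2 * (g x)\<^sup>2) = (\<lambda>x. (a * f x + b * g x)\<^sup>2)"
    by (simp add: fun_eq_iff power2_eq_square algebra_simps)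
  ultimately show ?thesis by simp
qed

lemma form_domD:
  assumes "u \<in> form_dom s"
  shows "pc2 u" "integrable lborel (\<lambda>x. (u x)\<^sup>2)" "integrable lborel (\<lambda>x. (deriv2 u x)\<^sup>2)"
     "(u \<longlongrightarrow> 0) at_bot" "(deriv u \<longlongrightarrow> 0) at_bot" "s \<le> x \<Longrightarrow> u x = 0" "s \<le> x \<Longrightarrow> deriv u x = 0"
     "s < x \<Longrightarrow> deriv2 u x = 0"
proof -
  show p: "pc2 u" "integrable lborel (\<lambda>x. (u x)\<^sup>2)" "integrable lborel (\<lambda>x. (deriv2 u x)\<^sup>2)"
     "(u \<longlongrightarrow> 0) at_bot" "(deriv u \<longlongrightarrow> 0) at_bot" and z: "s \<le> x \<Longrightarrow> u x = 0" for x
    using assms by (auto simp: form_dom_def)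
  have d: "deriv u x = 0 \<and> deriv2 u x = 0" if "s < x" for x
    using deriv_cong_open[of "{s<..}" x u "\<lambda>_. 0"] that z pc2_zero by auto
  then show "s < x \<Longrightarrow> deriv2 u x = 0" by blast
  \<comment> \<open>\<open>form_dom\<close> prescribes only that \<open>u\<close> vanishes from
    \<open>s\<close> on; the second boundary condition u'(s) = 0 comes from continuity of the
    derivative.\<close>
  have "(deriv u \<longlongrightarrow> deriv u s) (at_right s)"
    using pc2D(2)[OF p(1), of UNIV] by (auto simp: continuous_on_eq_continuous_at isCont_def filterlim_at_split)
  moreover have "eventually (\<lambda>x. deriv u x = 0) (at_right s)" using d by (auto simp: eventually_at_filter)
  then have "(deriv u \<longlongrightarrow> 0) (at_right s)" by (rule tendsto_eventually)
  ultimately have "deriv u s = 0" using tendsto_unique trivial_limit_at_right_real by blast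
  then show "s \<le> x \<Longrightarrow> deriv u x = 0" using d by (cases "s = x") auto
qed

lemma subspace_form_dom: "subspace (form_dom s)"
proof (rule subspaceI)
  show "0 \<in> form_dom s" unfolding form_dom_def zero_fun_def using pc2_zero by simp
  have comb: "a *\<^sub>R u + b *\<^sub>R w \<in> form_dom s" if u: "u \<in> form_dom s" and w: "w \<in> form_dom s" for a b u w
  proof -
    note U = form_domD[OF u] and W = form_domD[OF w]
    note P = pc2_comb[OF U(1) W(1), of a b]
    have dc: "deriv (a *\<^sub>R u + b *\<^sub>R w) = (\<lambda>x. a * deriv u x + b * deriv w x)" using P(2) by (rule ext)
    have "integrable lborel (\<lambda>x. (a * u x + b * w x)\<^sup>2)"
      by (rule integrable_square_comb) (use U W pc2D(6) in auto)
    moreover have "integrable lborel (\<lambda>x. (deriv2 (a *\<^sub>R u + b *\<^sub>R w) x)\<^sup>2)"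
    proof -
      have "integrable lborel (\<lambda>x. (a * deriv2 u x + b * deriv2 w x)\<^sup>2)"
        by (rule integrable_square_comb) (use U W pc2D(4) in auto)
      moreover have "integrable lborel (\<lambda>x. (deriv2 (a *\<^sub>R u + b *\<^sub>R w) x)\<^sup>2) \<longleftrightarrow> integrable lborel (\<lambda>x. (a * deriv2 u x + b * deriv2 w x)\<^sup>2)"
      proof (rule integrable_cong_AE)
        show "AE x in lborel. (deriv2 (a *\<^sub>R u + b *\<^sub>R w) x)\<^sup>2 = (a * deriv2 u x + b * deriv2 w x)\<^sup>2"
          using P(3) by eventually_elim simp
      qed (use pc2D(4)[OF P(1)] pc2D(4)[OF U(1)] pc2D(4)[OF W(1)] in measurable)
      ultimately show ?thesis by simp
    qed
    moreover have "((a *\<^sub>R u + b *\<^sub>R w) \<longlongrightarrow> 0) at_bot"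
      using U(4) W(4) by (auto simp: plus_fun_def scaleR_fun_def intro!: tendsto_eq_intros)
    moreover have "(deriv (a *\<^sub>R u + b *\<^sub>R w) \<longlongrightarrow> 0) at_bot"
      unfolding dc using U(5) W(5) by (auto intro!: tendsto_eq_intros)
    ultimately show ?thesis using P(1) U(6) W(6) by (simp add: form_dom_def)
  qed
  show "u + w \<in> form_dom s" if "u \<in> form_dom s" "w \<in> form_dom s" for u w
    using comb[OF that, of 1 1] by simp
  show "a *\<^sub>R u \<in> form_dom s" if "u \<in> form_dom s" for a u
    using comb[OF that that, of a 0] by simp
qed

text \<open>Extension by zero makes the domains nested, which is what monotonicity of the index in
  the endpoint rests on.\<close>

lemma form_dom_mono: "s \<le> t \<Longrightarrow> form_dom s \<subseteq> form_dom t"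
  by (auto simp: form_dom_def)

lemma l2_integrable: "u \<in> form_dom s \<Longrightarrow> v \<in> form_dom t \<Longrightarrow> integrable lborel (\<lambda>x. u x * v x)"
  by (rule integrable_mult_of_squares) (auto dest: form_domD pc2D(6))

lemma form_space_l2: "form_space (form_dom s) l2form"
proof
  show "subspace (form_dom s)" by (rule subspace_form_dom)
next
  fix u v w assume "u \<in> form_dom s" "v \<in> form_dom s" "w \<in> form_dom s"
  then show "l2form (u + v) w = l2form u w + l2form v w"
    by (simp add: l2form_def distrib_right l2_integrable)
qed (simp_all add: l2form_def mult.commute mult.assoc, simp add: mult.left_commute mult.commute)

lemma l2form_pos:
  assumes u: "u \<in> form_dom s" and "u \<noteq> 0"
  shows "l2form u u > 0"
proof -
  note U = form_domD[OF u]
  have nn: "l2form u u \<ge> 0" by (simp add: l2form_def)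
  have "l2form u u \<noteq> 0"
  proof
    assume "l2form u u = 0"
    then have "AE x in lborel. u x * u x = 0"
      unfolding l2form_def using integral_nonneg_eq_0_iff_AE[of lborel "\<lambda>x. u x * u x"] l2_integrable[OF u u] by simp
    then have "AE x in lborel. u x = 0" by eventually_elim simp
    moreover obtain t where t: "u t \<noteq> 0" using assms(2) by (auto simp: fun_eq_iff)
    define S where "S = {x. u x \<noteq> 0}"
    have oS: "open S"
      unfolding S_def using pc2D(3)[OF U(1), of UNIV] by (intro open_Collect_neq) auto
    have "emeasure lborel S = 0"
    proof (rule AE_iff_measurable[THEN iffD1])
      show "S \<in> sets lborel" using oS by simp
      show "{x \<in> space lborel. \<not> u x = 0} = S" by (simp add: S_def)
    qed fact
    moreover obtain e where e: "e > 0" "ball t e \<subseteq> S" using oS t unfolding S_def open_contains_ball by blast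
    have "emeasure lborel {t - e<..<t + e} \<le> emeasure lborel S"
      by (rule emeasure_mono) (use e oS in \<open>auto simp: ball_def dist_real_def subset_iff\<close>)
    then have "ennreal (2 * e) \<le> emeasure lborel S" using e by simp
    ultimately show False using e by (simp add: ennreal_eq_0_iff)
  qed
  then show ?thesis using nn by simp
qed

context bounded_potential
begin

lemma c_measurable: "c \<in> borel_measurable borel"
  by (rule borel_measurable_continuous_onI[OF cont])

lemma qform_integrable:
  assumes u: "u \<in> form_dom s" and v: "v \<in> form_dom t"
  shows "integrable lborel (\<lambda>x. (deriv2 u x + u x) * (deriv2 v x + v x) + c x * u x * v x)"
proof -
  note U = form_domD[OF u] and V = form_domD[OF v]
  have sq: "integrable lborel (\<lambda>x. (deriv2 w x + w x)\<^sup>2)" if w: "w \<in> form_dom r" for w r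
    using integrable_square_comb[of lborel "deriv2 w" w 1 1] form_domD[OF w] pc2D[OF form_domD(1)[OF w]] by simp
  have "integrable lborel (\<lambda>x. (deriv2 u x + u x) * (deriv2 v x + v x))"
    by (rule integrable_mult_of_squares[OF sq[OF u] sq[OF v]])
       (use pc2D(4,6)[OF U(1)] pc2D(4,6)[OF V(1)] in measurable)
  moreover have "integrable lborel (\<lambda>x. c x * (u x * v x))"
  proof (rule Bochner_Integration.integrable_bound)
    show "integrable lborel (\<lambda>x. M * (u x * v x))" using l2_integrable[OF u v] by simp
    show "AE x in lborel. norm (c x * (u x * v x)) \<le> norm (M * (u x * v x))"
      using bd M_nonneg by (intro AE_I2) (auto simp: abs_mult intro!: mult_right_mono)
  qed (use pc2D(6)[OF U(1)] pc2D(6)[OF V(1)] c_measurable in measurable)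
  ultimately show ?thesis by (simp add: mult.assoc)
qed

lemma form_space_qform: "form_space (form_dom s) (qform c)"
proof
  show "subspace (form_dom s)" by (rule subspace_form_dom)
next
  fix u v assume "u \<in> form_dom s" "v \<in> form_dom s"
  show "qform c u v = qform c v u" by (simp add: qform_def mult.commute mult.left_commute)
next
  have comb: "qform c (a *\<^sub>R u + b *\<^sub>R v) w = a * qform c u w + b * qform c v w"
    if u: "u \<in> form_dom s" and v: "v \<in> form_dom s" and w: "w \<in> form_dom s" for a b u v w
  proof -
    have uv: "a *\<^sub>R u + b *\<^sub>R v \<in> form_dom s"
      using u v subspace_form_dom by (intro subspace_add subspace_scale)
    let ?I = "\<lambda>u x. (deriv2 u x + u x) * (deriv2 w x + w x) + c x * u x * w x"
    have "qform c (a *\<^sub>R u + b *\<^sub>R v) w = (\<integral>x. a * ?I u x + b * ?I v x \<partial>lborel)"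
      unfolding qform_def
    proof (rule integral_cong_AE)
      show "AE x in lborel. ?I (a *\<^sub>R u + b *\<^sub>R v) x = a * ?I u x + b * ?I v x"
        using pc2_comb(3)[OF form_domD(1)[OF u] form_domD(1)[OF v], of a b]
        by eventually_elim (simp add: algebra_simps)
    qed (use borel_measurable_integrable qform_integrable[OF uv w] qform_integrable[OF u w] qform_integrable[OF v w] in auto)
    also have "\<dots> = a * qform c u w + b * qform c v w"
      unfolding qform_def using qform_integrable[OF u w] qform_integrable[OF v w] by simp
    finally show ?thesis .
  qed
  show "qform c (u + v) w = qform c u w + qform c v w" if "u \<in> form_dom s" "v \<in> form_dom s" "w \<in> form_dom s" for u v w
    using comb[OF that, of 1 1] by simp
  show "qform c (a *\<^sub>R u) w = a * qform c u w" if "u \<in> form_dom s" "w \<in> form_dom s" for a u w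
    using comb[OF that(1,1,2), of a 0] by simp
qed

lemma qform_add_const:
  assumes u: "u \<in> form_dom s"
  shows "qform (\<lambda>x. c x + e) u u = qform c u u + e * l2form u u"
proof -
  have "qform (\<lambda>x. c x + e) u u = (\<integral>x. ((deriv2 u x + u x) * (deriv2 u x + u x) + c x * u x * u x) + e * (u x * u x) \<partial>lborel)"
    unfolding qform_def by (simp add: algebra_simps)
  also have "\<dots> = qform c u u + e * l2form u u"
    unfolding qform_def l2form_def using qform_integrable[OF u u] l2_integrable[OF u u] by simp
  finally show ?thesis .
qed

end

section \<open>Translations of the form domain\<close>

definition shift :: "real \<Rightarrow> (real \<Rightarrow> real) \<Rightarrow> (real \<Rightarrow> real)" where
  "shift \<tau> u = (\<lambda>x. u (x + \<tau>))"

lemma deriv_shift: "deriv (shift \<tau> u) = shift \<tau> (deriv u)"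
  unfolding shift_def deriv_def DERIV_shift[symmetric] ..

lemma deriv2_shift: "deriv2 (shift \<tau> u) = shift \<tau> (deriv2 u)"
  unfolding deriv2_def deriv_shift ..

lemma linear_shift: "linear (shift \<tau>)"
  by (rule linearI) (simp_all add: shift_def fun_eq_iff)

lemma inj_shift: "inj (shift \<tau>)"
proof (rule injI)
  fix u v assume "shift \<tau> u = shift \<tau> v"
  then have "u (x - \<tau> + \<tau>) = v (x - \<tau> + \<tau>)" for x unfolding shift_def by metis
  then show "u = v" by (simp add: fun_eq_iff)
qed

lemma integrable_shift:
  fixes f :: "real \<Rightarrow> real"
  shows "integrable lborel f \<Longrightarrow> integrable lborel (\<lambda>x. f (x + \<tau>))"
  using lborel_integrable_real_affine[of f 1 \<tau>] by (simp add: add.commute)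

lemma integral_shift:
  fixes f :: "real \<Rightarrow> real" and \<tau> :: real
  shows "(\<integral>x. f (x + \<tau>) \<partial>lborel) = (\<integral>x. f x \<partial>lborel)"
  using lborel_integral_real_affine[of 1 f \<tau>] by (simp add: add.commute)

lemma pc2_shift: assumes u: "pc2 u" shows "pc2 (shift \<tau> u)"
proof -
  obtain F where F: "finite F" "\<And>x. x \<notin> F \<Longrightarrow> (deriv u has_real_derivative deriv2 u x) (at x)"
    using pc2_exceptional[OF u] by blast
  have 1: "(shift \<tau> u has_real_derivative shift \<tau> (deriv u) x) (at x)" for x
    using pc2D(1)[OF u, of "x + \<tau>"] unfolding shift_def DERIV_shift .
  have 2: "continuous_on UNIV (shift \<tau> (deriv u))"
    unfolding shift_def by (rule continuous_on_compose2[OF pc2D(2)[OF u, of UNIV]]) (auto intro!: continuous_intros)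
  have 3: "finite ((\<lambda>x. x - \<tau>) ` F)" using F by simp
  have 4: "(shift \<tau> (deriv u) has_real_derivative shift \<tau> (deriv2 u) x) (at x)" if x: "x \<notin> (\<lambda>x. x - \<tau>) ` F" for x
  proof -
    have "x + \<tau> \<notin> F" using x by (metis add_diff_cancel_right' image_eqI)
    then show ?thesis using F(2)[of "x + \<tau>"] unfolding shift_def DERIV_shift by simp
  qed
  have 5: "shift \<tau> (deriv2 u) \<in> borel_measurable borel"
    unfolding shift_def using pc2D(4)[OF u] by measurable
  have 6: "set_integrable lborel {-n..n} (\<lambda>x. (shift \<tau> (deriv2 u) x)\<^sup>2)" for n
  proof -
    have "set_integrable lborel {- (\<bar>n\<bar> + \<bar>\<tau>\<bar>)..\<bar>n\<bar> + \<bar>\<tau>\<bar>} (\<lambda>x. (deriv2 u x)\<^sup>2)" by (rule pc2D(5)[OF u])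
    then have "set_integrable lborel {- n + \<tau>..n + \<tau>} (\<lambda>x. (deriv2 u x)\<^sup>2)"
      by (rule set_integrable_subset) auto
    from integrable_shift[OF this[unfolded set_integrable_def], of \<tau>] show ?thesis
      unfolding set_integrable_def shift_def by (simp add: indicator_def)
  qed
  show ?thesis using pc2I(1)[OF 1 2 3 4 5 6] .
qed

lemma shift_form_dom:
  assumes u: "u \<in> form_dom t"
  shows "shift \<tau> u \<in> form_dom (t - \<tau>)"
proof -
  note U = form_domD[OF u]
  show ?thesis unfolding form_dom_def mem_Collect_eq deriv2_shift deriv_shift
    using pc2_shift[OF U(1)] integrable_shift[OF U(2)] integrable_shift[OF U(3)] U(6)
      filterlim_compose[OF U(4) filterlim_shift_at_bot] filterlim_compose[OF U(5) filterlim_shift_at_bot]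
    by (simp add: shift_def)
qed

lemma l2form_shift: "l2form (shift \<tau> u) (shift \<tau> u) = l2form u u"
  unfolding l2form_def shift_def by (rule integral_shift)

text \<open>The part with u'' + u is translation invariant. Undoing the translation moves only the
  potential, so the error is bounded by the L^2 form.\<close>

lemma (in bounded_potential) qform_shift:
  assumes u: "u \<in> form_dom t" and near: "\<And>x. \<bar>c (x - \<tau>) - c x\<bar> \<le> e"
  shows "\<bar>qform c (shift \<tau> u) (shift \<tau> u) - qform c u u\<bar> \<le> e * l2form u u"
proof -
  interpret T: bounded_potential "\<lambda>x. c (x - \<tau>)" M
    by standard (auto intro!: bd continuous_on_compose2[OF cont] continuous_intros)
  let ?I = "\<lambda>c x. (deriv2 u x + u x) * (deriv2 u x + u x) + c x * u x * u x"
  have "qform c (shift \<tau> u) (shift \<tau> u) = (\<integral>x. ?I (\<lambda>x. c (x - \<tau>)) (x + \<tau>) \<partial>lborel)"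
    unfolding qform_def deriv2_shift by (simp add: shift_def)
  also have "\<dots> = qform (\<lambda>x. c (x - \<tau>)) u u" unfolding qform_def by (rule integral_shift)
  finally have "qform c (shift \<tau> u) (shift \<tau> u) - qform c u u = (\<integral>x. ?I (\<lambda>x. c (x - \<tau>)) x - ?I c x \<partial>lborel)"
    unfolding qform_def using Bochner_Integration.integral_diff[OF T.qform_integrable[OF u u] qform_integrable[OF u u]] by simp
  moreover have "\<bar>\<integral>x. ?I (\<lambda>x. c (x - \<tau>)) x - ?I c x \<partial>lborel\<bar> \<le> (\<integral>x. e * (u x * u x) \<partial>lborel)"
  proof (rule integral_abs_bound_integral)
    show "integrable lborel (\<lambda>x. ?I (\<lambda>x. c (x - \<tau>)) x - ?I c x)"
      by (rule Bochner_Integration.integrable_diff[OF T.qform_integrable[OF u u] qform_integrable[OF u u]])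
    show "integrable lborel (\<lambda>x. e * (u x * u x))" using l2_integrable[OF u u] by simp
    fix x
    have "?I (\<lambda>x. c (x - \<tau>)) x - ?I c x = (c (x - \<tau>) - c x) * (u x * u x)" by (simp add: algebra_simps)
    also have "\<bar>\<dots>\<bar> \<le> e * (u x * u x)" unfolding abs_mult[of _ "u x * u x"] using near[of x] by (simp add: mult_right_mono)
    finally show "\<bar>?I (\<lambda>x. c (x - \<tau>)) x - ?I c x\<bar> \<le> e * (u x * u x)" .
  qed
  ultimately show ?thesis by (simp add: l2form_def)
qed

section \<open>Splitting the form and Green's formula\<close>

lemma integral_atMost_split:
  fixes F :: "real \<Rightarrow> real"
  assumes F: "integrable lborel F" and "a \<le> b"
  shows "integral {..b} F = integral {..a} F + integral {a..b} F"
proof -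
  have i: "F integrable_on A" if "A \<in> sets borel" for A
    by (rule set_borel_integral_eq_integral(1), unfold set_integrable_def, rule integrable_mult_indicator) (use F that in auto)
  have "{..b} = {..a} \<union> {a..b}" "{..a} \<inter> {a..b} = {a}" using assms(2) by auto
  then show ?thesis using integral_Un[of F "{..a}" "{a..b}"] i by simp
qed

lemma integral_grid_split:
  fixes F :: "real \<Rightarrow> real" and g :: "nat \<Rightarrow> real"
  assumes F: "integrable lborel F" and g: "\<And>j. j < N \<Longrightarrow> g j \<le> g (Suc j)" and z: "\<And>x. g N < x \<Longrightarrow> F x = 0"
  shows "(\<integral>x. F x \<partial>lborel) = integral {..g 0} F + (\<Sum>j<N. integral {g j..g (Suc j)} F)"
proof -
  have "n \<le> N \<Longrightarrow> integral {..g n} F = integral {..g 0} F + (\<Sum>j<n. integral {g j..g (Suc j)} F)" for n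
  proof (induction n)
    case (Suc n)
    then show ?case using integral_atMost_split[OF F g[of n]] by simp
  qed simp
  then have "integral {..g N} F = integral {..g 0} F + (\<Sum>j<N. integral {g j..g (Suc j)} F)" by blast
  moreover have U: "(F has_integral (\<integral>x. F x \<partial>lborel)) UNIV" by (rule has_integral_integral_lborel[OF F])
  have "set_integrable lborel {..g N} F"
    unfolding set_integrable_def by (rule integrable_mult_indicator) (use F in auto)
  then have "(F has_integral integral {..g N} F) {..g N}"
    by (intro integrable_integral set_borel_integral_eq_integral(1))
  then have "(F has_integral integral {..g N} F) UNIV"
    by (rule has_integral_on_superset) (use z in auto)
  with U have "integral {..g N} F = (\<integral>x. F x \<partial>lborel)" by (rule has_integral_unique[rotated])
  ultimately show ?thesis by simp
qed

text \<open>By the equation, the integrand is the derivative of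
  \<open>y 2 * deriv v - y 3 * v\<close> off a finite set. Continuity at the exceptional points of
  \<open>v\<close> is all that the fundamental theorem requires there.\<close>

lemma green_interval:
  assumes s: "sol c y" and v: "pc2 v" and lr: "l \<le> r"
  shows "((\<lambda>x. y 2 x * (deriv2 v x + v x) + c x * y 0 x * v x) has_integral
     (y 2 r * deriv v r - y 3 r * v r) - (y 2 l * deriv v l - y 3 l * v l)) {l..r}"
proof -
  obtain F where F: "finite F" "\<And>x. x \<notin> F \<Longrightarrow> (deriv v has_real_derivative deriv2 v x) (at x)"
    using pc2_exceptional[OF v] by blast
  show ?thesis
  proof (rule fundamental_theorem_of_calculus_interior_strong[OF F(1) lr])
    fix x assume x: "x \<in> {l<..<r} - F"
    have "((\<lambda>x. y 2 x * deriv v x - y 3 x * v x) has_real_derivative y 2 x * (deriv2 v x + v x) + c x * y 0 x * v x) (at x)"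
      using x by (auto intro!: derivative_eq_intros solD[OF s] F(2) pc2D(1)[OF v] simp: algebra_simps)
    then show "((\<lambda>x. y 2 x * deriv v x - y 3 x * v x) has_vector_derivative y 2 x * (deriv2 v x + v x) + c x * y 0 x * v x) (at x)"
      by (simp add: has_real_derivative_iff_has_vector_derivative)
  next
    show "continuous_on {l..r} (\<lambda>x. y 2 x * deriv v x - y 3 x * v x)"
      by (intro continuous_intros sol_continuous_on[OF s] pc2D[OF v]) auto
  qed
qed

text \<open>Limit of the interval formula: the left boundary term tends to 0, since
  \<open>y\<close>, \<open>v\<close> and \<open>deriv v\<close> all decay.\<close>

lemma green_half_line:
  assumes s: "sol c y" and v: "v \<in> form_dom t" and d: "decays y"
    and int: "set_integrable lborel {..r} (\<lambda>x. y 2 x * (deriv2 v x + v x) + c x * y 0 x * v x)"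
  shows "integral {..r} (\<lambda>x. y 2 x * (deriv2 v x + v x) + c x * y 0 x * v x) = y 2 r * deriv v r - y 3 r * v r"
proof -
  note V = form_domD[OF v]
  let ?F = "\<lambda>x. y 2 x * (deriv2 v x + v x) + c x * y 0 x * v x"
  let ?b = "\<lambda>x. y 2 x * deriv v x - y 3 x * v x"
  have "((\<lambda>l. LINT x:{l..r}|lborel. ?F x) \<longlongrightarrow> (LINT x:{..r}|lborel. ?F x)) at_bot"
    by (rule tendsto_set_lebesgue_integral_at_bot[OF _ int]) simp
  moreover have "eventually (\<lambda>l. (LINT x:{l..r}|lborel. ?F x) = ?b r - ?b l) at_bot"
    using eventually_le_at_bot[of r]
  proof eventually_elim
    case (elim l)
    have "set_integrable lborel {l..r} ?F" by (rule set_integrable_subset[OF int]) auto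
    from set_borel_integral_eq_integral(2)[OF this] show ?case
      using integral_unique[OF green_interval[OF s V(1) elim]] by simp
  qed
  then have "((\<lambda>l. LINT x:{l..r}|lborel. ?F x) \<longlongrightarrow> ?b r) at_bot \<longleftrightarrow> ((\<lambda>l. ?b r - ?b l) \<longlongrightarrow> ?b r) at_bot"
    by (rule tendsto_cong)
  moreover have "((\<lambda>l. ?b r - ?b l) \<longlongrightarrow> ?b r - (0 * 0 - 0 * 0)) at_bot"
    using d V(4,5) unfolding decays_def all_less_4 by (intro tendsto_intros) auto
  ultimately have "(LINT x:{..r}|lborel. ?F x) = ?b r" 
    using tendsto_unique[of at_bot] trivial_limit_at_bot_linorder by force
  then show ?thesis using set_borel_integral_eq_integral(2)[OF int] by simp
qed

section \<open>Diagonalization by broken solutions\<close>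

text \<open>Completing squares with the weight \<open>\<rho> x = - A (x - l)\<close>, first for \<open>(k', k'')\<close> and then for \<open>(k, k')\<close>, bounds
  \<open>k''\<^sup>2 - (A\<^sup>2/4) k\<^sup>2\<close> from below by a derivative whose integral vanishes, so no Poincare inequality is needed.\<close>

lemma short_interval_pos:
  fixes c k :: "real \<Rightarrow> real" and M \<delta> l r :: real
  assumes k: "pc2 k" and lr: "l < r" and short: "8 * (1 + M + \<delta>) * (r - l)\<^sup>2 \<le> 1" and M: "0 \<le> M" "0 < \<delta>"
    and bd: "\<And>x. \<bar>c x\<bar> \<le> M"
    and z: "k l = 0" "deriv k l = 0" "k r = 0" "deriv k r = 0"
    and int: "(\<lambda>x. (deriv2 k x + k x)\<^sup>2 + c x * (k x)\<^sup>2 - \<delta> * (k x)\<^sup>2) integrable_on {l..r}"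
  shows "0 \<le> integral {l..r} (\<lambda>x. (deriv2 k x + k x)\<^sup>2 + c x * (k x)\<^sup>2 - \<delta> * (k x)\<^sup>2)"
proof -
  obtain E where E: "finite E" "\<And>x. x \<notin> E \<Longrightarrow> (deriv k has_real_derivative deriv2 k x) (at x)"
    using pc2_exceptional[OF k] by blast
  \<comment> \<open>From (k'' + k)^2 \<ge> k''^2 / 2 - k^2, it is enough to compare k''^2 with
    \<open>\<kappa>\<close> times k^2.\<close>
  define \<kappa> where "\<kappa> = 2 * (1 + M + \<delta>)"
  define h where "h = r - l"
  \<comment> \<open>Chosen so that the weight satisfies
    \<open>(\<rho> x)\<^sup>2 \<le> A / 2\<close> on the interval, which makes both completed
    squares fit. Shortness gives \<open>2 * \<kappa> \<le> A\<close>, whence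
    \<open>\<kappa> \<le> A\<^sup>2 / 4\<close> because \<open>\<kappa>\<close> is at least
    1.\<close>
  define A where "A = 1 / (2 * h\<^sup>2)"
  have h: "h > 0" "4 * \<kappa> * h\<^sup>2 \<le> 1" using lr short by (auto simp: h_def \<kappa>_def)
  have A: "A > 0" "A\<^sup>2 * h\<^sup>2 = A / 2" using h by (auto simp: A_def power2_eq_square)
  have \<kappa>: "1 \<le> \<kappa>" using M by (simp add: \<kappa>_def)
  have "2 * \<kappa> \<le> A" using h by (simp add: A_def field_simps)
  then have "(2 * \<kappa>)\<^sup>2 \<le> A\<^sup>2" using \<kappa> by (intro power_mono) auto
  moreover have "\<kappa> * 1 \<le> \<kappa> * \<kappa>" using \<kappa> by (intro mult_left_mono) auto
  ultimately have A\<kappa>: "\<kappa> \<le> A\<^sup>2 / 4" by (simp add: power2_eq_square)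
  define \<rho> where "\<rho> x = - A * (x - l)" for x
  define \<Phi> where "\<Phi> x = \<rho> x * (deriv k x)\<^sup>2 + (A / 2) * \<rho> x * (k x)\<^sup>2" for x
  define \<Phi>' where "\<Phi>' x = - A * (deriv k x)\<^sup>2 + 2 * \<rho> x * deriv k x * deriv2 k x
      + (A / 2) * (- A * (k x)\<^sup>2 + 2 * \<rho> x * k x * deriv k x)" for x
  have "(\<Phi>' has_integral \<Phi> r - \<Phi> l) {l..r}"
  proof (rule fundamental_theorem_of_calculus_interior_strong[OF E(1)])
    fix x assume x: "x \<in> {l<..<r} - E"
    have "(\<Phi> has_real_derivative \<Phi>' x) (at x)"
      unfolding \<Phi>_def \<Phi>'_def \<rho>_def using x
      by (auto intro!: derivative_eq_intros E(2) pc2D(1)[OF k] simp: algebra_simps power2_eq_square)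
    then show "(\<Phi> has_vector_derivative \<Phi>' x) (at x)" by (simp add: has_real_derivative_iff_has_vector_derivative)
  next
    show "continuous_on {l..r} \<Phi>" unfolding \<Phi>_def \<rho>_def by (intro continuous_intros pc2D[OF k])
  qed (use lr in auto)
  moreover have "\<Phi> r - \<Phi> l = 0" using z by (simp add: \<Phi>_def)
  ultimately have i: "((\<lambda>x. \<Phi>' x / 2) has_integral 0) {l..r}" using has_integral_divide[of \<Phi>' 0 "{l..r}" 2] by simp
  have "\<Phi>' x / 2 \<le> (deriv2 k x + k x)\<^sup>2 + c x * (k x)\<^sup>2 - \<delta> * (k x)\<^sup>2" if x: "x \<in> {l..r}" for x
  proof -
    let ?g = "deriv2 k x" and ?v = "deriv k x" and ?u = "k x"
    have "(x - l)\<^sup>2 \<le> h\<^sup>2" using x by (intro power_mono) (auto simp: h_def)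
    then have "A\<^sup>2 * (x - l)\<^sup>2 \<le> A\<^sup>2 * h\<^sup>2" by (intro mult_left_mono) auto
    then have \<rho>2: "(\<rho> x)\<^sup>2 \<le> A / 2" using A by (simp add: \<rho>_def power_mult_distrib)
    have 1: "2 * \<rho> x * ?v * ?g \<le> ?g\<^sup>2 + A / 2 * ?v\<^sup>2"
    proof -
      have "2 * \<rho> x * ?v * ?g \<le> ?g\<^sup>2 + (\<rho> x)\<^sup>2 * ?v\<^sup>2"
        using zero_le_power2[of "?g - \<rho> x * ?v"] by (simp add: power2_eq_square algebra_simps)
      moreover have "(\<rho> x)\<^sup>2 * ?v\<^sup>2 \<le> A / 2 * ?v\<^sup>2" using \<rho>2 by (rule mult_right_mono) simp
      ultimately show ?thesis by linarith
    qed
    have 2: "2 * \<rho> x * ?u * ?v \<le> ?v\<^sup>2 + A / 2 * ?u\<^sup>2"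
    proof -
      have "2 * \<rho> x * ?u * ?v \<le> ?v\<^sup>2 + (\<rho> x)\<^sup>2 * ?u\<^sup>2"
        using zero_le_power2[of "?v - \<rho> x * ?u"] by (simp add: power2_eq_square algebra_simps)
      moreover have "(\<rho> x)\<^sup>2 * ?u\<^sup>2 \<le> A / 2 * ?u\<^sup>2" using \<rho>2 by (rule mult_right_mono) simp
      ultimately show ?thesis by linarith
    qed
    have "(A / 2) * (- A * ?u\<^sup>2 + 2 * \<rho> x * ?u * ?v) \<le> (A / 2) * (?v\<^sup>2 - A / 2 * ?u\<^sup>2)"
      using A(1) 2 by (intro mult_left_mono) auto
    also have "\<dots> = A / 2 * ?v\<^sup>2 - A\<^sup>2 / 4 * ?u\<^sup>2" by (simp add: algebra_simps power2_eq_square)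
    finally have "\<Phi>' x \<le> ?g\<^sup>2 - A\<^sup>2 / 4 * ?u\<^sup>2" using 1 unfolding \<Phi>'_def by linarith
    also have "\<dots> \<le> ?g\<^sup>2 - \<kappa> * ?u\<^sup>2" using mult_right_mono[OF A\<kappa>, of "?u\<^sup>2"] by simp
    finally have 3: "\<Phi>' x \<le> ?g\<^sup>2 - \<kappa> * ?u\<^sup>2" .
    have "?g\<^sup>2 / 2 - ?u\<^sup>2 \<le> (?g + ?u)\<^sup>2"
      using zero_le_power2[of "?g + 2 * ?u"] by (simp add: power2_eq_square algebra_simps)
    moreover have "- M * ?u\<^sup>2 \<le> c x * ?u\<^sup>2" using bd[of x] by (intro mult_right_mono) auto
    ultimately have 4: "?g\<^sup>2 / 2 - ?u\<^sup>2 - M * ?u\<^sup>2 - \<delta> * ?u\<^sup>2 \<le> (?g + ?u)\<^sup>2 + c x * ?u\<^sup>2 - \<delta> * ?u\<^sup>2" by linarith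
    have 5: "?g\<^sup>2 / 2 - ?u\<^sup>2 - M * ?u\<^sup>2 - \<delta> * ?u\<^sup>2 = (?g\<^sup>2 - \<kappa> * ?u\<^sup>2) / 2"
      by (simp add: \<kappa>_def algebra_simps)
    have "\<Phi>' x / 2 \<le> (?g\<^sup>2 - \<kappa> * ?u\<^sup>2) / 2" using 3 by simp
    then show ?thesis using 4 unfolding 5 by (rule order_trans)
  qed
  then show ?thesis by (rule has_integral_le[OF i integrable_integral[OF int]])
qed

lemma form_domI:
  assumes p: "pc2 \<eta>" and i: "set_integrable lborel {..b} (\<lambda>x. (\<eta> x)\<^sup>2)" "set_integrable lborel {..b} (\<lambda>x. (deriv2 \<eta> x)\<^sup>2)"
    and l: "(\<eta> \<longlongrightarrow> 0) at_bot" "(deriv \<eta> \<longlongrightarrow> 0) at_bot" and z: "\<And>x. s \<le> x \<Longrightarrow> \<eta> x = 0"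
  shows "\<eta> \<in> form_dom s"
proof -
  have full: "integrable lborel f"
    if f: "set_integrable lborel {..b} f" "\<And>n. set_integrable lborel {-n..n} f" "\<And>x. s < x \<Longrightarrow> f x = 0" for f :: "real \<Rightarrow> real"
  proof -
    define n where "n = \<bar>b\<bar> + \<bar>s\<bar>"
    have "set_integrable lborel ({..b} \<union> {-n..n}) f" using f by (intro set_integrable_Un) auto
    then have "integrable lborel (\<lambda>x. indicator ({..b} \<union> {-n..n}) x *\<^sub>R f x)" unfolding set_integrable_def .
    moreover have "(\<lambda>x. indicator ({..b} \<union> {-n..n}) x *\<^sub>R f x) = f"
    proof
      fix x
      show "indicator ({..b} \<union> {-n..n}) x *\<^sub>R f x = f x"
      proof (cases "x \<in> {..b} \<union> {-n..n}")
        case False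
        then have "s < x" by (auto simp: n_def)
        then show ?thesis using f(3) by simp
      qed simp
    qed
    ultimately show ?thesis by (simp only:)
  qed
  have "integrable lborel (\<lambda>x. (\<eta> x)\<^sup>2)"
  proof (rule full[OF i(1)])
    show "set_integrable lborel {-n..n} (\<lambda>x. (\<eta> x)\<^sup>2)" for n
      by (intro borel_integrable_atLeastAtMost' continuous_intros pc2D(3)[OF p])
  qed (use z in auto)
  moreover have "integrable lborel (\<lambda>x. (deriv2 \<eta> x)\<^sup>2)"
  proof (rule full[OF i(2) pc2D(5)[OF p]])
    fix x assume "s < x"
    then have "deriv2 \<eta> x = deriv2 (\<lambda>_. 0) x" by (intro deriv_cong_open(2)[of "{s<..}"]) (use z in auto)
    then show "(deriv2 \<eta> x)\<^sup>2 = 0" using pc2_zero by simp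
  qed
  ultimately show ?thesis using p l z by (simp add: form_dom_def)
qed

lemma deriv_sum_form_dom:
  assumes "finite I" "\<And>i. i \<in> I \<Longrightarrow> f i \<in> form_dom s"
  shows "(\<Sum>i\<in>I. f i) \<in> form_dom s \<and> deriv (\<Sum>i\<in>I. f i) x = (\<Sum>i\<in>I. deriv (f i) x)"
  using assms
proof (induction I)
  case empty
  have "deriv (0 :: real \<Rightarrow> real) x = 0" unfolding zero_fun_def by simp
  then show ?case unfolding sum.empty using subspace_0[OF subspace_form_dom] by blast
next
  case (insert i I)
  then have H: "f i \<in> form_dom s" "(\<Sum>i\<in>I. f i) \<in> form_dom s"
    and IH: "deriv (\<Sum>i\<in>I. f i) x = (\<Sum>i\<in>I. deriv (f i) x)" by auto
  have "deriv (f i + (\<Sum>i\<in>I. f i)) x = deriv (f i) x + deriv (\<Sum>i\<in>I. f i) x"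
    using pc2_comb(2)[OF form_domD(1)[OF H(1)] form_domD(1)[OF H(2)], of 1 1 x] by simp
  then show ?case
    unfolding sum.insert[OF insert.hyps] IH using subspace_add[OF subspace_form_dom H] by blast
qed

context left_positive_potential
begin

lemma decays_square_integrable:
  assumes "sol c y" "decays y" "k < 4"
  shows "set_integrable lborel {..r} (\<lambda>x. (y k x)\<^sup>2)"
  using decays_if_wronsk_nonneg(2)[OF assms(1) wronsk_nonneg_if_decays[OF assms(1,2)] assms(3)] .

lemma form_dom_sol:
  assumes p: "pc2 \<eta>" and y: "sol c y" "decays y" and eq: "\<And>x. x \<le> b \<Longrightarrow> \<eta> x = y 0 x"
    and z: "\<And>x. s \<le> x \<Longrightarrow> \<eta> x = 0"
  shows "\<eta> \<in> form_dom s"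
proof -
  note P = pc2_sol[OF y(1) cont]
  have d: "deriv \<eta> x = y 1 x \<and> deriv2 \<eta> x = y 2 x - y 0 x" if "x < b" for x
    using deriv_cong_open[of "{..<b}" x \<eta> "y 0"] that eq P(2,3) by auto
  \<comment> \<open>Stopping at \<open>b - 1\<close> keeps the closed half-line inside the open set
    where the derivatives of \<open>\<eta>\<close> agree with those of the solution.\<close>
  have sb: "set_integrable lborel {..b - 1} (\<lambda>x. (y k x)\<^sup>2)" if "k < 4" for k
    by (rule decays_square_integrable[OF y that])
  have i2: "set_integrable lborel {..b - 1} (\<lambda>x. (y 2 x - y 0 x)\<^sup>2)"
  proof (rule set_integrable_dominated)
    show "set_integrable lborel {..b - 1} (\<lambda>x. 2 * (y 2 x)\<^sup>2 + 2 * (y 0 x)\<^sup>2)"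
      by (rule set_integral_add(1); rule set_integrable_mult_right; rule sb; simp)
    show "(\<lambda>x. (y 2 x - y 0 x)\<^sup>2) \<in> borel_measurable borel"
      by (intro borel_measurable_continuous_onI continuous_intros sol_continuous_on[OF y(1)]) auto
    show "\<bar>(y 2 x - y 0 x)\<^sup>2\<bar> \<le> 2 * (y 2 x)\<^sup>2 + 2 * (y 0 x)\<^sup>2" for x
      unfolding abs_of_nonneg[OF zero_le_power2]
      using zero_le_power2[of "y 2 x + y 0 x"] by (simp add: power2_eq_square algebra_simps)
  qed auto
  have ev: "eventually (\<lambda>x. x < b) at_bot" by (rule eventually_gt_at_bot)
  show ?thesis
  proof (rule form_domI[OF p _ _ _ _ z])
    show "set_integrable lborel {..b - 1} (\<lambda>x. (\<eta> x)\<^sup>2)"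
      by (subst set_integrable_cong[OF refl]) (use sb[of 0] eq in auto)
    show "set_integrable lborel {..b - 1} (\<lambda>x. (deriv2 \<eta> x)\<^sup>2)"
      by (subst set_integrable_cong[OF refl]) (use i2 d in auto)
    have "(y 0 \<longlongrightarrow> 0) at_bot" "(y 1 \<longlongrightarrow> 0) at_bot" using y(2) by (simp_all add: decays_def)
    moreover have "eventually (\<lambda>x. y 0 x = \<eta> x) at_bot" using ev by eventually_elim (simp add: eq)
    moreover have "eventually (\<lambda>x. y 1 x = deriv \<eta> x) at_bot" using ev by eventually_elim (simp add: d)
    ultimately show "(\<eta> \<longlongrightarrow> 0) at_bot" "(deriv \<eta> \<longlongrightarrow> 0) at_bot"
      by (blast intro: Lim_transform_eventually)+
  qed
qed

text \<open>Green's formula makes the form of a solution clamped at both ends zero, while on a short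
  interval it is at least \<open>\<delta>\<close> times the integral of u^2.\<close>

lemma interval_sol_zero:
  assumes s: "sol c y" and lr: "l < r" "8 * (1 + M + \<delta>) * (r - l)\<^sup>2 \<le> 1"
    and z: "y 0 l = 0" "y 1 l = 0" "y 0 r = 0" "y 1 r = 0" and k: "k < 4"
  shows "y k x = 0"
proof -
  note P = pc2_sol[OF s cont]
  have cy: "continuous_on S (y k)" if "k < 4" for k S by (rule sol_continuous_on[OF s that])
  have g: "((\<lambda>x. (y 2 x)\<^sup>2 + c x * (y 0 x)\<^sup>2) has_integral 0) {l..r}"
    using green_interval[OF s P(1), of l r] lr z unfolding P by (simp add: power2_eq_square mult.assoc)
  let ?F = "\<lambda>x. (deriv2 (y 0) x + y 0 x)\<^sup>2 + c x * (y 0 x)\<^sup>2 - \<delta> * (y 0 x)\<^sup>2"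
  have "continuous_on {l..r} (\<lambda>x. \<delta> * (y 0 x)\<^sup>2)" by (intro continuous_intros cy) simp
  then have i: "(\<lambda>x. \<delta> * (y 0 x)\<^sup>2) integrable_on {l..r}" by (rule integrable_continuous_interval)
  have Fi: "(?F has_integral 0 - integral {l..r} (\<lambda>x. \<delta> * (y 0 x)\<^sup>2)) {l..r}"
    unfolding P using has_integral_diff[OF g integrable_integral[OF i]] by simp
  have "0 \<le> integral {l..r} ?F"
    by (rule short_interval_pos[OF P(1) lr(1,2) M_nonneg \<delta> bd]) (use z Fi P in \<open>auto simp: has_integral_integrable\<close>)
  then have le: "integral {l..r} (\<lambda>x. \<delta> * (y 0 x)\<^sup>2) \<le> 0" using integral_unique[OF Fi] by simp
  have "\<forall>x\<in>{l..r}. \<delta> * (y 0 x)\<^sup>2 = 0"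
  proof -
    have "integral {l..r} (\<lambda>x. \<delta> * (y 0 x)\<^sup>2) \<ge> 0" using \<delta> by (intro integral_nonneg[OF i]) auto
    with le have "integral {l..r} (\<lambda>x. \<delta> * (y 0 x)\<^sup>2) = 0" by (rule antisym)
    then have "((\<lambda>x. \<delta> * (y 0 x)\<^sup>2) has_integral 0) (cbox l r)"
      using integrable_integral[OF i] unfolding box_real(2) by (simp only:)
    moreover have "continuous_on (cbox l r) (\<lambda>x. \<delta> * (y 0 x)\<^sup>2)" by (intro continuous_intros cy) simp
    ultimately have "\<delta> * (y 0 x)\<^sup>2 = 0" if "x \<in> cbox l r" for x
      using has_integral_0_cbox_imp_0[of l r "\<lambda>x. \<delta> * (y 0 x)\<^sup>2" x] that \<delta> lr by (auto simp: box_real)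
    then show ?thesis by simp
  qed
  then show ?thesis using sol_zero_on_interval[OF s _ lr(1) k] \<delta> by auto
qed

text \<open>The map from the four Cauchy data at \<open>l\<close> to the four boundary values is
  linear and, by \<open>interval_sol_zero\<close>, injective; hence it is surjective.\<close>

lemma interval_sol_exists:
  assumes lr: "l < r" "8 * (1 + M + \<delta>) * (r - l)\<^sup>2 \<le> 1"
  obtains y where "sol c y" "y 0 l = A" "y 1 l = B" "y 0 r = C" "y 1 r = D"
proof -
  obtain Y where Ysol: "\<And>\<xi>. sol c (Y \<xi>)"
    and Yt: "\<And>p q r s. Y (p, q, r, s) 0 l = p" "\<And>p q r s. Y (p, q, r, s) 1 l = q"
    "\<And>p q r s. Y (p, q, r, s) 2 l = r" "\<And>p q r s. Y (p, q, r, s) 3 l = s"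
    and Ylin: "\<And>\<alpha> \<xi> \<beta> \<eta> k x. Y (\<alpha> *\<^sub>R \<xi> + \<beta> *\<^sub>R \<eta>) k x = \<alpha> * Y \<xi> k x + \<beta> * Y \<eta> k x"
    by (rule sol_parametrization[of l]) blast
  define J where "J \<xi> = (Y \<xi> 0 l, Y \<xi> 1 l, Y \<xi> 0 r, Y \<xi> 1 r)" for \<xi>
  have "linear J"
  proof (rule linearI)
    show "J (\<xi> + \<eta>) = J \<xi> + J \<eta>" for \<xi> \<eta>
      using Ylin[of 1 \<xi> 1 \<eta>] by (simp add: J_def)
    show "J (\<alpha> *\<^sub>R \<xi>) = \<alpha> *\<^sub>R J \<xi>" for \<alpha> \<xi>
      using Ylin[of \<alpha> \<xi> 0 0] by (simp add: J_def)
  qed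
  moreover have "inj J"
  proof (rule linear_injective_0[OF \<open>linear J\<close>, THEN iffD2], intro allI impI)
    fix \<xi> assume "J \<xi> = 0"
    then have z: "Y \<xi> 0 l = 0" "Y \<xi> 1 l = 0" "Y \<xi> 0 r = 0" "Y \<xi> 1 r = 0"
      by (simp_all add: J_def zero_prod_def)
    have "\<forall>k<4. Y \<xi> k l = 0" using interval_sol_zero[OF Ysol lr z] by blast
    moreover obtain p q r s where "\<xi> = (p, q, r, s)" by (cases \<xi>) auto
    ultimately show "\<xi> = 0" unfolding all_less_4 using Yt by (simp add: zero_prod_def)
  qed
  ultimately have "surj J" by (rule linear_injective_imp_surjective) (rule refl)
  then obtain \<xi> where "J \<xi> = (A, B, C, D)" by (metis surjD)
  then show ?thesis using that[OF Ysol[of \<xi>]] by (simp add: J_def)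
qed

end

section \<open>Decomposition of the form domain along a grid\<close>

text \<open>Left of \<open>g 0\<close> coercivity comes from the sign of \<open>c\<close>, between
  grid points from shortness of the intervals. The last point \<open>g N\<close> is the endpoint of
  the half-line.\<close>

locale grid_potential = left_positive_potential +
  fixes g :: "nat \<Rightarrow> real" and N :: nat
  assumes g_less: "j < N \<Longrightarrow> g j < g (Suc j)"
    and g_short: "j < N \<Longrightarrow> 8 * (1 + M + \<delta>) * (g (Suc j) - g j)\<^sup>2 \<le> 1"
    and g_first: "g 0 \<le> a"
begin

interpretation Q: form_space "form_dom (g N)" "qform c" by (rule form_space_qform)

lemma g_mono: "i < j \<Longrightarrow> j \<le> N \<Longrightarrow> g i < g j"
proof (induction j)
  case (Suc j)
  then show ?case using g_less[of j] by (cases "i = j") auto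
qed simp

lemma g_mono_le: "i \<le> j \<Longrightarrow> j \<le> N \<Longrightarrow> g i \<le> g j"
  using g_mono[of i j] by (cases "i = j") auto

definition grid_null :: "(real \<Rightarrow> real) set" where
  "grid_null = {k \<in> form_dom (g N). \<forall>j\<le>N. k (g j) = 0 \<and> deriv k (g j) = 0}"

text \<open>Piecewise solutions; \<open>Y 0\<close> is used on \<open>(-\<infinity>, g 0]\<close> and \<open>Y (j + 1)\<close> on \<open>[g j, g (j + 1)]\<close>.\<close>

definition broken :: "(real \<Rightarrow> real) \<Rightarrow> (nat \<Rightarrow> nat \<Rightarrow> real \<Rightarrow> real) \<Rightarrow> bool" where
  "broken \<eta> Y \<longleftrightarrow> \<eta> \<in> form_dom (g N) \<and> (\<forall>j. sol c (Y j)) \<and> decays (Y 0) \<and> (\<forall>x\<le>g 0. \<eta> x = Y 0 0 x) \<and>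
     (\<forall>j<N. \<forall>x. g j \<le> x \<and> x \<le> g (Suc j) \<longrightarrow> \<eta> x = Y (Suc j) 0 x)"

text \<open>The boundary form in Green's formula: w and -w', with w = u'' + u, are the momenta
  conjugate to slope and value.\<close>

definition momentum_pairing :: "(nat \<Rightarrow> real \<Rightarrow> real) \<Rightarrow> (real \<Rightarrow> real) \<Rightarrow> real \<Rightarrow> real" where
  "momentum_pairing y v x = y 2 x * deriv v x - y 3 x * v x"

text \<open>Green's formula on each piece shows that pairing with a broken solution sees only the
  values and slopes of \<open>v\<close> on the grid. In particular it is orthogonal to
  \<open>grid_null\<close>.\<close>

lemma qform_broken:
  assumes b: "broken \<eta> Y" and v: "v \<in> form_dom (g N)"
  shows "qform c \<eta> v = momentum_pairing (Y 0) v (g 0) +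
    (\<Sum>j<N. momentum_pairing (Y (Suc j)) v (g (Suc j)) - momentum_pairing (Y (Suc j)) v (g j))"
proof -
  have \<eta>: "\<eta> \<in> form_dom (g N)" and Y: "sol c (Y j)" "decays (Y 0)" and
    eq0: "\<And>x. x \<le> g 0 \<Longrightarrow> \<eta> x = Y 0 0 x" and
    eq: "\<And>j x. j < N \<Longrightarrow> g j \<le> x \<Longrightarrow> x \<le> g (Suc j) \<Longrightarrow> \<eta> x = Y (Suc j) 0 x" for j
    using b by (auto simp: broken_def)
  let ?F = "\<lambda>x. (deriv2 \<eta> x + \<eta> x) * (deriv2 v x + v x) + c x * \<eta> x * v x"
  define G where "G j x = Y j 2 x * (deriv2 v x + v x) + c x * Y j 0 x * v x" for j x
  have Fi: "integrable lborel ?F" by (rule qform_integrable[OF \<eta> v])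
  have mG: "G j \<in> borel_measurable borel" for j
  proof -
    have "Y j 2 \<in> borel_measurable borel" "Y j 0 \<in> borel_measurable borel"
      by (intro borel_measurable_continuous_onI sol_continuous_on[OF Y(1)]; simp)+
    then show ?thesis unfolding G_def[abs_def] using pc2D(4,6)[OF form_domD(1)[OF v]] c_measurable by measurable
  qed
  have FG: "?F x = G j x" if "open S" "x \<in> S" "\<And>t. t \<in> S \<Longrightarrow> \<eta> t = Y j 0 t" for S x j
  proof -
    have "deriv2 \<eta> x = Y j 2 x - Y j 0 x"
      using deriv_cong_open(2)[OF that] pc2_sol(3)[OF Y(1) cont] by simp
    then show ?thesis using that(2,3) by (simp add: G_def)
  qed
  have "integral {..g 0} ?F = integral {..g 0} (G 0)"
  proof (rule integral_spike[of "{g 0}"])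
    fix x assume "x \<in> {..g 0} - {g 0}"
    then show "G 0 x = ?F x" by (intro FG[symmetric, of "{..<g 0}"]) (use eq0 in auto)
  qed simp
  also have "\<dots> = momentum_pairing (Y 0) v (g 0)"
    unfolding G_def[abs_def] momentum_pairing_def
  proof (rule green_half_line[OF Y(1) v Y(2)])
    have "set_integrable lborel {..g 0} ?F"
      unfolding set_integrable_def by (rule integrable_mult_indicator) (use Fi in auto)
    moreover have "set_integrable lborel {..g 0} ?F \<longleftrightarrow> set_integrable lborel {..g 0} (G 0)"
      unfolding set_integrable_def
    proof (rule integrable_cong_AE)
      show "AE x in lborel. indicat_real {..g 0} x *\<^sub>R ?F x = indicat_real {..g 0} x *\<^sub>R G 0 x"
        using AE_lborel_singleton[of "g 0"]
      proof eventually_elim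
        case (elim x)
        show ?case
        proof (cases "x < g 0")
          case True
          have "?F x = G 0 x" by (intro FG[of "{..<g 0}"]) (use True eq0 in auto)
          then show ?thesis by simp
        qed (use elim in \<open>simp add: indicator_def\<close>)
      qed
    qed (use mG[of 0] borel_measurable_integrable[OF Fi] in measurable)
    ultimately show "set_integrable lborel {..g 0} (\<lambda>x. Y 0 2 x * (deriv2 v x + v x) + c x * Y 0 0 x * v x)"
      unfolding G_def[abs_def] by simp
  qed
  finally have 1: "integral {..g 0} ?F = momentum_pairing (Y 0) v (g 0)" .
  have 2: "integral {g j..g (Suc j)} ?F = momentum_pairing (Y (Suc j)) v (g (Suc j)) - momentum_pairing (Y (Suc j)) v (g j)"
    if j: "j < N" for j
  proof -
    have "integral {g j..g (Suc j)} ?F = integral {g j..g (Suc j)} (G (Suc j))"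
    proof (rule integral_spike[of "{g j, g (Suc j)}"])
      fix x assume "x \<in> {g j..g (Suc j)} - {g j, g (Suc j)}"
      then show "G (Suc j) x = ?F x" by (intro FG[symmetric, of "{g j<..<g (Suc j)}"]) (use eq[OF j] in auto)
    qed simp
    also have "\<dots> = momentum_pairing (Y (Suc j)) v (g (Suc j)) - momentum_pairing (Y (Suc j)) v (g j)"
      unfolding G_def[abs_def] momentum_pairing_def
      using green_interval[OF Y(1) form_domD(1)[OF v]] g_less[OF j] by (intro integral_unique) auto
    finally show ?thesis .
  qed
  have "qform c \<eta> v = integral {..g 0} ?F + (\<Sum>j<N. integral {g j..g (Suc j)} ?F)"
    unfolding qform_def
    by (rule integral_grid_split[OF Fi]) (use g_less form_domD(6)[OF \<eta>] form_domD(6)[OF v] form_domD(8)[OF v] in \<open>auto simp: less_imp_le\<close>)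
  then show ?thesis using 1 2 by simp
qed

lemma qform_broken_grid_null:
  assumes "broken \<eta> Y" "k \<in> grid_null"
  shows "qform c \<eta> k = 0"
proof -
  have "momentum_pairing y k (g j) = 0" if "j \<le> N" for y j
    using assms(2) that by (simp add: grid_null_def momentum_pairing_def)
  moreover have "k \<in> form_dom (g N)" using assms(2) by (simp add: grid_null_def)
  ultimately show ?thesis using qform_broken[OF assms(1)] by simp
qed

lemma broken_comb:
  assumes "broken u Y" "broken v Z"
  shows "broken (\<alpha> *\<^sub>R u + \<beta> *\<^sub>R v) (\<lambda>j k x. \<alpha> * Y j k x + \<beta> * Z j k x)"
proof -
  have "\<alpha> *\<^sub>R u + \<beta> *\<^sub>R v \<in> form_dom (g N)"
    using assms subspace_form_dom by (intro subspace_add subspace_scale) (auto simp: broken_def)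
  then show ?thesis using assms unfolding broken_def
    by (auto intro!: sol_deriv_comb decays_lincomb)
qed

lemma broken_zero: "broken 0 (\<lambda>j k x. 0)"
  unfolding broken_def using sol_zero subspace_0[OF subspace_form_dom] by (auto simp: decays_def)

text \<open>Only the two pieces meeting at \<open>g i\<close> are nonzero. The left one solves a
  boundary value problem on the preceding interval or, for \<open>i = 0\<close>, is a decaying
  solution; the right one is clamped at \<open>g (Suc i)\<close>. There is no hat at
  \<open>g N\<close>, where everything is clamped.\<close>

lemma hat_exists:
  assumes i: "i < N"
  shows "\<exists>\<eta> Y. broken \<eta> Y \<and> \<eta> (g i) = A \<and> deriv \<eta> (g i) = B \<and> (\<forall>j\<le>N. j \<noteq> i \<longrightarrow> \<eta> (g j) = 0 \<and> deriv \<eta> (g j) = 0)"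
proof -
  obtain y where y: "sol c y" "y 0 (g i) = A" "y 1 (g i) = B"
    and y0: "i = 0 \<Longrightarrow> decays y" and y1: "\<And>h. i = Suc h \<Longrightarrow> y 0 (g h) = 0 \<and> y 1 (g h) = 0"
  proof (cases i)
    case 0
    obtain y where "sol c y" "y 0 (g 0) = A" "y 1 (g 0) = B" "decays y" using decaying_sol_exists[OF g_first] .
    then show ?thesis using 0 by (intro that[of y]) auto
  next
    case (Suc h)
    then have h: "h < N" using i by simp
    obtain y where "sol c y" "y 0 (g h) = 0" "y 1 (g h) = 0" "y 0 (g (Suc h)) = A" "y 1 (g (Suc h)) = B"
      using interval_sol_exists[OF g_less[OF h] g_short[OF h]] .
    then show ?thesis using Suc by (intro that[of y]) auto
  qed
  obtain z where z: "sol c z" "z 0 (g i) = A" "z 1 (g i) = B" "z 0 (g (Suc i)) = 0" "z 1 (g (Suc i)) = 0"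
    using interval_sol_exists[OF g_less[OF i] g_short[OF i]] .
  note Py = pc2_sol[OF y(1) cont] and Pz = pc2_sol[OF z(1) cont]
  define L where "L = (if i = 0 then y 0 else glue (g (i - 1)) (\<lambda>_. 0) (y 0))"
  define R where "R = glue (g (Suc i)) (z 0) (\<lambda>_. 0)"
  define \<eta> where "\<eta> = glue (g i) L R"
  \<comment> \<open>Pieces are numbered by their right ends: \<open>Y i\<close> lies left of
    \<open>g i\<close> and \<open>Y (Suc i)\<close> right of it.\<close>
  define Y where "Y j = (if j = i then y else if j = Suc i then z else (\<lambda>k x. 0))" for j
  have gi: "g i < g (Suc i)" by (rule g_less[OF i])
  have gi': "g (i - 1) < g i" if "i \<noteq> 0" using g_mono[of "i - 1" i] i that by simp
  have y1': "y 0 (g (i - 1)) = 0" "y 1 (g (i - 1)) = 0" if "i \<noteq> 0" using y1[of "i - 1"] that by auto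
  have PL: "pc2 L" "deriv L = (if i = 0 then y 1 else glue (g (i - 1)) (\<lambda>_. 0) (y 1))"
    using pc2_glue[OF pc2_zero(1) Py(1), of "g (i - 1)"] y1' Py pc2_zero by (auto simp: L_def)
  have PR: "pc2 R" "deriv R = glue (g (Suc i)) (z 1) (\<lambda>_. 0)"
    using pc2_glue[OF Pz(1) pc2_zero(1), of "g (Suc i)"] z Pz pc2_zero by (auto simp: R_def)
  have LR: "L (g i) = R (g i)" "deriv L (g i) = deriv R (g i)"
    unfolding PL PR using gi gi' y z by (auto simp: L_def R_def glue_def)
  have P\<eta>: "pc2 \<eta>" "deriv \<eta> = glue (g i) (deriv L) (deriv R)"
    unfolding \<eta>_def using pc2_glue[OF PL(1) PR(1) LR] by auto
  have right: "\<eta> x = 0" if "g (Suc i) \<le> x" for x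
    using that gi z(4) by (auto simp: \<eta>_def R_def glue_def)
  have mid: "\<eta> x = z 0 x" if "g i \<le> x" "x \<le> g (Suc i)" for x
    using that gi gi' y z by (cases "x = g i") (auto simp: \<eta>_def L_def R_def glue_def)
  have left: "\<eta> x = y 0 x" if "i = 0 \<or> g (i - 1) \<le> x" "x \<le> g i" for x
    using that gi' y1' by (auto simp: \<eta>_def L_def glue_def)
  have leftmost: "\<eta> x = 0" if "i \<noteq> 0" "x \<le> g (i - 1)" for x
    using that gi' by (auto simp: \<eta>_def L_def glue_def)
  have solY: "sol c (Y j)" for j using y z sol_zero by (auto simp: Y_def)
  have dec: "decays (Y 0)" using y0 by (auto simp: Y_def decays_def)
  have eq0: "\<eta> x = Y 0 0 x" if "x \<le> g 0" for x
  proof (cases "i = 0")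
    case True
    then show ?thesis using left that by (simp add: Y_def)
  next
    case False
    then have "g 0 \<le> g (i - 1)" using g_mono_le[of 0 "i - 1"] i by simp
    then show ?thesis using leftmost that False by (simp add: Y_def)
  qed
  have eq: "\<eta> x = Y (Suc j) 0 x" if j: "j < N" and x: "g j \<le> x" "x \<le> g (Suc j)" for j x
  proof -
    consider "j = i" | "Suc j = i" | "i < j" | "Suc j < i" by linarith
    then show ?thesis
    proof cases
      case 1
      then show ?thesis using mid x by (simp add: Y_def)
    next
      case 2
      then have "i - 1 = j" by simp
      then show ?thesis using left[of x] x 2 by (auto simp: Y_def)
    next
      case 3
      then have "g (Suc i) \<le> g j" using g_mono_le[of "Suc i" j] j by simp
      then show ?thesis using right[of x] x 3 by (simp add: Y_def)
    next
      case 4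
      then have "g (Suc j) \<le> g (i - 1)" using g_mono_le[of "Suc j" "i - 1"] i by simp
      then show ?thesis using leftmost[of x] x 4 by (simp add: Y_def)
    qed
  qed
  have "\<eta> \<in> form_dom (g N)"
  proof (rule form_dom_sol[OF P\<eta>(1) solY dec eq0])
    have "g (Suc i) \<le> g N" using g_mono_le[of "Suc i" N] i by simp
    then show "\<eta> x = 0" if "g N \<le> x" for x using right that by simp
  qed
  then have "broken \<eta> Y" unfolding broken_def using solY dec eq0 eq by blast
  moreover have "i = 0 \<or> g (i - 1) \<le> g i" using gi' by (cases "i = 0") auto
  then have "\<eta> (g i) = A" "deriv \<eta> (g i) = B"
    using left[of "g i"] gi' y P\<eta>(2) PL(2) by (auto simp: glue_def less_imp_le)
  moreover have "\<eta> (g j) = 0 \<and> deriv \<eta> (g j) = 0" if j: "j \<le> N" "j \<noteq> i" for j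
  proof (cases "i < j")
    case True
    then have le: "g (Suc i) \<le> g j" using g_mono_le[of "Suc i" j] j by simp
    then have "deriv \<eta> (g j) = 0" unfolding P\<eta>(2) PR(2) using gi z(5) by (auto simp: glue_def)
    then show ?thesis using right[OF le] by simp
  next
    case False
    then have i0: "i \<noteq> 0" and le: "g j \<le> g (i - 1)" using j i g_mono_le[of j "i - 1"] by auto
    have "deriv \<eta> (g j) = 0" unfolding P\<eta>(2) PL(2) using gi'[OF i0] le i0 by (auto simp: glue_def)
    then show ?thesis using leftmost[OF i0 le] by simp
  qed
  ultimately show ?thesis by blast
qed

lemma grid_null_positive:
  assumes k: "k \<in> grid_null"
  shows "\<delta> * l2form k k \<le> qform c k k"
proof -
  have kH: "k \<in> form_dom (g N)" and z: "\<And>j. j \<le> N \<Longrightarrow> k (g j) = 0" "\<And>j. j \<le> N \<Longrightarrow> deriv k (g j) = 0"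
    using k by (auto simp: grid_null_def)
  let ?F = "\<lambda>x. (deriv2 k x + k x)\<^sup>2 + c x * (k x)\<^sup>2 - \<delta> * (k x)\<^sup>2"
  have eq: "?F = (\<lambda>x. ((deriv2 k x + k x) * (deriv2 k x + k x) + c x * k x * k x) - \<delta> * (k x * k x))"
    by (simp add: power2_eq_square mult.assoc)
  have Fi: "integrable lborel ?F"
    unfolding eq using qform_integrable[OF kH kH] l2_integrable[OF kH kH] by (intro Bochner_Integration.integrable_diff) auto
  have "qform c k k - \<delta> * l2form k k = (\<integral>x. ?F x \<partial>lborel)"
    unfolding eq qform_def l2form_def
    using Bochner_Integration.integral_diff[OF qform_integrable[OF kH kH], of "\<lambda>x. \<delta> * (k x * k x)"] l2_integrable[OF kH kH] by simp
  also have "\<dots> = integral {..g 0} ?F + (\<Sum>j<N. integral {g j..g (Suc j)} ?F)"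
    by (rule integral_grid_split[OF Fi]) (use g_less form_domD(6,8)[OF kH] in \<open>auto simp: less_imp_le\<close>)
  also have "\<dots> \<ge> 0"
  proof (intro add_nonneg_nonneg sum_nonneg)
    have io: "?F integrable_on S" if "S \<in> sets borel" for S
      by (rule set_borel_integral_eq_integral(1), unfold set_integrable_def, rule integrable_mult_indicator) (use Fi that in auto)
    show "0 \<le> integral {..g 0} ?F"
    proof (rule integral_nonneg[OF io])
      fix x assume "x \<in> {..g 0}"
      then have "\<delta> \<le> c x" using pos g_first by auto
      then have "\<delta> * (k x)\<^sup>2 \<le> c x * (k x)\<^sup>2" by (intro mult_right_mono) auto
      then show "0 \<le> ?F x" using zero_le_power2[of "deriv2 k x + k x"] by linarith
    qed simp
    fix j assume "j \<in> {..<N}"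
    then have j: "j < N" by simp
    show "0 \<le> integral {g j..g (Suc j)} ?F"
      by (rule short_interval_pos[OF form_domD(1)[OF kH] g_less[OF j] g_short[OF j] M_nonneg \<delta> bd]) (use z j io in auto)
  qed
  finally show ?thesis by simp
qed

lemma subspace_grid_null: "subspace grid_null"
proof (rule subspaceI)
  have "deriv (0 :: real \<Rightarrow> real) x = 0" for x unfolding zero_fun_def by simp
  then show "0 \<in> grid_null" unfolding grid_null_def using subspace_0[OF subspace_form_dom] by simp
  fix u v assume uv: "u \<in> grid_null" "v \<in> grid_null"
  then have H: "u \<in> form_dom (g N)" "v \<in> form_dom (g N)" by (auto simp: grid_null_def)
  have "deriv (u + v) x = deriv u x + deriv v x" for x
    using pc2_comb(2)[OF form_domD(1)[OF H(1)] form_domD(1)[OF H(2)], of 1 1 x] by simp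
  then show "u + v \<in> grid_null" using uv subspace_add[OF subspace_form_dom H] by (simp add: grid_null_def)
next
  fix \<alpha> u assume u: "u \<in> grid_null"
  then have H: "u \<in> form_dom (g N)" by (auto simp: grid_null_def)
  have "deriv (\<alpha> *\<^sub>R u) x = \<alpha> * deriv u x" for x
    using pc2_comb(2)[OF form_domD(1)[OF H] form_domD(1)[OF H], of \<alpha> 0 x] by simp
  then show "\<alpha> *\<^sub>R u \<in> grid_null" using u subspace_scale[OF subspace_form_dom H] by (simp add: grid_null_def)
qed

text \<open>Nodal functions as in Hermite interpolation: one family is dual to the values at the
  grid points, the other to the slopes.\<close>

lemma hats:
  obtains hA hB YA YB where
    "\<And>i. i < N \<Longrightarrow> broken (hA i) (YA i)" "\<And>i. i < N \<Longrightarrow> broken (hB i) (YB i)"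
    "\<And>i j. i < N \<Longrightarrow> j \<le> N \<Longrightarrow> hA i (g j) = (if j = i then 1 else 0)"
    "\<And>i j. i < N \<Longrightarrow> j \<le> N \<Longrightarrow> deriv (hA i) (g j) = 0"
    "\<And>i j. i < N \<Longrightarrow> j \<le> N \<Longrightarrow> hB i (g j) = 0"
    "\<And>i j. i < N \<Longrightarrow> j \<le> N \<Longrightarrow> deriv (hB i) (g j) = (if j = i then 1 else 0)"
proof -
  obtain hA YA where A: "\<And>i. i < N \<Longrightarrow> broken (hA i) (YA i) \<and> hA i (g i) = 1 \<and> deriv (hA i) (g i) = 0 \<and>
      (\<forall>j\<le>N. j \<noteq> i \<longrightarrow> hA i (g j) = 0 \<and> deriv (hA i) (g j) = 0)"
    using hat_exists[of _ 1 0] by metis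
  obtain hB YB where B: "\<And>i. i < N \<Longrightarrow> broken (hB i) (YB i) \<and> hB i (g i) = 0 \<and> deriv (hB i) (g i) = 1 \<and>
      (\<forall>j\<le>N. j \<noteq> i \<longrightarrow> hB i (g j) = 0 \<and> deriv (hB i) (g j) = 0)"
    using hat_exists[of _ 0 1] by metis
  show ?thesis by (rule that[of hA YA hB YB]) (use A B in \<open>force\<close>)+
qed

lemma broken_span:
  assumes S: "\<And>e. e \<in> S \<Longrightarrow> \<exists>Y. broken e Y" and u: "u \<in> span S"
  shows "\<exists>Y. broken u Y"
proof -
  have "subspace {u. \<exists>Y. broken u Y}"
  proof (rule subspaceI)
    show "0 \<in> {u. \<exists>Y. broken u Y}" using broken_zero by blast
    show "u + v \<in> {u. \<exists>Y. broken u Y}" if "u \<in> {u. \<exists>Y. broken u Y}" "v \<in> {u. \<exists>Y. broken u Y}" for u v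
      using that broken_comb[of u _ v _ 1 1] by auto
    show "\<alpha> *\<^sub>R u \<in> {u. \<exists>Y. broken u Y}" if "u \<in> {u. \<exists>Y. broken u Y}" for \<alpha> u
      using that broken_comb[of u _ u _ \<alpha> 0] by auto
  qed
  then have "span S \<subseteq> {u. \<exists>Y. broken u Y}" by (rule span_minimal[rotated]) (use S in auto)
  then show ?thesis using u by auto
qed

text \<open>Subtracting the Hermite interpolant built from the hats leaves a function in
  \<open>grid_null\<close>, so the complement is spanned by finitely many broken solutions.\<close>

lemma grid_decomposition:
  obtains S where "finite S" "\<And>e. e \<in> S \<Longrightarrow> \<exists>Y. broken e Y"
    "\<And>u. u \<in> form_dom (g N) \<Longrightarrow> \<exists>k\<in>grid_null. u - k \<in> span S"
proof -
  obtain hA hB YA YB where h: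
    "\<And>i. i < N \<Longrightarrow> broken (hA i) (YA i)" "\<And>i. i < N \<Longrightarrow> broken (hB i) (YB i)"
    "\<And>i j. i < N \<Longrightarrow> j \<le> N \<Longrightarrow> hA i (g j) = (if j = i then 1 else 0)"
    "\<And>i j. i < N \<Longrightarrow> j \<le> N \<Longrightarrow> deriv (hA i) (g j) = 0"
    "\<And>i j. i < N \<Longrightarrow> j \<le> N \<Longrightarrow> hB i (g j) = 0"
    "\<And>i j. i < N \<Longrightarrow> j \<le> N \<Longrightarrow> deriv (hB i) (g j) = (if j = i then 1 else 0)"
    by (rule hats) blast
  define S where "S = hA ` {..<N} \<union> hB ` {..<N}"
  have hH: "hA i \<in> form_dom (g N)" "hB i \<in> form_dom (g N)" if "i < N" for i
    using h(1,2)[OF that] by (auto simp: broken_def)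
  show ?thesis
  proof (rule that[of S])
    show "finite S" by (simp add: S_def)
    show "\<exists>Y. broken e Y" if "e \<in> S" for e using that h(1,2) by (auto simp: S_def)
    fix u assume u: "u \<in> form_dom (g N)"
    define f where "f i = u (g i) *\<^sub>R hA i + deriv u (g i) *\<^sub>R hB i" for i
    have fH: "f i \<in> form_dom (g N)" if "i < N" for i
      unfolding f_def using hH[OF that] subspace_form_dom by (intro subspace_add subspace_scale)
    have df: "deriv (f i) x = u (g i) * deriv (hA i) x + deriv u (g i) * deriv (hB i) x" if "i < N" for i x
      unfolding f_def by (rule pc2_comb(2)) (use hH[OF that] form_domD(1) in auto)
    define w where "w = (\<Sum>i\<in>{..<N}. f i)"
    have wH: "w \<in> form_dom (g N)" and dw: "\<And>x. deriv w x = (\<Sum>i\<in>{..<N}. deriv (f i) x)"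
      using deriv_sum_form_dom[of "{..<N}" f "g N"] fH by (auto simp: w_def)
    have dk: "deriv (u - w) x = deriv u x - deriv w x" for x
      using pc2_comb(2)[OF form_domD(1)[OF u] form_domD(1)[OF wH], of 1 "-1" x] by simp
    have "w (g j) = u (g j) \<and> deriv w (g j) = deriv u (g j)" if j: "j \<le> N" for j
    proof -
      have "w (g j) = (\<Sum>i<N. if i = j then u (g j) else 0)"
        unfolding w_def sum_fun_apply by (rule sum.cong) (use h j in \<open>auto simp: f_def\<close>)
      moreover have "deriv w (g j) = (\<Sum>i<N. if i = j then deriv u (g j) else 0)"
        unfolding dw by (rule sum.cong) (use h j df in auto)
      \<comment> \<open>At the last grid point the interpolant is 0, which matches because
        \<open>u\<close> is clamped there.\<close>
      moreover have "u (g N) = 0" "deriv u (g N) = 0" using form_domD(6,7)[OF u] by auto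
      ultimately show ?thesis using j by (cases "j = N") auto
    qed
    then have "u - w \<in> grid_null"
      unfolding grid_null_def using subspace_diff[OF subspace_form_dom u wH] dk by simp
    moreover have "w \<in> span S"
      unfolding w_def f_def by (intro span_sum span_add span_scale; rule span_base) (auto simp: S_def)
    then have "u - (u - w) \<in> span S" by simp
    ultimately show "\<exists>k\<in>grid_null. u - k \<in> span S" by blast
  qed
qed

lemma grid_diagonal_form: obtains E where "diagonal_form (form_dom (g N)) (qform c) l2form E grid_null \<delta>"
proof -
  obtain S where S: "finite S" "\<And>e. e \<in> S \<Longrightarrow> \<exists>Y. broken e Y"
    "\<And>u. u \<in> form_dom (g N) \<Longrightarrow> \<exists>k\<in>grid_null. u - k \<in> span S"
    using grid_decomposition by blast
  have KS: "qform c k e = 0" if ke: "k \<in> grid_null" "e \<in> S" for k e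
  proof -
    obtain Y where Y: "broken e Y" using S(2) ke by blast
    have "k \<in> form_dom (g N)" "e \<in> form_dom (g N)" using ke Y by (auto simp: grid_null_def broken_def)
    then show ?thesis using qform_broken_grid_null[OF Y ke(1)] Q.sym by simp
  qed
  obtain E where "diagonal_form (form_dom (g N)) (qform c) l2form E grid_null \<delta>"
    by (rule diagonal_form_exists[OF form_space_qform form_space_l2 l2form_pos S(1) _ subspace_grid_null _ S(3) KS \<delta> grid_null_positive])
       (use S(2) in \<open>auto simp: broken_def grid_null_def\<close>)
  then show ?thesis by (rule that)
qed

text \<open>Testing against the \<open>grid_null\<close> part removes it by coercivity, so a kernel
  element is broken. Testing against the hats makes the momenta continuous across every grid point;
  value and slope are continuous anyway, so all pieces are the same solution by uniqueness.\<close>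

lemma ker_is_sol:
  assumes u: "u \<in> form_ker (form_dom (g N)) (qform c)"
  obtains y where "sol c y" "decays y" "\<And>x. x \<le> g N \<Longrightarrow> u x = y 0 x"
proof -
  have uH: "u \<in> form_dom (g N)" and uz: "\<And>v. v \<in> form_dom (g N) \<Longrightarrow> qform c u v = 0"
    using u by (auto simp: form_ker_def)
  obtain S where S: "finite S" "\<And>e. e \<in> S \<Longrightarrow> \<exists>Y. broken e Y"
    "\<And>u. u \<in> form_dom (g N) \<Longrightarrow> \<exists>k\<in>grid_null. u - k \<in> span S"
    using grid_decomposition by blast
  obtain k where k: "k \<in> grid_null" "u - k \<in> span S" using S(3)[OF uH] by blast
  obtain Y' where Y': "broken (u - k) Y'" using broken_span[OF S(2) k(2)] by blast
  have kH: "k \<in> form_dom (g N)" and dH: "u - k \<in> form_dom (g N)" using k Y' by (auto simp: grid_null_def broken_def)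
  have "qform c ((u - k) + k) k = qform c (u - k) k + qform c k k" by (rule Q.add_l[OF dH kH kH])
  then have "qform c k k = 0" using uz[OF kH] qform_broken_grid_null[OF Y' k(1)] by simp
  then have "\<delta> * l2form k k \<le> 0" using grid_null_positive[OF k(1)] by simp
  then have "k = 0" using l2form_pos[OF kH] \<delta> by (smt (verit) mult_pos_pos)
  then obtain Y where Y: "broken u Y" using Y' by auto
  have sY: "sol c (Y j)" and dY: "decays (Y 0)" and eq0: "\<And>x. x \<le> g 0 \<Longrightarrow> u x = Y 0 0 x"
    and eq: "\<And>j x. j < N \<Longrightarrow> g j \<le> x \<Longrightarrow> x \<le> g (Suc j) \<Longrightarrow> u x = Y (Suc j) 0 x" for j
    using Y by (auto simp: broken_def)
  obtain hA hB YA YB where h: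
    "\<And>i. i < N \<Longrightarrow> broken (hA i) (YA i)" "\<And>i. i < N \<Longrightarrow> broken (hB i) (YB i)"
    "\<And>i j. i < N \<Longrightarrow> j \<le> N \<Longrightarrow> hA i (g j) = (if j = i then 1 else 0)"
    "\<And>i j. i < N \<Longrightarrow> j \<le> N \<Longrightarrow> deriv (hA i) (g j) = 0"
    "\<And>i j. i < N \<Longrightarrow> j \<le> N \<Longrightarrow> hB i (g j) = 0"
    "\<And>i j. i < N \<Longrightarrow> j \<le> N \<Longrightarrow> deriv (hB i) (g j) = (if j = i then 1 else 0)"
    by (rule hats) blast
  \<comment> \<open>Each piece agrees with \<open>u\<close> on one side of the grid point only; as
    \<open>u\<close> is differentiable there, a one-sided difference quotient is enough.\<close>
  have du: "deriv u (g i) = Y j 1 (g i)"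
    if ev: "eventually (\<lambda>x. u x = Y j 0 x) (at_left (g i)) \<or> eventually (\<lambda>x. u x = Y j 0 x) (at_right (g i))"
      and val: "u (g i) = Y j 0 (g i)" for i j
  proof -
    have d: "((\<lambda>x. u x - Y j 0 x) has_real_derivative deriv u (g i) - Y j 1 (g i)) (at (g i))"
      by (intro derivative_intros pc2D(1)[OF form_domD(1)[OF uH]] solD(1)[OF sY])
    have "deriv u (g i) - Y j 1 (g i) = 0" if F: "F \<le> at (g i)" "F \<noteq> bot" "eventually (\<lambda>x. u x = Y j 0 x) F" for F
    proof -
      have "((\<lambda>x. (u x - Y j 0 x - (u (g i) - Y j 0 (g i))) / (x - g i)) \<longlongrightarrow> deriv u (g i) - Y j 1 (g i)) F"
        using d F(1) by (auto simp: has_field_derivative_iff intro: tendsto_mono)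
      moreover have "eventually (\<lambda>x. (u x - Y j 0 x - (u (g i) - Y j 0 (g i))) / (x - g i) = 0) F"
        using F(3) by eventually_elim (simp add: val)
      then have "((\<lambda>x. (u x - Y j 0 x - (u (g i) - Y j 0 (g i))) / (x - g i)) \<longlongrightarrow> 0) F" by (rule tendsto_eventually)
      ultimately show ?thesis using tendsto_unique[OF F(2)] by blast
    qed
    from this[of "at_left (g i)"] this[of "at_right (g i)"] ev show ?thesis
      by (auto simp: at_within_le_at trivial_limit_at_left_real trivial_limit_at_right_real)
  qed
  have step: "\<forall>k<4. \<forall>x. Y (Suc i) k x = Y i k x" if i: "i < N" for i
  proof -
    have l0: "u (g i) = Y i 0 (g i)" using eq0[of "g 0"] eq[of "i - 1" "g i"] i g_less[of "i - 1"] by (cases i) auto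
    have r0: "u (g i) = Y (Suc i) 0 (g i)" using eq[OF i] g_less[OF i] by simp
    have "eventually (\<lambda>x. u x = Y i 0 x) (at_left (g i))"
    proof (cases i)
      case 0
      then show ?thesis using eq0 by (auto simp: eventually_at_filter)
    next
      case (Suc j)
      then have "j < N" "g j < g i" using i g_less by auto
      then show ?thesis using eq[of j] Suc by (auto simp: eventually_at_left intro!: exI[of _ "g j"])
    qed
    then have l1: "deriv u (g i) = Y i 1 (g i)" using du l0 by blast
    have "eventually (\<lambda>x. u x = Y (Suc i) 0 x) (at_right (g i))"
      using eq[OF i] g_less[OF i] by (auto simp: eventually_at_right intro!: exI[of _ "g (Suc i)"])
    then have r1: "deriv u (g i) = Y (Suc i) 1 (g i)" using du r0 by blast
    \<comment> \<open>For \<open>v\<close> with data at \<open>g i\<close> alone, all boundary terms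
      drop out except those of the two adjacent pieces. A value hat then tests \<open>y 3\<close>, a
      slope hat \<open>y 2\<close>.\<close>
    have jump: "qform c u v = momentum_pairing (Y i) v (g i) - momentum_pairing (Y (Suc i)) v (g i)"
      if v: "v \<in> form_dom (g N)" "\<And>j. j \<le> N \<Longrightarrow> j \<noteq> i \<Longrightarrow> v (g j) = 0 \<and> deriv v (g j) = 0" for v
    proof -
      define m where "m j l = momentum_pairing (Y j) v (g l)" for j l
      have m0: "m j l = 0" if "l \<le> N" "l \<noteq> i" for j l using v(2)[OF that] by (simp add: m_def momentum_pairing_def)
      have "qform c u v = m 0 0 + (\<Sum>j<N. m (Suc j) (Suc j) - m (Suc j) j)"
        unfolding m_def by (rule qform_broken[OF Y v(1)])
      also have "\<dots> = m 0 0 + (\<Sum>j<N. m (Suc j) (Suc j)) - (\<Sum>j<N. m (Suc j) j)" by (simp add: sum_subtractf)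
      also have "m 0 0 + (\<Sum>j<N. m (Suc j) (Suc j)) = (\<Sum>j<Suc N. m j j)" by (rule sum.lessThan_Suc_shift[symmetric])
      also have "(\<Sum>j<Suc N. m j j) = (\<Sum>j<Suc N. if j = i then m i i else 0)"
        by (rule sum.cong) (use m0 in auto)
      also have "\<dots> = m i i" using i by simp
      also have "(\<Sum>j<N. m (Suc j) j) = (\<Sum>j<N. if j = i then m (Suc i) i else 0)"
        by (rule sum.cong) (use m0 in auto)
      also have "\<dots> = m (Suc i) i" using i by simp
      finally show ?thesis by (simp add: m_def)
    qed
    have hH: "hA i \<in> form_dom (g N)" "hB i \<in> form_dom (g N)" using h(1,2)[OF i] by (auto simp: broken_def)
    have "Y i 3 (g i) = Y (Suc i) 3 (g i)"
      using jump[OF hH(1)] uz[OF hH(1)] h(3,4)[OF i] i by (simp add: momentum_pairing_def)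
    moreover have "Y i 2 (g i) = Y (Suc i) 2 (g i)"
      using jump[OF hH(2)] uz[OF hH(2)] h(5,6)[OF i] i by (simp add: momentum_pairing_def)
    ultimately have "\<forall>k<4. Y (Suc i) k (g i) = Y i k (g i)"
      unfolding all_less_4 using l0 r0 l1 r1 by simp
    then show ?thesis using sol_unique[OF sY sY, of "Suc i" "g i" i] by blast
  qed
  have same: "j \<le> N \<Longrightarrow> Y j 0 x = Y 0 0 x" for j x
  proof (induction j)
    case (Suc j)
    then show ?case using step[of j] by simp
  qed simp
  have loc: "n \<le> N \<Longrightarrow> x \<le> g n \<Longrightarrow> u x = Y 0 0 x" for n x
  proof (induction n)
    case (Suc n)
    then show ?case using eq[of n x] same[of "Suc n" x] by (cases "x \<le> g n") auto
  qed (use eq0 in auto)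
  show ?thesis by (rule that[OF sY dY]) (use loc in auto)
qed

end

context left_positive_potential
begin

lemma grid_exists:
  obtains g N where "grid_potential c M a \<delta> g N" "g N = s"
proof -
  \<comment> \<open>Ensures that the grid starts in the region of positivity and strictly left of
    \<open>s\<close>.\<close>
  define a0 where "a0 = min a (s - 1)"
  define \<kappa> where "\<kappa> = 8 * (1 + M + \<delta>)"
  have \<kappa>: "\<kappa> \<ge> 8" using M_nonneg \<delta> by (simp add: \<kappa>_def)
  have a0: "a0 \<le> a" "a0 < s" by (auto simp: a0_def)
  \<comment> \<open>Then the step satisfies \<open>h * \<kappa> \<le> 1\<close>, and since this also
    forces \<open>h \<le> 1\<close>, the quadratic smallness follows.\<close>
  obtain N where N: "(s - a0) * \<kappa> < real N" using reals_Archimedean2 by blast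
  have "0 < (s - a0) * \<kappa>" using a0 \<kappa> by simp
  then have N0: "real N > 0" using N by linarith
  define h where "h = (s - a0) / real N"
  have h0: "h > 0" using a0 N0 by (simp add: h_def)
  have h\<kappa>: "h * \<kappa> \<le> 1" using N N0 by (simp add: h_def field_simps)
  have "h * 8 \<le> h * \<kappa>" using h0 \<kappa> by (intro mult_left_mono) auto
  then have "h \<le> 1" using h\<kappa> h0 by linarith
  then have "h * (h * \<kappa>) \<le> 1 * 1" using h\<kappa> h0 \<kappa> by (intro mult_mono) auto
  then have hs: "\<kappa> * h\<^sup>2 \<le> 1" by (simp add: power2_eq_square mult_ac)
  define g where "g j = a0 + real j * h" for j
  have gd: "g (Suc j) - g j = h" for j by (simp add: g_def algebra_simps)
  have "grid_potential c M a \<delta> g N"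
  proof
    show "g j < g (Suc j)" for j using gd[of j] h0 by simp
    show "8 * (1 + M + \<delta>) * (g (Suc j) - g j)\<^sup>2 \<le> 1" for j using hs unfolding gd \<kappa>_def .
    show "g 0 \<le> a" using a0 by (simp add: g_def)
  qed
  moreover have "g N = s" using N0 by (simp add: g_def h_def)
  ultimately show ?thesis by (rule that)
qed

lemma diagonal_form_dom: obtains E K where "diagonal_form (form_dom s) (qform c) l2form E K \<delta>"
proof -
  obtain g N where g: "grid_potential c M a \<delta> g N" "g N = s" using grid_exists .
  interpret grid_potential c M a \<delta> g N by (rule g(1))
  show ?thesis using grid_diagonal_form that g(2) by metis
qed

text \<open>Weak and classical solutions agree: the boundary conditions come from the C^1 extension
  by zero, and conversely the boundary terms of Green's formula telescope when all pieces are the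
  same solution.\<close>

lemma ker_iff:
  "u \<in> form_ker (form_dom s) (qform c) \<longleftrightarrow>
     (\<exists>y. sol c y \<and> decays y \<and> y 0 s = 0 \<and> y 1 s = 0 \<and> (\<forall>x\<le>s. u x = y 0 x) \<and> (\<forall>x>s. u x = 0))"
proof
  assume u: "u \<in> form_ker (form_dom s) (qform c)"
  then have uH: "u \<in> form_dom s" by (simp add: form_ker_def)
  obtain g N where g: "grid_potential c M a \<delta> g N" "g N = s" using grid_exists .
  interpret grid_potential c M a \<delta> g N by (rule g(1))
  obtain y where y: "sol c y" "decays y" "\<And>x. x \<le> s \<Longrightarrow> u x = y 0 x"
    using ker_is_sol u g(2) by metis
  have "y 1 x = deriv u x" if "x < s" for x
    using deriv_cong_open(1)[of "{..<s}" x u "y 0"] y(3) that pc2_sol(2)[OF y(1) cont] by auto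
  then have "eventually (\<lambda>x. deriv u x = y 1 x) (at_left s)" by (auto simp: eventually_at_filter)
  moreover have "(deriv u \<longlongrightarrow> deriv u s) (at_left s)"
    using pc2D(2)[OF form_domD(1)[OF uH], of UNIV] by (auto simp: continuous_on_eq_continuous_at isCont_def filterlim_at_split)
  ultimately have "(y 1 \<longlongrightarrow> deriv u s) (at_left s)" by (blast intro: Lim_transform_eventually)
  moreover have "(y 1 \<longlongrightarrow> y 1 s) (at_left s)"
    using sol_isCont[OF y(1), of 1 s] by (auto simp: isCont_def filterlim_at_split)
  ultimately have "y 1 s = deriv u s" using tendsto_unique trivial_limit_at_left_real by blast
  then show "\<exists>y. sol c y \<and> decays y \<and> y 0 s = 0 \<and> y 1 s = 0 \<and> (\<forall>x\<le>s. u x = y 0 x) \<and> (\<forall>x>s. u x = 0)"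
    using y y(3)[of s] form_domD(6)[OF uH, of s] form_domD(7)[OF uH, of s] form_domD(6)[OF uH]
    by (intro exI[of _ y]) auto
next
  assume "\<exists>y. sol c y \<and> decays y \<and> y 0 s = 0 \<and> y 1 s = 0 \<and> (\<forall>x\<le>s. u x = y 0 x) \<and> (\<forall>x>s. u x = 0)"
  then obtain y where y: "sol c y" "decays y" "y 0 s = 0" "y 1 s = 0" and eq: "\<And>x. x \<le> s \<Longrightarrow> u x = y 0 x"
    and z: "\<And>x. x > s \<Longrightarrow> u x = 0" by blast
  obtain g N where g: "grid_potential c M a \<delta> g N" "g N = s" using grid_exists .
  interpret grid_potential c M a \<delta> g N by (rule g(1))
  note P = pc2_sol[OF y(1) cont]
  have ug: "u = glue s (y 0) (\<lambda>_. 0)" using eq z by (auto simp: glue_def fun_eq_iff)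
  have pu: "pc2 u" unfolding ug by (rule pc2_glue(1)[OF P(1) pc2_zero(1)]) (use y P pc2_zero in auto)
  have uz: "u x = 0" if "s \<le> x" for x using eq z y that by (cases "x = s") auto
  have uH: "u \<in> form_dom s" by (rule form_dom_sol[OF pu y(1,2) eq uz])
  have "broken u (\<lambda>j. y)"
    unfolding broken_def g(2) using uH y
  proof (intro conjI allI impI)
    show "u x = y 0 x" if "x \<le> g 0" for x using eq that g_mono_le[of 0 N] g(2) by simp
    show "u x = y 0 x" if "j < N" "g j \<le> x \<and> x \<le> g (Suc j)" for j x
      using eq that g_mono_le[of "Suc j" N] g(2) by simp
  qed
  \<comment> \<open>After telescoping, only the term at the endpoint remains, where \<open>v\<close>
    is clamped.\<close>
  moreover have "momentum_pairing y v (g 0) + (\<Sum>j<n. momentum_pairing y v (g (Suc j)) - momentum_pairing y v (g j)) = momentum_pairing y v (g n)" for v n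
    by (induction n) auto
  ultimately have "qform c u v = momentum_pairing y v s" if "v \<in> form_dom s" for v
    using qform_broken[of u "\<lambda>j. y" v] that g(2) by simp
  moreover have "momentum_pairing y v s = 0" if "v \<in> form_dom s" for v
    using form_domD(6,7)[OF that] by (simp add: momentum_pairing_def)
  ultimately show "u \<in> form_ker (form_dom s) (qform c)" using uH by (simp add: form_ker_def)
qed

end

section \<open>Index, spectral parameter and endpoint\<close>

lemma morse_index_zero_if_nonneg:
  assumes "form_space H Q" "\<And>u. u \<in> H \<Longrightarrow> 0 \<le> Q u u"
  shows "morse_index H Q = 0"
proof -
  interpret form_space H Q by fact
  have "A = {}" if A: "neg_family H Q A" for A
  proof (rule ccontr)
    assume "A \<noteq> {}"
    then obtain e where e: "e \<in> A" by blast
    have "e \<noteq> 0" using A e dependent_zero[of A] by (auto simp: neg_family_def)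
    then have "Q e e < 0" using A e span_base[of e A] by (auto simp: neg_family_def)
    moreover have "e \<in> H" using A e by (auto simp: neg_family_def)
    ultimately show False using assms(2)[of e] by simp
  qed
  moreover have "neg_family H Q {}" by (auto simp: neg_family_def independent_empty)
  ultimately have "{A. neg_family H Q A} = {{}}" by blast
  then show ?thesis by (simp add: morse_index_def)
qed

locale pulse_potential =
  fixes W :: "real \<Rightarrow> real" and w\<^sub>0 :: real
  assumes W_cont: "continuous_on UNIV W"
    and W_bot: "(W \<longlongrightarrow> w\<^sub>0) at_bot" and W_top: "(W \<longlongrightarrow> w\<^sub>0) at_top" and w0_pos: "w\<^sub>0 > 0"
begin

lemma W_near_limit:
  assumes "e > 0"
  obtains R where "R > 0" "\<And>x. \<bar>x\<bar> \<ge> R \<Longrightarrow> \<bar>W x - w\<^sub>0\<bar> < e"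
proof -
  obtain A where A: "\<And>x. x \<le> A \<Longrightarrow> \<bar>W x - w\<^sub>0\<bar> < e"
    using tendstoD[OF W_bot assms] by (auto simp: eventually_at_bot_linorder dist_real_def)
  obtain B where B: "\<And>x. B \<le> x \<Longrightarrow> \<bar>W x - w\<^sub>0\<bar> < e"
    using tendstoD[OF W_top assms] by (auto simp: eventually_at_top_linorder dist_real_def)
  show ?thesis
  proof (rule that[of "\<bar>A\<bar> + \<bar>B\<bar> + 1"])
    fix x :: real assume "\<bar>A\<bar> + \<bar>B\<bar> + 1 \<le> \<bar>x\<bar>"
    then have "x \<le> A \<or> B \<le> x" by linarith
    then show "\<bar>W x - w\<^sub>0\<bar> < e" using A B by blast
  qed simp
qed

lemma W_bounded: obtains M where "\<And>x. \<bar>W x\<bar> \<le> M"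
proof -
  obtain R where R: "R > 0" "\<And>x. \<bar>x\<bar> \<ge> R \<Longrightarrow> \<bar>W x - w\<^sub>0\<bar> < 1" using W_near_limit[of 1] by auto
  have "compact (W ` {-R..R})" by (intro compact_continuous_image continuous_on_subset[OF W_cont]) auto
  then have "bounded (W ` {-R..R})" by (rule compact_imp_bounded)
  then obtain B where "\<forall>y\<in>W ` {-R..R}. norm y \<le> B" unfolding bounded_iff by blast
  then have B: "\<bar>W x\<bar> \<le> B" if "x \<in> {-R..R}" for x using that by simp
  show ?thesis
  proof (rule that[of "\<bar>B\<bar> + \<bar>w\<^sub>0\<bar> + 1"])
    fix x
    show "\<bar>W x\<bar> \<le> \<bar>B\<bar> + \<bar>w\<^sub>0\<bar> + 1"
    proof (cases "\<bar>x\<bar> \<ge> R")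
      case True
      then show ?thesis using R(2)[of x] by linarith
    next
      case False
      then show ?thesis using B[of x] by force
    qed
  qed
qed

lemma W_uniform:
  assumes e: "e > 0"
  obtains h where "h > 0" "\<And>x y. \<bar>x - y\<bar> < h \<Longrightarrow> \<bar>W x - W y\<bar> \<le> e"
proof -
  obtain R where R: "R > 0" "\<And>x. \<bar>x\<bar> \<ge> R \<Longrightarrow> \<bar>W x - w\<^sub>0\<bar> < e / 2" using W_near_limit[of "e / 2"] e by auto
  have "uniformly_continuous_on {-(R + 1)..R + 1} W"
    by (intro compact_uniformly_continuous continuous_on_subset[OF W_cont]) auto
  then obtain h where h: "h > 0" "\<And>x y. x \<in> {-(R + 1)..R + 1} \<Longrightarrow> y \<in> {-(R + 1)..R + 1} \<Longrightarrow> \<bar>x - y\<bar> < h \<Longrightarrow> \<bar>W x - W y\<bar> < e"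
    using e unfolding uniformly_continuous_on_def dist_real_def by metis
  show ?thesis
  \<comment> \<open>With distance below 1, two points lie both in the compact interval or both
    beyond \<open>R\<close>, where W is within \<open>e / 2\<close> of its limit.\<close>
  proof (rule that[of "min h 1"])
    fix x y :: real assume xy: "\<bar>x - y\<bar> < min h 1"
    show "\<bar>W x - W y\<bar> \<le> e"
    proof (cases "\<bar>x\<bar> \<le> R + 1 \<and> \<bar>y\<bar> \<le> R + 1")
      case True
      then have "x \<in> {-(R + 1)..R + 1}" "y \<in> {-(R + 1)..R + 1}" by auto
      then show ?thesis using h(2) xy by (simp add: less_imp_le)
    next
      case False
      then have "\<bar>x\<bar> \<ge> R" "\<bar>y\<bar> \<ge> R" using xy by linarith+
      then show ?thesis using R(2)[of x] R(2)[of y] by linarith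
    qed
  qed (use h in simp)
qed

definition bound :: real where "bound = (SOME M. \<forall>x. \<bar>W x\<bar> \<le> M)"

lemma bound: "\<bar>W x\<bar> \<le> bound"
proof -
  have "\<exists>M. \<forall>x. \<bar>W x\<bar> \<le> M" using W_bounded by metis
  then show ?thesis unfolding bound_def by (rule someI2_ex) blast
qed

text \<open>Chosen once, independently of the spectral parameter: adding a nonnegative constant to W
  only improves the lower bound.\<close>

definition left_end :: real where "left_end = (SOME a. \<forall>x\<le>a. w\<^sub>0 / 2 \<le> W x)"

lemma left_end: "x \<le> left_end \<Longrightarrow> w\<^sub>0 / 2 \<le> W x"
proof -
  obtain R where R: "R > 0" "\<And>x. \<bar>x\<bar> \<ge> R \<Longrightarrow> \<bar>W x - w\<^sub>0\<bar> < w\<^sub>0 / 2" using W_near_limit[of "w\<^sub>0 / 2"] w0_pos by auto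
  have "w\<^sub>0 / 2 \<le> W x" if "x \<le> - R" for x
  proof -
    have "\<bar>W x - w\<^sub>0\<bar> < w\<^sub>0 / 2" using R(2)[of x] that R(1) by simp
    then show ?thesis by linarith
  qed
  then have "\<exists>a. \<forall>x\<le>a. w\<^sub>0 / 2 \<le> W x" by blast
  then have "\<forall>x\<le>left_end. w\<^sub>0 / 2 \<le> W x" unfolding left_end_def by (rule someI_ex)
  then show "x \<le> left_end \<Longrightarrow> w\<^sub>0 / 2 \<le> W x" by blast
qed

definition pot :: "real \<Rightarrow> real \<Rightarrow> real" where "pot \<eta> x = W x + \<eta>"

lemma pot: "0 \<le> \<eta> \<Longrightarrow> left_positive_potential (pot \<eta>) (bound + \<eta>) left_end (w\<^sub>0 / 2)"
proof
  assume l: "0 \<le> \<eta>"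
  show "continuous_on UNIV (pot \<eta>)" unfolding pot_def[abs_def] by (intro continuous_intros W_cont)
  show "\<bar>pot \<eta> x\<bar> \<le> bound + \<eta>" for x using bound[of x] l unfolding pot_def by linarith
  show "w\<^sub>0 / 2 \<le> pot \<eta> x" if "x \<le> left_end" for x using left_end[OF that] l by (simp add: pot_def)
qed (use w0_pos in simp)

abbreviation "Qf \<eta> \<equiv> qform (pot \<eta>)"
definition "index_at s \<eta> = morse_index (form_dom s) (Qf \<eta>)"
definition "nullity s \<eta> = dim (form_ker (form_dom s) (Qf \<eta>))"

lemma diagonal: 
  assumes "0 \<le> \<eta>"
  obtains E K where "diagonal_form (form_dom s) (Qf \<eta>) l2form E K (w\<^sub>0 / 2)"
  using left_positive_potential.diagonal_form_dom[OF pot[OF assms]] by blast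

lemma Qf_form_space: "0 \<le> \<eta> \<Longrightarrow> form_space (form_dom s) (Qf \<eta>)"
  using bounded_potential.form_space_qform[OF left_positive_potential.axioms(1)[OF pot]] .

lemma Qf_change:
  assumes "0 \<le> \<eta>" "u \<in> form_dom s"
  shows "Qf \<eta>' u u = Qf \<eta> u u + (\<eta>' - \<eta>) * l2form u u"
proof -
  have "pot \<eta>' = (\<lambda>x. pot \<eta> x + (\<eta>' - \<eta>))" by (simp add: pot_def fun_eq_iff)
  then show ?thesis
    using bounded_potential.qform_add_const[OF left_positive_potential.axioms(1)[OF pot[OF assms(1)]] assms(2), of "\<eta>' - \<eta>"] by simp
qed

lemma l2_nonneg: "0 \<le> l2form u u"
  by (simp add: l2form_def)

lemma index_ge: "0 \<le> \<eta> \<Longrightarrow> neg_family (form_dom s) (Qf \<eta>) A \<Longrightarrow> card A \<le> index_at s \<eta>"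
  unfolding index_at_def using diagonal_form.morse_index_ge diagonal by metis

lemma index_attained:
  assumes "0 \<le> \<eta>"
  obtains A where "neg_family (form_dom s) (Qf \<eta>) A" "card A = index_at s \<eta>"
proof -
  obtain E K where "diagonal_form (form_dom s) (Qf \<eta>) l2form E K (w\<^sub>0 / 2)" using diagonal[OF assms] by blast
  then interpret diagonal_form "form_dom s" "Qf \<eta>" l2form E K "w\<^sub>0 / 2" .
  show ?thesis using that neg_family_Eneg morse_index_eq by (simp add: index_at_def)
qed

text \<open>A larger domain and a smaller form keep every negative family negative.\<close>

lemma index_mono:
  assumes "s \<le> t" "0 \<le> \<eta>'" "\<eta>' \<le> \<eta>"
  shows "index_at s \<eta> \<le> index_at t \<eta>'"
proof -
  have l: "0 \<le> \<eta>" using assms by simp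
  obtain A where A: "neg_family (form_dom s) (Qf \<eta>) A" "card A = index_at s \<eta>" using index_attained[OF l] .
  have "neg_family (form_dom t) (Qf \<eta>') A"
  proof -
    obtain E K where "diagonal_form (form_dom s) (Qf \<eta>) l2form E K (w\<^sub>0 / 2)" using diagonal[OF l] by blast
    then interpret diagonal_form "form_dom s" "Qf \<eta>" l2form E K "w\<^sub>0 / 2" .
    show ?thesis
    proof (rule neg_family_mono[OF A(1) form_dom_mono[OF assms(1)]])
      fix u assume "u \<in> form_dom s"
      then have "Qf \<eta>' u u = Qf \<eta> u u + (\<eta>' - \<eta>) * l2form u u" by (rule Qf_change[OF l])
      moreover have "(\<eta>' - \<eta>) * l2form u u \<le> 0" using assms(3) l2_nonneg by (intro mult_nonpos_nonneg) auto
      ultimately show "Qf \<eta>' u u \<le> Qf \<eta> u u" by simp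
    qed
  qed
  then show ?thesis using index_ge[OF assms(2)] A(2) by metis
qed

lemma index_zero_far_left:
  assumes "s \<le> left_end"
  shows "index_at s 0 = 0"
  unfolding index_at_def
proof (rule morse_index_zero_if_nonneg[OF Qf_form_space])
  fix u assume u: "u \<in> form_dom s"
  show "0 \<le> Qf 0 u u" unfolding qform_def
  proof (rule integral_nonneg_AE, rule AE_I2)
    fix x
    have "0 \<le> pot 0 x * (u x * u x)"
    proof (cases "x \<le> s")
      case True
      then have "0 \<le> pot 0 x" using left_end[of x] assms w0_pos by (simp add: pot_def)
      then show ?thesis by simp
    qed (use form_domD(6)[OF u] in simp)
    then show "0 \<le> (deriv2 u x + u x) * (deriv2 u x + u x) + pot 0 x * u x * u x" by (simp add: mult.assoc)
  qed
qed simp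

lemma index_zero_large:
  assumes "bound \<le> \<eta>"
  shows "index_at s \<eta> = 0"
  unfolding index_at_def
proof (rule morse_index_zero_if_nonneg[OF Qf_form_space])
  show "0 \<le> \<eta>" using bound[of 0] assms by linarith
  fix u
  show "0 \<le> Qf \<eta> u u" unfolding qform_def
  proof (rule integral_nonneg_AE, rule AE_I2)
    fix x
    have "0 \<le> pot \<eta> x" using bound[of x] assms unfolding pot_def by linarith
    then have "0 \<le> pot \<eta> x * (u x * u x)" by simp
    then show "0 \<le> (deriv2 u x + u x) * (deriv2 u x + u x) + pot \<eta> x * u x * u x" by (simp add: mult.assoc)
  qed
qed

section \<open>The index as a count in each of the two parameters\<close>

lemma count_in_spectral_parameter:
  "finite {\<eta>. 0 < \<eta> \<and> nullity s \<eta> \<noteq> 0} \<and> (\<Sum>\<eta>\<in>{\<eta>. 0 < \<eta> \<and> nullity s \<eta> \<noteq> 0}. nullity s \<eta>) = index_at s 0"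
proof -
  \<comment> \<open>With \<open>p = - \<eta>\<close> the index is nondecreasing in the parameter,
    the positive spectral parameters become \<open>p < 0\<close>, and the index is 0 up to
    \<open>- bound\<close>.\<close>
  let ?f = "\<lambda>p. index_at s (- p)" and ?\<nu> = "\<lambda>p. nullity s (- p)"
  have "finite {p. p < 0 \<and> ?\<nu> p \<noteq> 0} \<and> (\<Sum>p\<in>{p. p < 0 \<and> ?\<nu> p \<noteq> 0}. ?\<nu> p) = ?f 0"
  proof (rule count_by_jumps[of "- bound" 0])
    show "- bound \<le> 0" using bound[of 0] by linarith
    show "?f p = 0" if "p \<le> - bound" for p using that by (intro index_zero_large) simp
  next
    fix p :: real assume p: "p \<le> 0"
    then have l: "0 \<le> - p" by simp
    obtain E K where "diagonal_form (form_dom s) (Qf (- p)) l2form E K (w\<^sub>0 / 2)" using diagonal[OF l] by blast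
    then interpret D: diagonal_form "form_dom s" "Qf (- p)" l2form E K "w\<^sub>0 / 2" .
    obtain \<epsilon> where \<epsilon>: "\<epsilon> > 0" and ex: "\<forall>H' Q' (T :: (real \<Rightarrow> real) \<Rightarrow> real \<Rightarrow> real). linear T \<longrightarrow> inj T \<longrightarrow> T ` form_dom s \<subseteq> H' \<longrightarrow>
       (\<forall>u\<in>form_dom s. Q' (T u) (T u) \<le> Qf (- p) u u + \<epsilon> * l2form u u) \<longrightarrow>
       (\<exists>A. neg_family H' Q' A \<and> card A = morse_index (form_dom s) (Qf (- p)))"
      using D.neg_family_perturbed by (elim exE conjE) (rule that)
    have "?f t = ?f p" if t: "p - \<epsilon> < t" "t \<le> p" for t
    proof (rule antisym)
      show "?f t \<le> ?f p" by (rule index_mono) (use t l in auto)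
      have "\<exists>A. neg_family (form_dom s) (Qf (- t)) A \<and> card A = index_at s (- p)"
        unfolding index_at_def
      proof (rule ex[rule_format, of "\<lambda>u. u"])
        show "Qf (- t) u u \<le> Qf (- p) u u + \<epsilon> * l2form u u" if u: "u \<in> form_dom s" for u
        proof -
          have "(- t - - p) * l2form u u \<le> \<epsilon> * l2form u u" using t l2_nonneg by (intro mult_right_mono) auto
          then show ?thesis using Qf_change[OF l u, of "- t"] by simp
        qed
      qed (auto simp: linear_id[unfolded id_def])
      then show "?f p \<le> ?f t" using index_ge[of "- t"] t l by fastforce
    qed
    then show "\<exists>\<epsilon>>0. \<forall>t. p - \<epsilon> < t \<and> t \<le> p \<longrightarrow> ?f t = ?f p" using \<epsilon> by blast
  next
    fix p :: real assume p: "p < 0"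
    then have l: "0 \<le> - p" by simp
    obtain E K where D: "diagonal_form (form_dom s) (Qf (- p)) l2form E K (w\<^sub>0 / 2)" using diagonal[OF l] by blast
    then interpret D: diagonal_form "form_dom s" "Qf (- p)" l2form E K "w\<^sub>0 / 2" .
    obtain \<epsilon> where \<epsilon>: "\<epsilon> > 0" and up: "\<forall>H' Q' (T :: (real \<Rightarrow> real) \<Rightarrow> real \<Rightarrow> real) A. linear T \<longrightarrow> inj T \<longrightarrow> T ` H' \<subseteq> form_dom s \<longrightarrow> form_space H' Q' \<longrightarrow>
       (\<forall>u\<in>H'. Qf (- p) (T u) (T u) - \<epsilon> * l2form (T u) (T u) \<le> Q' u u) \<longrightarrow> neg_family H' Q' A \<longrightarrow>
       card A \<le> morse_index (form_dom s) (Qf (- p)) + dim (form_ker (form_dom s) (Qf (- p)))"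
      using D.card_le_index_plus_nullity by (elim exE conjE) (rule that)
    have "?f t = ?f p + ?\<nu> p" if t: "p < t" "t < p + \<epsilon>" "t \<le> 0" for t
    proof (rule antisym)
      have lt: "0 \<le> - t" using t by simp
      obtain A where A: "neg_family (form_dom s) (Qf (- t)) A" "card A = index_at s (- t)" using index_attained[OF lt] .
      have "card A \<le> index_at s (- p) + nullity s (- p)"
        unfolding index_at_def nullity_def
      proof (rule up[rule_format, OF _ _ _ Qf_form_space[OF lt] _ A(1), of "\<lambda>u. u"])
        show "Qf (- p) u u - \<epsilon> * l2form u u \<le> Qf (- t) u u" if u: "u \<in> form_dom s" for u
        proof -
          have "- \<epsilon> * l2form u u \<le> (- t - - p) * l2form u u" using t l2_nonneg by (intro mult_right_mono) auto
          then show ?thesis using Qf_change[OF l u, of "- t"] by simp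
        qed
      qed (auto simp: linear_id[unfolded id_def])
      then show "?f t \<le> ?f p + ?\<nu> p" using A(2) by simp
      obtain E' K' where D': "diagonal_form (form_dom s) (Qf (- t)) l2form E' K' (w\<^sub>0 / 2)" using diagonal[OF lt] by blast
      \<comment> \<open>The strict decrease, through positivity of the L^2 form, supplies the kernel
        hypothesis of \<open>index_increases\<close>: in a kernel of \<open>Qf (- t)\<close> that
        form vanishes, so \<open>Qf (- p)\<close> would be positive.\<close>
      have less: "Qf (- t) u u < Qf (- p) u u" if u: "u \<in> form_dom s" "u \<noteq> 0" for u
      proof -
        have "(t - p) * l2form u u > 0" using t l2form_pos[OF u] by simp
        then show ?thesis using Qf_change[OF l u(1), of "- t"] by (simp add: algebra_simps)
      qed
      show "?f p + ?\<nu> p \<le> ?f t"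
        unfolding index_at_def nullity_def
      proof (rule D.index_increases[OF D' order_refl])
        fix u assume u: "u \<in> form_dom s"
        show "Qf (- t) u u \<le> Qf (- p) u u" using less[OF u] form_space.zero_l[OF Qf_form_space, of _ 0] u l lt by (cases "u = 0") auto
        assume "Qf (- p) u u \<le> 0" "u \<in> form_ker (form_dom s) (Qf (- t))"
        then show "u = 0" using less[OF u] u by (force simp: form_ker_def)
      qed
    qed
    then show "\<exists>\<epsilon>>0. \<forall>t. p < t \<and> t < p + \<epsilon> \<and> t \<le> 0 \<longrightarrow> ?f t = ?f p + ?\<nu> p" using \<epsilon> by blast
  qed
  moreover have im: "{\<eta>. 0 < \<eta> \<and> nullity s \<eta> \<noteq> 0} = uminus ` {p. p < 0 \<and> ?\<nu> p \<noteq> 0}"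
  proof -
    have "\<eta> \<in> uminus ` {p. p < 0 \<and> ?\<nu> p \<noteq> 0}" if "0 < \<eta>" "nullity s \<eta> \<noteq> 0" for \<eta>
      by (rule image_eqI[of _ _ "- \<eta>"]) (use that in auto)
    then show ?thesis by auto
  qed
  ultimately show ?thesis unfolding im by (simp add: sum.reindex)
qed

text \<open>Translation by \<open>p - t\<close> carries the domain for \<open>p\<close> onto that
  for \<open>t\<close>, and uniform continuity of W makes the resulting error smaller than either
  gap. For the jump the inclusion of domains is used instead, with the same form on both.\<close>

lemma count_in_endpoint:
  "finite {x. x < L \<and> nullity x 0 \<noteq> 0} \<and> (\<Sum>x\<in>{x. x < L \<and> nullity x 0 \<noteq> 0}. nullity x 0) = index_at L 0"
proof (rule count_by_jumps[of "min left_end L" L "\<lambda>x. index_at x 0" "\<lambda>x. nullity x 0"])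
  interpret c: left_positive_potential "pot 0" "bound + 0" left_end "w\<^sub>0 / 2" by (rule pot) simp
  show "min left_end L \<le> L" by simp
  show "index_at p 0 = 0" if "p \<le> min left_end L" for p using that by (intro index_zero_far_left) simp
  fix p :: real
  obtain E K where D: "diagonal_form (form_dom p) (Qf 0) l2form E K (w\<^sub>0 / 2)" using diagonal[of 0] by auto
  then interpret D: diagonal_form "form_dom p" "Qf 0" l2form E K "w\<^sub>0 / 2" .
  have near: "\<bar>Qf 0 (shift \<tau> u) (shift \<tau> u) - Qf 0 u u\<bar> \<le> \<epsilon> * l2form u u"
    if "u \<in> form_dom t" "\<bar>\<tau>\<bar> < h" "\<And>x y. \<bar>x - y\<bar> < h \<Longrightarrow> \<bar>W x - W y\<bar> \<le> \<epsilon>" for \<tau> u t h \<epsilon>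
    by (rule c.qform_shift[OF that(1)]) (use that in \<open>auto simp: pot_def\<close>)
  show "\<exists>\<epsilon>>0. \<forall>t. p - \<epsilon> < t \<and> t \<le> p \<longrightarrow> index_at t 0 = index_at p 0"
  proof -
    obtain \<epsilon> where \<epsilon>: "\<epsilon> > 0" and ex: "\<forall>H' Q' (T :: (real \<Rightarrow> real) \<Rightarrow> real \<Rightarrow> real). linear T \<longrightarrow> inj T \<longrightarrow> T ` form_dom p \<subseteq> H' \<longrightarrow>
       (\<forall>u\<in>form_dom p. Q' (T u) (T u) \<le> Qf 0 u u + \<epsilon> * l2form u u) \<longrightarrow>
       (\<exists>A. neg_family H' Q' A \<and> card A = morse_index (form_dom p) (Qf 0))"
      using D.neg_family_perturbed by (elim exE conjE) (rule that)
    obtain h where h: "h > 0" "\<And>x y. \<bar>x - y\<bar> < h \<Longrightarrow> \<bar>W x - W y\<bar> \<le> \<epsilon>" using W_uniform[OF \<epsilon>] by blast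
    have "index_at t 0 = index_at p 0" if t: "p - h < t" "t \<le> p" for t
    proof (rule antisym)
      show "index_at t 0 \<le> index_at p 0" by (rule index_mono) (use t in auto)
      have "\<exists>A. neg_family (form_dom t) (Qf 0) A \<and> card A = index_at p 0"
        unfolding index_at_def
      proof (rule ex[rule_format, OF linear_shift inj_shift, of "p - t"])
        show "shift (p - t) ` form_dom p \<subseteq> form_dom t" using shift_form_dom[of _ p "p - t"] by auto
        show "Qf 0 (shift (p - t) u) (shift (p - t) u) \<le> Qf 0 u u + \<epsilon> * l2form u u" if u: "u \<in> form_dom p" for u
        proof -
          from u have "\<bar>Qf 0 (shift (p - t) u) (shift (p - t) u) - Qf 0 u u\<bar> \<le> \<epsilon> * l2form u u"
            using t h by (intro near[of u p "p - t" h]) auto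
          then show ?thesis by linarith
        qed
      qed
      then show "index_at p 0 \<le> index_at t 0" using index_ge[of 0 t] by fastforce
    qed
    then show ?thesis using h(1) by blast
  qed
  show "\<exists>\<epsilon>>0. \<forall>t. p < t \<and> t < p + \<epsilon> \<and> t \<le> L \<longrightarrow> index_at t 0 = index_at p 0 + nullity p 0"
  proof -
    obtain \<epsilon> where \<epsilon>: "\<epsilon> > 0" and up: "\<forall>H' Q' (T :: (real \<Rightarrow> real) \<Rightarrow> real \<Rightarrow> real) A. linear T \<longrightarrow> inj T \<longrightarrow> T ` H' \<subseteq> form_dom p \<longrightarrow> form_space H' Q' \<longrightarrow>
       (\<forall>u\<in>H'. Qf 0 (T u) (T u) - \<epsilon> * l2form (T u) (T u) \<le> Q' u u) \<longrightarrow> neg_family H' Q' A \<longrightarrow>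
       card A \<le> morse_index (form_dom p) (Qf 0) + dim (form_ker (form_dom p) (Qf 0))"
      using D.card_le_index_plus_nullity by (elim exE conjE) (rule that)
    obtain h where h: "h > 0" "\<And>x y. \<bar>x - y\<bar> < h \<Longrightarrow> \<bar>W x - W y\<bar> \<le> \<epsilon>" using W_uniform[OF \<epsilon>] by blast
    have "index_at t 0 = index_at p 0 + nullity p 0" if t: "p < t" "t < p + h" for t
    proof (rule antisym)
      obtain A where A: "neg_family (form_dom t) (Qf 0) A" "card A = index_at t 0" using index_attained[of 0 t] by auto
      have "card A \<le> index_at p 0 + nullity p 0"
        unfolding index_at_def nullity_def
      proof (rule up[rule_format, OF linear_shift inj_shift _ Qf_form_space[OF order_refl] _ A(1), of "t - p"])
        show "shift (t - p) ` form_dom t \<subseteq> form_dom p" using shift_form_dom[of _ t "t - p"] by auto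
        show "Qf 0 (shift (t - p) u) (shift (t - p) u) - \<epsilon> * l2form (shift (t - p) u) (shift (t - p) u) \<le> Qf 0 u u" if u: "u \<in> form_dom t" for u
        proof -
          from u have "\<bar>Qf 0 (shift (t - p) u) (shift (t - p) u) - Qf 0 u u\<bar> \<le> \<epsilon> * l2form u u"
            using t h by (intro near[of u t "t - p" h]) auto
          then show ?thesis
            unfolding l2form_shift by linarith
        qed
      qed
      then show "index_at t 0 \<le> index_at p 0 + nullity p 0" using A(2) by simp
      obtain E' K' where D': "diagonal_form (form_dom t) (Qf 0) l2form E' K' (w\<^sub>0 / 2)" using diagonal[of 0] by auto
      show "index_at p 0 + nullity p 0 \<le> index_at t 0"
        unfolding index_at_def nullity_def
      proof (rule D.index_increases[OF D' form_dom_mono order_refl])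
        fix u assume u: "u \<in> form_dom p" and k: "u \<in> form_ker (form_dom t) (Qf 0)"
        obtain y where y: "sol (pot 0) y" "\<forall>x\<le>t. u x = y 0 x" "\<forall>x>t. u x = 0" using c.ker_iff k by blast
        have "y 0 x = 0" if "p < x" "x < t" for x using y(2) form_domD(6)[OF u, of x] that by simp
        then have y0: "y 0 x = 0" for x using c.sol_zero_on_interval[OF y(1) _ t(1), of 0 x] by simp
        have "u x = 0" for x using y(2,3) y0[of x] by (cases "x \<le> t") auto
        then show "u = 0" by (simp add: fun_eq_iff)
      qed (use t in simp)
    qed
    then show ?thesis using h(1) by blast
  qed
qed

end

section \<open>Eigenspaces and conjugate points\<close>

lemma dim_image_linear:
  fixes T :: "'a::euclidean_space \<Rightarrow> 'b::real_vector"
  assumes "linear T" "inj T" "subspace V"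
  shows "dim (T ` V) = dim V"
proof -
  obtain B where B: "B \<subseteq> V" "independent B" "V \<subseteq> span B" "card B = dim V" using basis_exists[of V] by blast
  have spB: "span B = V" using B assms(3) by (simp add: span_minimal subset_antisym)
  have "inj_on T (span B)" using assms(2) by (rule inj_on_subset) simp
  then have "independent (T ` B)" using linear_independent_injective_image[OF assms(1) B(2)] by blast
  then have "dim (span (T ` B)) = card (T ` B)" by (rule dim_span_eq_card_independent)
  moreover have "span (T ` B) = T ` V" using linear_span_image[OF assms(1)] spB by simp
  moreover have "card (T ` B) = card B" by (rule card_image) (use assms(2) inj_on_subset in blast)
  ultimately show ?thesis using B(4) by simp
qed

text \<open>\<open>sq_integrable_on\<close> uses the gauge integral; for a nonnegative function this
  already gives Lebesgue integrability.\<close>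

lemma set_integrable_of_integrable_on_square:
  fixes f :: "real \<Rightarrow> real"
  assumes "continuous_on UNIV f" "(\<lambda>x. (f x)\<^sup>2) integrable_on {..s}"
  shows "set_integrable lborel {..s} (\<lambda>x. (f x)\<^sup>2)"
proof -
  have "(\<lambda>x. (f x)\<^sup>2) absolutely_integrable_on {..s}"
    by (rule nonnegative_absolutely_integrable_1[OF assms(2)]) simp
  moreover have "f \<in> borel_measurable borel" by (rule borel_measurable_continuous_onI[OF assms(1)])
  then have "(\<lambda>x. indicat_real {..s} x *\<^sub>R (f x)\<^sup>2) \<in> borel_measurable lborel" by measurable
  ultimately show ?thesis unfolding set_integrable_def by (simp add: integrable_completion)
qed

lemma sq_integrable_onI:
  fixes f g :: "real \<Rightarrow> real"
  assumes "continuous_on UNIV f" "set_integrable lborel {..s} (\<lambda>x. (f x)\<^sup>2)" "\<And>x. x \<le> s \<Longrightarrow> g x = f x"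
  shows "sq_integrable_on g {..s}"
  unfolding sq_integrable_on_def
proof
  have "f \<in> borel_measurable (lebesgue_on {..s})"
    using borel_measurable_continuous_onI[OF assms(1)] by (intro measurable_restrict_space1 measurable_completion) simp
  moreover have "g \<in> borel_measurable (lebesgue_on {..s}) \<longleftrightarrow> f \<in> borel_measurable (lebesgue_on {..s})"
    by (rule measurable_cong) (use assms(3) in simp)
  ultimately show "g \<in> borel_measurable (lebesgue_on {..s})" by simp
  have "(\<lambda>x. (f x)\<^sup>2) integrable_on {..s}" using set_borel_integral_eq_integral(1)[OF assms(2)] .
  then show "(\<lambda>x. (g x)\<^sup>2) integrable_on {..s}" by (rule integrable_eq) (use assms(3) in simp)
qed

lemma integral_representation:
  fixes f f' :: "real \<Rightarrow> real"
  assumes "x \<le> s" "\<And>t. (f has_real_derivative f' t) (at t)"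
  shows "f' integrable_on {x..s}" "f x = f s - integral {x..s} f'"
proof -
  have "(f' has_integral f s - f x) {x..s}"
    using assms by (intro fundamental_theorem_of_calculus)
      (auto intro: has_field_derivative_at_within simp: has_real_derivative_iff_has_vector_derivative[symmetric])
  then show "f' integrable_on {x..s}" "f x = f s - integral {x..s} f'" by (auto simp: integral_unique)
qed

text \<open>Upgrades the integral form of a weak derivative to a classical derivative once the
  integrand is continuous.\<close>

lemma derivative_of_integral_representation:
  fixes f h :: "real \<Rightarrow> real"
  assumes rep: "\<And>x. x \<le> s \<Longrightarrow> f x = f s - integral {x..s} h"
    and h: "continuous_on {a..s} h" and x: "a < x" "x < s"
  shows "(f has_real_derivative h x) (at x)"
proof -
  have "((\<lambda>x. integral {x..s} h) has_real_derivative - h x) (at x within {a..s})"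
    by (rule integral_has_real_derivative'[OF h]) (use x in auto)
  then have "((\<lambda>x. integral {x..s} h) has_real_derivative - h x) (at x)"
    unfolding at_within_Icc_at[OF x] .
  then have "((\<lambda>x. f s - integral {x..s} h) has_real_derivative h x) (at x)"
    using DERIV_diff[OF DERIV_const, of "\<lambda>x. integral {x..s} h" "- h x" x UNIV "f s"] by simp
  moreover have "eventually (\<lambda>y. f y = f s - integral {y..s} h) (nhds x)"
    using eventually_nhds_in_open[of "{..<s}" x] x by (auto elim!: eventually_mono intro: rep)
  then have "(f has_real_derivative h x) (at x) \<longleftrightarrow> ((\<lambda>x. f s - integral {x..s} h) has_real_derivative h x) (at x)"
    by (intro DERIV_cong_ev refl)
  ultimately show ?thesis by blast
qed

section \<open>The stationary pulse\<close>

locale pulse = 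
  fixes \<nu> \<mu> :: real and \<phi> :: "real \<Rightarrow> real"
  assumes \<phi>: "H1 \<nu> \<mu> \<phi>" and neg: "H2 \<nu> \<mu>"
begin

lemma \<phi>_continuous: "continuous_on UNIV \<phi>"
proof -
  obtain D where "smooth_with_derivs \<phi> D" using \<phi> by (auto simp: H1_def)
  then have "(\<phi> has_real_derivative D 1 x) (at x)" for x by (auto simp: smooth_with_derivs_def)
  then show ?thesis using DERIV_isCont by (blast intro: continuous_at_imp_continuous_on)
qed

definition W :: "real \<Rightarrow> real" where "W x = - fnl' \<nu> \<mu> (\<phi> x)"

sublocale pulse_potential W "- fnl' \<nu> \<mu> 0"
proof
  show "continuous_on UNIV W" unfolding W_def fnl'_def by (intro continuous_intros \<phi>_continuous)
  have "(W \<longlongrightarrow> - fnl' \<nu> \<mu> 0) F" if "(\<phi> \<longlongrightarrow> 0) F" for F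
    unfolding W_def fnl'_def by (intro tendsto_intros that)
  then show "(W \<longlongrightarrow> - fnl' \<nu> \<mu> 0) at_bot" "(W \<longlongrightarrow> - fnl' \<nu> \<mu> 0) at_top" using \<phi> by (auto simp: H1_def)
  show "- fnl' \<nu> \<mu> 0 > 0" using neg by (simp add: H2_def)
qed

text \<open>A decaying solution yields all four derivatives explicitly. Conversely, the equation
  makes the fourth weak derivative continuous up to a null set, so an eigenfunction is classical and
  coincides with the solution having the same Cauchy data at \<open>s\<close>; square integrability
  of u and u'' then gives decay.\<close>

lemma eigenspace_eq_ker:
  assumes l: "0 \<le> lam"
  shows "eigenspace_L \<nu> \<mu> \<phi> s lam = form_ker (form_dom s) (Qf lam)"
proof -
  interpret c: left_positive_potential "pot lam" "bound + lam" left_end "(- fnl' \<nu> \<mu> 0) / 2" by (rule pot[OF l])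
  have pot_eq: "pot lam x = lam - fnl' \<nu> \<mu> (\<phi> x)" for x by (simp add: pot_def W_def)
  show ?thesis
  proof (intro set_eqI iffI)
    fix u assume "u \<in> form_ker (form_dom s) (Qf lam)"
    then obtain y where y: "sol (pot lam) y" "decays y" "y 0 s = 0" "y 1 s = 0" and
      uy: "\<And>x. x \<le> s \<Longrightarrow> u x = y 0 x" and uz: "\<And>x. s < x \<Longrightarrow> u x = 0"
      using c.ker_iff by blast
    have cy: "continuous_on S (y k)" if "k < 4" for k S by (rule sol_continuous_on[OF y(1) that])
    have iy: "set_integrable lborel {..s} (\<lambda>x. (y k x)\<^sup>2)" if "k < 4" for k
      by (rule c.decays_square_integrable[OF y(1,2) that])
    define e where "e k = (if k = 0 then y 0 else if k = 1 then y 1 else if k = 2 then (\<lambda>x. y 2 x - y 0 x)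
      else if k = 3 then (\<lambda>x. y 3 x - y 1 x) else (\<lambda>x. (- y 2 x - pot lam x * y 0 x) - (y 2 x - y 0 x)))" for k :: nat
    \<comment> \<open>\<open>H4_rep\<close> demands \<open>d 0 = u\<close> everywhere, hence zero
      beyond \<open>s\<close>; the other representatives matter only up to \<open>s\<close>.\<close>
    define d where "d k = (if k = 0 then u else e k)" for k
    have de: "d k x = e k x" if "x \<le> s" for k x using uy[OF that] by (simp add: d_def e_def)
    have e_deriv: "(e k has_real_derivative e (Suc k) x) (at x)" if "k < 4" for k x
    proof -
      have "\<forall>k<4. (e k has_real_derivative e (Suc k) x) (at x)"
        unfolding all_less_4
      proof (intro conjI)
        note D = solD[OF y(1), of x]
        show "(e 0 has_real_derivative e (Suc 0) x) (at x)" using D(1) by (simp add: e_def)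
        show "(e 1 has_real_derivative e (Suc 1) x) (at x)" using D(2) by (simp add: e_def)
        show "(e 2 has_real_derivative e (Suc 2) x) (at x)" using DERIV_diff[OF D(3) D(1)] by (simp add: e_def)
        show "(e 3 has_real_derivative e (Suc 3) x) (at x)" using DERIV_diff[OF D(4) D(2)] by (simp add: e_def)
      qed
      then show ?thesis using that by blast
    qed
    have sqi: "sq_integrable_on (d k) {..s}" if "k \<le> 4" for k
    proof (rule sq_integrable_onI[OF _ _ de])
      have comb: "set_integrable lborel {..s} (\<lambda>x. (f x - g x)\<^sup>2)"
        if "set_integrable lborel {..s} (\<lambda>x. (f x)\<^sup>2)" "set_integrable lborel {..s} (\<lambda>x. (g x)\<^sup>2)"
          "continuous_on UNIV f" "continuous_on UNIV g" for f g :: "real \<Rightarrow> real"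
      proof (rule set_integrable_dominated)
        show "set_integrable lborel {..s} (\<lambda>x. 2 * (f x)\<^sup>2 + 2 * (g x)\<^sup>2)"
          using that(1,2) by (intro set_integral_add(1) set_integrable_mult_right)
        show "(\<lambda>x. (f x - g x)\<^sup>2) \<in> borel_measurable borel"
          using that(3,4) by (intro borel_measurable_continuous_onI continuous_intros)
        show "\<bar>(f x - g x)\<^sup>2\<bar> \<le> 2 * (f x)\<^sup>2 + 2 * (g x)\<^sup>2" for x
          unfolding abs_of_nonneg[OF zero_le_power2]
          using zero_le_power2[of "f x + g x"] by (simp add: power2_eq_square algebra_simps)
      qed simp
      have cont_c: "continuous_on UNIV (\<lambda>x. pot lam x * y 0 x)" by (intro continuous_intros c.cont cy) simp
      have py: "set_integrable lborel {..s} (\<lambda>x. (pot lam x * y 0 x)\<^sup>2)"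
      proof (rule set_integrable_dominated)
        show "set_integrable lborel {..s} (\<lambda>x. (bound + lam)\<^sup>2 * (y 0 x)\<^sup>2)"
          using iy[of 0] by (intro set_integrable_mult_right) simp
        show "(\<lambda>x. (pot lam x * y 0 x)\<^sup>2) \<in> borel_measurable borel"
          by (intro borel_measurable_continuous_onI continuous_on_power cont_c)
        show "\<bar>(pot lam x * y 0 x)\<^sup>2\<bar> \<le> (bound + lam)\<^sup>2 * (y 0 x)\<^sup>2" for x
        proof -
          have "(pot lam x)\<^sup>2 \<le> (bound + lam)\<^sup>2" using c.bd[of x] by (rule power2_le_iff_abs_le[THEN iffD2, OF c.M_nonneg])
          then show ?thesis by (simp add: power_mult_distrib mult_right_mono)
        qed
      qed simp
      have my: "set_integrable lborel {..s} (\<lambda>x. (- y 2 x)\<^sup>2)" using iy[of 2] by simp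
      have ce: "\<forall>k<4. continuous_on UNIV (e k)" "continuous_on UNIV (e 4)"
        unfolding all_less_4 e_def using cy cont_c by (auto intro!: continuous_intros)
      have ie: "\<forall>k<4. set_integrable lborel {..s} (\<lambda>x. (e k x)\<^sup>2)" 
        unfolding all_less_4 e_def using cy iy by (auto intro!: comb)
      have ie4: "set_integrable lborel {..s} (\<lambda>x. (e 4 x)\<^sup>2)"
      proof -
        have "continuous_on UNIV (\<lambda>x. - y 2 x)" "continuous_on UNIV (\<lambda>x. - y 2 x - pot lam x * y 0 x)"
          "continuous_on UNIV (\<lambda>x. y 2 x - y 0 x)"
          using cy cont_c by (auto intro!: continuous_intros)
        then have "set_integrable lborel {..s} (\<lambda>x. ((- y 2 x - pot lam x * y 0 x) - (y 2 x - y 0 x))\<^sup>2)"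
          using iy cy cont_c my py by (intro comb) auto
        then show ?thesis by (simp add: e_def)
      qed
      show "continuous_on UNIV (e k)" "set_integrable lborel {..s} (\<lambda>x. (e k x)\<^sup>2)"
        using ce ie ie4 that by (cases "k = 4"; simp)+
    qed
    have rep: "d (Suc k) integrable_on {x..s} \<and> d k x = d k s - integral {x..s} (d (Suc k))" if "k < 4" "x \<le> s" for k x
    proof -
      have "integral {x..s} (d (Suc k)) = integral {x..s} (e (Suc k))" by (rule integral_cong) (use de in auto)
      moreover have "d (Suc k) = e (Suc k)" by (simp add: d_def)
      ultimately show ?thesis using integral_representation[OF that(2) e_deriv[OF that(1)]] de that(2) by simp
    qed
    have "d 0 = u" by (simp add: d_def)
    then have "H4_rep s u d" unfolding H4_rep_def using sqi rep by blast
    moreover have "d 0 s = 0" "d 1 s = 0" using de[of s] y by (auto simp: e_def)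
    moreover have "AE x in lebesgue_on {..s}. - d 4 x - 2 * d 2 x - u x + fnl' \<nu> \<mu> (\<phi> x) * u x = lam * u x"
    proof (rule AE_I2)
      fix x assume "x \<in> space (lebesgue_on {..s})"
      then have "x \<le> s" by simp
      then show "- d 4 x - 2 * d 2 x - u x + fnl' \<nu> \<mu> (\<phi> x) * u x = lam * u x"
        using uy[of x] by (simp add: d_def e_def pot_eq algebra_simps)
    qed
    ultimately show "u \<in> eigenspace_L \<nu> \<mu> \<phi> s lam" unfolding eigenspace_L_def using uz by blast
  next
    fix u assume "u \<in> eigenspace_L \<nu> \<mu> \<phi> s lam"
    then obtain d where uz: "\<And>x. s < x \<Longrightarrow> u x = 0" and d: "H4_rep s u d" "d 0 s = 0" "d 1 s = 0"
      and ae: "AE x in lebesgue_on {..s}. - d 4 x - 2 * d 2 x - u x + fnl' \<nu> \<mu> (\<phi> x) * u x = lam * u x"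
      by (auto simp: eigenspace_L_def)
    have d0: "d 0 = u" and sq: "\<And>k. k \<le> 4 \<Longrightarrow> sq_integrable_on (d k) {..s}"
      and int: "\<And>k x. k < 4 \<Longrightarrow> x \<le> s \<Longrightarrow> d (Suc k) integrable_on {x..s}"
      and rep: "\<And>k x. k < 4 \<Longrightarrow> x \<le> s \<Longrightarrow> d k x = d k s - integral {x..s} (d (Suc k))"
      using d(1) unfolding H4_rep_def by blast+
    have cd: "continuous_on {a..s} (d k)" if "k < 4" for k a
    proof (cases "a \<le> s")
      case True
      have "continuous_on {a..s} (\<lambda>x. d k s - integral {x..s} (d (Suc k)))"
        by (intro continuous_intros indefinite_integral_continuous_1' int[OF that True])
      then show ?thesis by (rule continuous_on_eq) (rule rep[OF that, symmetric], simp)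
    qed simp
    \<comment> \<open>The equation solved for the fourth derivative; unlike \<open>d 4\<close>, this
      expression is continuous.\<close>
    define h where "h x = - 2 * d 2 x - (1 + pot lam x) * d 0 x" for x
    have "AE x in lebesgue. x \<in> {..s} \<longrightarrow> d 4 x = h x"
    proof -
      have "AE x in lebesgue. x \<in> {..s} \<longrightarrow> - d 4 x - 2 * d 2 x - u x + fnl' \<nu> \<mu> (\<phi> x) * u x = lam * u x"
        using ae by (subst (asm) AE_restrict_space_iff) auto
      then show ?thesis
        by eventually_elim (auto simp: h_def d0 pot_eq algebra_simps)
    qed
    then obtain Z where Z: "Z \<in> null_sets lebesgue" "{x. \<not> (x \<in> {..s} \<longrightarrow> d 4 x = h x)} \<subseteq> Z"
      by (auto simp: eventually_ae_filter)
    have neg: "negligible Z" using Z(1) by (simp add: negligible_iff_null_sets)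
    have rep3: "d 3 x = d 3 s - integral {x..s} h" if "x \<le> s" for x
    proof -
      have "integral {x..s} (d 4) = integral {x..s} h"
        by (rule integral_spike[OF neg]) (use Z(2) in auto)
      moreover have "d 3 x = d 3 s - integral {x..s} (d (Suc 3))" by (rule rep) (use that in auto)
      ultimately show ?thesis by simp
    qed
    have ch: "continuous_on {a..s} h" for a
      unfolding h_def by (intro continuous_intros cd continuous_on_subset[OF c.cont]) auto
    obtain y where y: "sol (pot lam) y" "\<And>k. k < 4 \<Longrightarrow> y k s = (if k = 0 then 0 else if k = 1 then 0 else if k = 2 then d 2 s + d 0 s else d 3 s + d 1 s)"
      using c.sol_exists[of s "\<lambda>k. if k = 0 then 0 else if k = 1 then 0 else if k = 2 then d 2 s + d 0 s else d 3 s + d 1 s"] by blast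
    have cy: "continuous_on S (y k)" if "k < 4" for k S by (rule sol_continuous_on[OF y(1) that])
    \<comment> \<open>The jet of \<open>u\<close>, rewritten in the coordinates of
      \<open>sol\<close>, minus the solution with the same data at \<open>s\<close>; it satisfies
      the homogeneous system and vanishes at \<open>s\<close>.\<close>
    define e where "e k = (if k = 0 then (\<lambda>x. d 0 x - y 0 x) else if k = 1 then (\<lambda>x. d 1 x - y 1 x)
      else if k = 2 then (\<lambda>x. d 2 x + d 0 x - y 2 x) else (\<lambda>x. d 3 x + d 1 x - y 3 x))" for k :: nat
    have ez: "e k a = 0" if a: "a \<le> s" and k: "k < 4" for a k
    proof (rule c.zero_left[OF a _ _ _ k])
      have "\<forall>k<4. continuous_on {a..s} (e k)"
        unfolding all_less_4 e_def using cd cy by (auto intro!: continuous_intros)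
      then show "continuous_on {a..s} (e k)" if "k < 4" for k using that by blast
      have "\<forall>k<4. e k s = 0" unfolding all_less_4 e_def using y(2) d by simp
      then show "e k s = 0" if "k < 4" for k using that by blast
      fix k x assume x: "(k::nat) < 4" "a < x" "x < s"
      have dd: "(d j has_real_derivative d (Suc j) x) (at x)" if "j < 3" for j
        by (rule derivative_of_integral_representation[of s _ _ a]) (rule rep cd, use that x in simp_all)+
      have dd3: "(d 3 has_real_derivative h x) (at x)"
        by (rule derivative_of_integral_representation[of s _ _ a]) (rule rep3 ch, (use x in simp_all)?)+
      have dd': "(d 0 has_real_derivative d 1 x) (at x)" "(d 1 has_real_derivative d 2 x) (at x)" "(d 2 has_real_derivative d 3 x) (at x)"
        using dd[of 0] dd[of 1] dd[of 2] by (simp_all add: numeral_2_eq_2 numeral_3_eq_3)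
      have "\<forall>k<4. (e k has_real_derivative vfield (pot lam) x (\<lambda>j. e j x) k) (at x)"
        unfolding all_less_4
      proof (intro conjI)
        show "(e 0 has_real_derivative vfield (pot lam) x (\<lambda>j. e j x) 0) (at x)"
          using DERIV_diff[OF dd'(1) solD(1)[OF y(1)]] by (simp add: e_def vfield_def)
        show "(e 1 has_real_derivative vfield (pot lam) x (\<lambda>j. e j x) 1) (at x)"
          using DERIV_diff[OF dd'(2) solD(2)[OF y(1)]] by (simp add: e_def vfield_def algebra_simps)
        show "(e 2 has_real_derivative vfield (pot lam) x (\<lambda>j. e j x) 2) (at x)"
          using DERIV_diff[OF DERIV_add[OF dd'(3) dd'(1)] solD(3)[OF y(1)]] by (simp add: e_def vfield_def)
        show "(e 3 has_real_derivative vfield (pot lam) x (\<lambda>j. e j x) 3) (at x)"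
          using DERIV_diff[OF DERIV_add[OF dd3 dd'(2)] solD(4)[OF y(1)]] by (simp add: e_def vfield_def h_def algebra_simps)
      qed
      then show "(e k has_real_derivative vfield (pot lam) x (\<lambda>j. e j x) k) (at x)" using x(1) by blast
    qed
    have uy: "u x = y 0 x" if "x \<le> s" for x using ez[OF that, of 0] d0 by (simp add: e_def)
    have dy2: "d 2 x = y 2 x - y 0 x" if "x \<le> s" for x
      using ez[OF that, of 0] ez[OF that, of 2] by (simp add: e_def)
    have "decays y"
    proof (rule c.sol_decays_if_square_integrable(1)[OF y(1)])
      show "set_integrable lborel {..s} (\<lambda>x. (y 0 x)\<^sup>2)"
      proof (rule set_integrable_of_integrable_on_square[OF cy])
        have "(\<lambda>x. (d 0 x)\<^sup>2) integrable_on {..s}" using sq[of 0] by (simp add: sq_integrable_on_def)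
        then show "(\<lambda>x. (y 0 x)\<^sup>2) integrable_on {..s}" by (rule integrable_eq) (use uy d0 in auto)
      qed simp
      show "set_integrable lborel {..s} (\<lambda>x. (y 2 x - y 0 x)\<^sup>2)"
      proof (rule set_integrable_of_integrable_on_square)
        show "continuous_on UNIV (\<lambda>x. y 2 x - y 0 x)" by (intro continuous_intros cy) auto
        have "(\<lambda>x. (d 2 x)\<^sup>2) integrable_on {..s}" using sq[of 2] by (simp add: sq_integrable_on_def)
        then show "(\<lambda>x. (y 2 x - y 0 x)\<^sup>2) integrable_on {..s}" by (rule integrable_eq) (use dy2 in auto)
      qed
    qed
    moreover have "y 0 s = 0" "y 1 s = 0" using y(2) by simp_all
    ultimately show "u \<in> form_ker (form_dom s) (Qf lam)"
      using c.ker_iff y(1) uy uz by blast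
  qed
qed

lemma subspace_Eu_sand: "subspace (Eu_minus \<nu> \<mu> \<phi> x lam \<inter> ell_sand)"
proof (rule subspaceI)
  have B_lin: "Bmat \<nu> \<mu> \<phi> t lam (a *\<^sub>R q + b *\<^sub>R r) = a *\<^sub>R Bmat \<nu> \<mu> \<phi> t lam q + b *\<^sub>R Bmat \<nu> \<mu> \<phi> t lam r" for t a b q r
    by (cases q; cases r) (simp add: Bmat_def algebra_simps)
  have comb: "a *\<^sub>R p + b *\<^sub>R r \<in> Eu_minus \<nu> \<mu> \<phi> x lam \<inter> ell_sand"
    if pr: "p \<in> Eu_minus \<nu> \<mu> \<phi> x lam \<inter> ell_sand" "r \<in> Eu_minus \<nu> \<mu> \<phi> x lam \<inter> ell_sand" for a b p r
  proof -
    obtain f where f: "p = f x" "\<And>t. (f has_vector_derivative Bmat \<nu> \<mu> \<phi> t lam (f t)) (at t)" "(f \<longlongrightarrow> 0) at_bot"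
      using pr(1) by (auto simp: Eu_minus_def)
    obtain g where g: "r = g x" "\<And>t. (g has_vector_derivative Bmat \<nu> \<mu> \<phi> t lam (g t)) (at t)" "(g \<longlongrightarrow> 0) at_bot"
      using pr(2) by (auto simp: Eu_minus_def)
    have "((\<lambda>t. a *\<^sub>R f t + b *\<^sub>R g t) has_vector_derivative Bmat \<nu> \<mu> \<phi> t lam (a *\<^sub>R f t + b *\<^sub>R g t)) (at t)" for t
      unfolding B_lin
      by (intro has_vector_derivative_add bounded_linear.has_vector_derivative[OF bounded_linear_scaleR_right] f(2) g(2))
    moreover have "((\<lambda>t. a *\<^sub>R f t + b *\<^sub>R g t) \<longlongrightarrow> a *\<^sub>R 0 + b *\<^sub>R 0) at_bot" by (intro tendsto_intros f g)
    ultimately have "a *\<^sub>R p + b *\<^sub>R r \<in> Eu_minus \<nu> \<mu> \<phi> x lam"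
      unfolding Eu_minus_def using f(1) g(1) by (intro CollectI exI[of _ "\<lambda>t. a *\<^sub>R f t + b *\<^sub>R g t"]) auto
    moreover have "a *\<^sub>R p + b *\<^sub>R r \<in> ell_sand" using pr by (cases p; cases r) (auto simp: ell_sand_def)
    ultimately show ?thesis by blast
  qed
  have "Bmat \<nu> \<mu> \<phi> t lam 0 = 0" for t by (simp add: Bmat_def zero_prod_def)
  then show "0 \<in> Eu_minus \<nu> \<mu> \<phi> x lam \<inter> ell_sand"
    unfolding Eu_minus_def by (auto simp: ell_sand_def zero_prod_def[symmetric] intro!: exI[of _ "\<lambda>_. 0"])
      (simp add: zero_prod_def)
  show "p + r \<in> Eu_minus \<nu> \<mu> \<phi> x lam \<inter> ell_sand" if "p \<in> Eu_minus \<nu> \<mu> \<phi> x lam \<inter> ell_sand" "r \<in> Eu_minus \<nu> \<mu> \<phi> x lam \<inter> ell_sand" for p r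
    using comb[OF that, of 1 1] by simp
  show "a *\<^sub>R p \<in> Eu_minus \<nu> \<mu> \<phi> x lam \<inter> ell_sand" if "p \<in> Eu_minus \<nu> \<mu> \<phi> x lam \<inter> ell_sand" for a p
    using comb[OF that that, of a 0] by simp
qed

text \<open>Change of coordinates between q = (u, u'', u''' + 2 u', u') and (u, u', u'' + u, u''' +
  u').\<close>

lemma Eu_minus_iff:
  "(q1, q2, q3, q4) \<in> Eu_minus \<nu> \<mu> \<phi> s lam \<longleftrightarrow>
     (\<exists>y. sol (pot lam) y \<and> decays y \<and> y 0 s = q1 \<and> y 1 s = q4 \<and> y 2 s = q1 + q2 \<and> y 3 s = q3 - q4)"
proof
  assume "(q1, q2, q3, q4) \<in> Eu_minus \<nu> \<mu> \<phi> s lam"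
  then obtain q where q: "(q1, q2, q3, q4) = q s" and dq: "\<And>t. (q has_vector_derivative Bmat \<nu> \<mu> \<phi> t lam (q t)) (at t)"
    and lq: "(q \<longlongrightarrow> 0) at_bot" by (auto simp: Eu_minus_def)
  define a b c d where "a t = fst (q t)" and "b t = fst (snd (q t))" and "c t = fst (snd (snd (q t)))" and "d t = snd (snd (snd (q t)))" for t
  have qt: "q t = (a t, b t, c t, d t)" for t by (simp add: a_def b_def c_def d_def)
  have B: "Bmat \<nu> \<mu> \<phi> t lam (q t) = (d t, c t - 2 * d t, (- lam - 1 + fnl' \<nu> \<mu> (\<phi> t)) * a t, b t)" for t
    by (simp add: Bmat_def qt)
  note D = dq[unfolded B has_vector_derivative_def]
  have da: "(a has_real_derivative d t) (at t)" and db: "(b has_real_derivative c t - 2 * d t) (at t)"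
    and dc: "(c has_real_derivative (- lam - 1 + fnl' \<nu> \<mu> (\<phi> t)) * a t) (at t)" and dd: "(d has_real_derivative b t) (at t)" for t
    using has_derivative_fst[OF D[of t]] has_derivative_fst[OF has_derivative_snd[OF D[of t]]]
      has_derivative_fst[OF has_derivative_snd[OF has_derivative_snd[OF D[of t]]]]
      has_derivative_snd[OF has_derivative_snd[OF has_derivative_snd[OF D[of t]]]]
    by (simp_all add: has_field_derivative_def a_def[abs_def] b_def[abs_def] c_def[abs_def] d_def[abs_def] mult.commute[of _ "_::real"] mult_commute_abs)
  have la: "(a \<longlongrightarrow> 0) at_bot" "(b \<longlongrightarrow> 0) at_bot" "(c \<longlongrightarrow> 0) at_bot" "(d \<longlongrightarrow> 0) at_bot"
    using tendsto_fst[OF lq] tendsto_fst[OF tendsto_snd[OF lq]] tendsto_fst[OF tendsto_snd[OF tendsto_snd[OF lq]]]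
      tendsto_snd[OF tendsto_snd[OF tendsto_snd[OF lq]]]
    by (simp_all add: a_def[abs_def] b_def[abs_def] c_def[abs_def] d_def[abs_def])
  define y where "y k = (if k = 0 then a else if k = 1 then d else if k = 2 then (\<lambda>t. a t + b t) else (\<lambda>t. c t - d t))" for k :: nat
  have "sol (pot lam) y"
  proof (rule solI)
    fix t
    show "(y 0 has_real_derivative y 1 t) (at t)" using da by (simp add: y_def)
    show "(y 1 has_real_derivative y 2 t - y 0 t) (at t)" using dd by (simp add: y_def)
    show "(y 2 has_real_derivative y 3 t) (at t)" using DERIV_add[OF da db, of t] by (simp add: y_def)
    show "(y 3 has_real_derivative - y 2 t - pot lam t * y 0 t) (at t)"
      using DERIV_diff[OF dc dd, of t] by (simp add: y_def pot_def W_def algebra_simps)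
  qed
  moreover have "decays y"
    unfolding decays_def all_less_4 using la tendsto_add[OF la(1,2)] tendsto_diff[OF la(3,4)] by (simp add: y_def)
  ultimately show "\<exists>y. sol (pot lam) y \<and> decays y \<and> y 0 s = q1 \<and> y 1 s = q4 \<and> y 2 s = q1 + q2 \<and> y 3 s = q3 - q4"
    using q qt[of s] by (intro exI[of _ y]) (simp add: y_def)
next
  assume "\<exists>y. sol (pot lam) y \<and> decays y \<and> y 0 s = q1 \<and> y 1 s = q4 \<and> y 2 s = q1 + q2 \<and> y 3 s = q3 - q4"
  then obtain y where y: "sol (pot lam) y" "decays y" and ys: "y 0 s = q1" "y 1 s = q4" "y 2 s = q1 + q2" "y 3 s = q3 - q4" by blast
  define q where "q t = (y 0 t, y 2 t - y 0 t, y 3 t + y 1 t, y 1 t)" for t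
  note D = solD[OF y(1)]
  have "(q has_vector_derivative Bmat \<nu> \<mu> \<phi> t lam (q t)) (at t)" for t
  proof -
    have "(q has_vector_derivative (y 1 t, y 3 t - y 1 t, (- y 2 t - pot lam t * y 0 t) + (y 2 t - y 0 t), y 2 t - y 0 t)) (at t)"
      unfolding q_def
      by (intro has_vector_derivative_Pair has_vector_derivative_diff has_vector_derivative_add
          D[unfolded has_real_derivative_iff_has_vector_derivative])
    moreover have "(y 1 t, y 3 t - y 1 t, (- y 2 t - pot lam t * y 0 t) + (y 2 t - y 0 t), y 2 t - y 0 t) = Bmat \<nu> \<mu> \<phi> t lam (q t)"
      by (simp add: Bmat_def q_def pot_def W_def algebra_simps)
    ultimately show ?thesis by simp
  qed
  moreover have "(q \<longlongrightarrow> (0, 0 - 0, 0 + 0, 0)) at_bot"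
    unfolding q_def using y(2) unfolding decays_def all_less_4 by (intro tendsto_intros) auto
  then have "(q \<longlongrightarrow> 0) at_bot" by (simp add: zero_prod_def)
  moreover have "q s = (q1, q2, q3, q4)" using ys by (simp add: q_def)
  ultimately show "(q1, q2, q3, q4) \<in> Eu_minus \<nu> \<mu> \<phi> s lam" unfolding Eu_minus_def by (intro CollectI exI[of _ q]) auto
qed

text \<open>Sending \<open>q\<close> to the solution with these data at \<open>s\<close>, cut off
  beyond \<open>s\<close>, is linear and injective by unique continuation. It maps the intersection
  onto the kernel, where q1 = q4 = 0 is the clamping condition.\<close>

lemma dim_Eu_sand:
  assumes l: "0 \<le> lam"
  shows "dim (Eu_minus \<nu> \<mu> \<phi> s lam \<inter> ell_sand) = nullity s lam"
    "Eu_minus \<nu> \<mu> \<phi> s lam \<inter> ell_sand \<noteq> {0} \<longleftrightarrow> form_ker (form_dom s) (Qf lam) \<noteq> {0}"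
proof -
  interpret c: left_positive_potential "pot lam" "bound + lam" left_end "(- fnl' \<nu> \<mu> 0) / 2" by (rule pot[OF l])
  obtain Y where Ysol: "\<And>\<xi>. sol (pot lam) (Y \<xi>)"
    and Yt: "\<And>p q r t. Y (p, q, r, t) 0 s = p" "\<And>p q r t. Y (p, q, r, t) 1 s = q"
    "\<And>p q r t. Y (p, q, r, t) 2 s = r" "\<And>p q r t. Y (p, q, r, t) 3 s = t"
    and Ylin: "\<And>\<alpha> \<xi> \<beta> \<eta> k x. Y (\<alpha> *\<^sub>R \<xi> + \<beta> *\<^sub>R \<eta>) k x = \<alpha> * Y \<xi> k x + \<beta> * Y \<eta> k x"
    and Yrep: "\<And>y k x. sol (pot lam) y \<Longrightarrow> k < 4 \<Longrightarrow> y k x = Y (y 0 s, y 1 s, y 2 s, y 3 s) k x"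
    by (rule c.sol_parametrization[of s]) blast
  define J :: "real \<times> real \<times> real \<times> real \<Rightarrow> real \<times> real \<times> real \<times> real"
    where "J q = (case q of (q1, q2, q3, q4) \<Rightarrow> (q1, q4, q1 + q2, q3 - q4))" for q
  \<comment> \<open>Defined on all of R^4, so that linearity and injectivity need no reference to
    decay.\<close>
  define T where "T q x = (if x \<le> s then Y (J q) 0 x else 0)" for q x
  have J_lin: "J (\<alpha> *\<^sub>R p + \<beta> *\<^sub>R q) = \<alpha> *\<^sub>R J p + \<beta> *\<^sub>R J q" for \<alpha> \<beta> p q
    by (cases p; cases q) (simp add: J_def algebra_simps)
  have T_comb: "T (\<alpha> *\<^sub>R p + \<beta> *\<^sub>R q) = \<alpha> *\<^sub>R T p + \<beta> *\<^sub>R T q" for \<alpha> \<beta> p q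
    by (rule ext) (simp add: T_def J_lin Ylin)
  have T: "linear T"
    by (rule linearI) (use T_comb[of 1 _ 1] T_comb[of _ _ 0 0] in auto)
  have "inj T"
  proof (rule linear_injective_0[OF T, THEN iffD2], intro allI impI)
    fix q assume "T q = 0"
    then have z: "Y (J q) 0 x = 0" if "x < s" for x using that by (auto simp: T_def fun_eq_iff split: if_splits dest!: spec[of _ x])
    have "\<forall>k<4. Y (J q) k s = 0" using c.sol_zero_on_interval[OF Ysol, of "s - 1" s] z by auto
    moreover obtain q1 q2 q3 q4 where "q = (q1, q2, q3, q4)" by (cases q) auto
    ultimately show "q = 0" unfolding all_less_4 by (simp add: J_def Yt zero_prod_def del: One_nat_def)
  qed
  have img: "T ` (Eu_minus \<nu> \<mu> \<phi> s lam \<inter> ell_sand) = form_ker (form_dom s) (Qf lam)"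
  proof (intro set_eqI iffI)
    fix u assume "u \<in> T ` (Eu_minus \<nu> \<mu> \<phi> s lam \<inter> ell_sand)"
    then obtain q2 q3 where q: "(0, q2, q3, 0) \<in> Eu_minus \<nu> \<mu> \<phi> s lam" and u: "u = T (0, q2, q3, 0)"
      by (auto simp: ell_sand_def)
    obtain y where y: "sol (pot lam) y" "decays y" "y 0 s = 0" "y 1 s = 0" "y 2 s = q2" "y 3 s = q3"
      using q unfolding Eu_minus_iff by auto
    have "Y (J (0, q2, q3, 0)) 0 x = y 0 x" for x using Yrep[OF y(1), of 0 x] y by (simp add: J_def)
    then show "u \<in> form_ker (form_dom s) (Qf lam)" unfolding c.ker_iff u
      using y by (intro exI[of _ y]) (simp add: T_def)
  next
    fix u assume "u \<in> form_ker (form_dom s) (Qf lam)"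
    then obtain y where y: "sol (pot lam) y" "decays y" "y 0 s = 0" "y 1 s = 0" "\<forall>x\<le>s. u x = y 0 x" "\<forall>x>s. u x = 0"
      unfolding c.ker_iff by blast
    let ?q = "(0, y 2 s, y 3 s, 0) :: real \<times> real \<times> real \<times> real"
    have "?q \<in> Eu_minus \<nu> \<mu> \<phi> s lam" unfolding Eu_minus_iff using y by (intro exI[of _ y]) simp
    moreover have "?q \<in> ell_sand" by (simp add: ell_sand_def)
    moreover have "Y (J ?q) 0 x = y 0 x" for x using Yrep[OF y(1), of 0 x] y by (simp add: J_def)
    then have "u = T ?q" using y by (auto simp: T_def fun_eq_iff)
    ultimately show "u \<in> T ` (Eu_minus \<nu> \<mu> \<phi> s lam \<inter> ell_sand)" by blast
  qed
  show "dim (Eu_minus \<nu> \<mu> \<phi> s lam \<inter> ell_sand) = nullity s lam"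
    unfolding nullity_def img[symmetric] by (rule dim_image_linear[OF T \<open>inj T\<close> subspace_Eu_sand, symmetric])
  have "T ` V = {0} \<longleftrightarrow> V = {0}" for V
  proof -
    have "T ` V = T ` {0} \<longleftrightarrow> V = {0}" using \<open>inj T\<close> by (rule inj_image_eq_iff)
    then show ?thesis using linear_0[OF T] by simp
  qed
  then show "Eu_minus \<nu> \<mu> \<phi> s lam \<inter> ell_sand \<noteq> {0} \<longleftrightarrow> form_ker (form_dom s) (Qf lam) \<noteq> {0}"
    unfolding img[symmetric] by simp
qed

lemma ker_nontrivial_iff: "0 \<le> lam \<Longrightarrow> form_ker (form_dom s) (Qf lam) \<noteq> {0} \<longleftrightarrow> nullity s lam \<noteq> 0"
  unfolding nullity_def using diagonal_form.ker_trivial_iff diagonal by metis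

lemma eigenvalue_count:
  "count_mult {lam. lam > 0 \<and> is_eigenvalue_L \<nu> \<mu> \<phi> s lam} (eig_mult_L \<nu> \<mu> \<phi> s) = enat (index_at s 0)"
proof -
  have "{lam. lam > 0 \<and> is_eigenvalue_L \<nu> \<mu> \<phi> s lam} = {lam. 0 < lam \<and> nullity s lam \<noteq> 0}"
  proof (rule Collect_cong)
    show "lam > 0 \<and> is_eigenvalue_L \<nu> \<mu> \<phi> s lam \<longleftrightarrow> 0 < lam \<and> nullity s lam \<noteq> 0" for lam
      using eigenspace_eq_ker[of lam s] ker_nontrivial_iff[of lam s] unfolding is_eigenvalue_L_def
      by (cases "0 < lam") simp_all
  qed
  moreover have "(\<Sum>lam\<in>{lam. 0 < lam \<and> nullity s lam \<noteq> 0}. eig_mult_L \<nu> \<mu> \<phi> s lam)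
      = (\<Sum>lam\<in>{lam. 0 < lam \<and> nullity s lam \<noteq> 0}. nullity s lam)"
    by (rule sum.cong) (auto simp: eig_mult_L_def dim_fscale eigenspace_eq_ker nullity_def)
  ultimately show ?thesis using count_in_spectral_parameter[of s] by (simp add: count_mult_def)
qed

lemma conjugate_point_count:
  "count_mult {x. x < L \<and> is_conj_point \<nu> \<mu> \<phi> x} (conj_mult \<nu> \<mu> \<phi>) = enat (index_at L 0)"
proof -
  have "{x. x < L \<and> is_conj_point \<nu> \<mu> \<phi> x} = {x. x < L \<and> nullity x 0 \<noteq> 0}"
    using dim_Eu_sand(2)[OF order_refl] ker_nontrivial_iff[OF order_refl] by (simp add: is_conj_point_def)
  moreover have "conj_mult \<nu> \<mu> \<phi> x = nullity x 0" for x by (simp add: conj_mult_def dim_Eu_sand(1))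
  ultimately show ?thesis using count_in_endpoint[of L] by (simp add: count_mult_def)
qed

end

theorem theorem3:
  fixes \<nu> \<mu> L :: real and \<phi> :: "real \<Rightarrow> real"
  assumes "H1 \<nu> \<mu> \<phi>" and "H2 \<nu> \<mu>" and "H3 \<nu> \<mu> \<phi>"
  shows "count_mult {lam. lam > 0 \<and> is_eigenvalue_L \<nu> \<mu> \<phi> L lam} (eig_mult_L \<nu> \<mu> \<phi> L)
       = count_mult {x. x < L \<and> is_conj_point \<nu> \<mu> \<phi> x} (conj_mult \<nu> \<mu> \<phi>)"
proof -
  interpret pulse \<nu> \<mu> \<phi> using assms(1,2) by unfold_locales
  show ?thesis unfolding eigenvalue_count conjugate_point_count ..
qed

end
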